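(* Assume that $1<p<N$, $-\infty<\mu<\bar{\mu}=((N-p)/p)^{p}$ and $0\le s<p$, and let $p^{*}(s)=(N-s)p/(N-p)$. Then up to a dilation $u^{\tau}(x)=\tau^{\frac{N-p}{p}}u(\tau x)$, $\tau>0$, there exists at most one positive radial (weak) solution $u\in\mathcal{D}^{1,p}(\mathbb{R}^{N})$ to the equation $$-\Delta_{p}u-\frac{\mu}{|x|^{p}}|u|^{p-2}u=\frac{|u|^{p^{*}(s)-2}u}{|x|^{s}}\qquad\text{in }\mathbb{R}^{N}.$$ Moreover, $u$ satisfies the estimates $$\lim_{|x|\to 0}u(x)|x|^{\gamma_{1}}=C_{1}\quad\text{and}\quad \lim_{|x|\to\infty}u(x)|x|^{\gamma_{2}}=C_{2},$$ $$\lim_{|x|\to 0}|\nabla u(x)||x|^{\gamma_{1}+1}=|\gamma_{1}|C_{1}\quad\text{and}\quad \lim_{|x|\to\infty}|\nabla u(x)||x|^{\gamma_{2}+1}=\gamma_{2}C_{2},$$ where $C_{1},C_{2}>0$ are constants depending only on $N,p$ and $\mu$, and $\gamma_{1}<\gamma_{2}$ are the two real roots of $\Gamma_{\mu}(\gamma)=(p-1)|\gamma|^{p}-(N-p)|\gamma|^{p-2}\gamma+\mu$.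
   Context: $N$ is the dimension of $\mathbb{R}^{N}$ and $\Delta_{p}u=\sum_{i=1}^{N}\partial_{x_{i}}(|\nabla u|^{p-2}\partial_{x_{i}}u)$ is the $p$-Laplacian. $\mathcal{D}^{1,p}(\mathbb{R}^{N})$ is the completion of $C_{0}^{\infty}(\mathbb{R}^{N})$ (smooth functions with compact support) in the seminorm $\|v\|_{\mathcal{D}^{1,p}(\mathbb{R}^{N})}=\|\nabla v\|_{L^{p}(\mathbb{R}^{N})}$. A (weak) solution is a function $u\in\mathcal{D}^{1,p}(\mathbb{R}^{N})$ such that for every $\varphi\in C_{0}^{\infty}(\mathbb{R}^{N})$, $$\int_{\mathbb{R}^{N}}\left(|\nabla u|^{p-2}\nabla u\cdot\nabla\varphi-\frac{\mu}{|x|^{p}}|u|^{p-2}u\varphi\right)dx=\int_{\mathbb{R}^{N}}\frac{|u|^{p^{*}(s)-2}u}{|x|^{s}}\varphi\, dx.$$ Radial means radial with respect to the origin. The equation is invariant under the dilation: if $u$ is a solution, so is $u^{\tau}$ for every $\tau>0$; "at most one up to a dilation" means that any two positive radial solutions in $\mathcal{D}^{1,p}(\mathbb{R}^{N})$ are dilations of each other. Under $1<p<N$ and $-\infty<\mu<\bar{\mu}$, the equation $\Gamma_{\mu}(\gamma)=0$, $\gamma\in\mathbb{R}$, has exactly two solutions.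
   Formalization: The constants C1, C2 cannot depend only on N, p, μ: dilating u changes them, and C1·C2 varies with s (p=2, μ=0, N=3). Instead, each u has its own C1, C2 > 0, and one pair depending on N, p, μ, s serves every solution after a dilation. *)

theory Defs
  imports "HOL-Analysis.Analysis"
begin

definition grad :: "(real ^ 'n \<Rightarrow> real) \<Rightarrow> real ^ 'n \<Rightarrow> real ^ 'n" where
  "grad f x = (THE D. GDERIV f x :> D)"

text \<open>\<open>C_k k f\<close>: \<open>f\<close> is of class \<open>C\<^sup>k\<close> on the whole space; \<open>grad f x $ i\<close> is the \<open>i\<close>-th
  partial derivative.\<close>

primrec C_k :: "nat \<Rightarrow> (real ^ 'n \<Rightarrow> real) \<Rightarrow> bool" where
  "C_k 0 f \<longleftrightarrow> continuous_on UNIV f"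
| "C_k (Suc k) f \<longleftrightarrow> (\<forall>x. f differentiable (at x)) \<and> (\<forall>i. C_k k (\<lambda>x. grad f x $ i))"

definition test_function :: "(real ^ 'n \<Rightarrow> real) \<Rightarrow> bool" where
  "test_function \<phi> \<longleftrightarrow> (\<forall>k. C_k k \<phi>) \<and> compact (closure {x. \<phi> x \<noteq> 0})"

definition crit_exp :: "real \<Rightarrow> real \<Rightarrow> real \<Rightarrow> real" where
  "crit_exp N p s = (N - s) * p / (N - p)"

text \<open>The completion of the test functions in the seminorm \<open>\<parallel>\<nabla>v\<parallel>\<close> of \<open>L\<^sup>p\<close>, for \<open>1 < p < N\<close>.
  By Sobolev's inequality a sequence that is Cauchy in this seminorm is also Cauchy in \<open>L\<^sup>q\<close> with
  \<open>q = N p / (N - p)\<close>, so an element of the completion is identified with the function \<open>u\<close> which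
  is the limit in \<open>L\<^sup>q\<close>, and its gradient is the limit \<open>g\<close> of the gradients in \<open>L\<^sup>p\<close>. Both \<open>u\<close> and
  \<open>g\<close> are representatives, determined up to null sets.\<close>

definition D1p_with_gradient ::
    "real \<Rightarrow> (real ^ 'n \<Rightarrow> real) \<Rightarrow> (real ^ 'n \<Rightarrow> real ^ 'n) \<Rightarrow> bool" where
  "D1p_with_gradient p u g \<longleftrightarrow>
     u \<in> borel_measurable lebesgue \<and> g \<in> borel_measurable lebesgue \<and>
     (\<exists>\<phi>. (\<forall>k::nat. test_function (\<phi> k)) \<and>
        (\<lambda>k. \<integral>\<^sup>+ x. ennreal (norm (grad (\<phi> k) x - g x) powr p) \<partial>lebesgue)
           \<longlonglongrightarrow> 0 \<and>
        (\<lambda>k. \<integral>\<^sup>+ x. ennreal (\<bar>\<phi> k x - u x\<bar> powr crit_exp (real CARD('n)) p 0) \<partial>lebesgue)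
           \<longlonglongrightarrow> 0)"

text \<open>In the products \<open>r powr (p - 2) * \<dots>\<close> the convention \<open>0 powr a = 0\<close> gives
  \<open>|\<xi>|\<^sup>p\<^sup>-\<^sup>2 \<xi> = 0\<close> at \<open>\<xi> = 0\<close>, also for \<open>p < 2\<close>. By the Hardy and Hardy-Sobolev inequalities
  all the integrands are integrable, so the integrals do not take a default value.\<close>

definition weak_solution :: "real \<Rightarrow> real \<Rightarrow> real \<Rightarrow> (real ^ 'n \<Rightarrow> real) \<Rightarrow> bool" where
  "weak_solution p \<mu> s u \<longleftrightarrow>
     (\<exists>g. D1p_with_gradient p u g \<and>
        (\<forall>\<phi>. test_function \<phi> \<longrightarrow>
           (\<integral>x. (norm (g x) powr (p - 2) * (g x \<bullet> grad \<phi> x)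
                  - \<mu> / norm x powr p * (\<bar>u x\<bar> powr (p - 2) * u x) * \<phi> x) \<partial>lebesgue)
           = (\<integral>x. \<bar>u x\<bar> powr (crit_exp (real CARD('n)) p s - 2) * u x / norm x powr s * \<phi> x
                \<partial>lebesgue)))"

definition radial :: "(real ^ 'n \<Rightarrow> real) \<Rightarrow> bool" where
  "radial u \<longleftrightarrow> (\<exists>f. AE x in lebesgue. u x = f (norm x))"

definition pos_radial_solution :: "real \<Rightarrow> real \<Rightarrow> real \<Rightarrow> (real ^ 'n \<Rightarrow> real) \<Rightarrow> bool" where
  "pos_radial_solution p \<mu> s u \<longleftrightarrow>
     weak_solution p \<mu> s u \<and> (AE x in lebesgue. u x > 0) \<and> radial u"

definition dilation :: "real \<Rightarrow> real \<Rightarrow> (real ^ 'n \<Rightarrow> real) \<Rightarrow> real ^ 'n \<Rightarrow> real" where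
  "dilation p \<tau> u x = \<tau> powr ((real CARD('n) - p) / p) * u (\<tau> *\<^sub>R x)"

definition Gamma_mu :: "real \<Rightarrow> real \<Rightarrow> real \<Rightarrow> real \<Rightarrow> real" where
  "Gamma_mu N p \<mu> \<gamma> =
     (p - 1) * \<bar>\<gamma>\<bar> powr p - (N - p) * (\<bar>\<gamma>\<bar> powr (p - 2) * \<gamma>) + \<mu>"

text \<open>\<open>u\<close> is given up to null sets, while the estimates are about pointwise values of \<open>u\<close> and
  \<open>\<nabla>u\<close>. They refer to the representative \<open>w\<close> that is differentiable away from the origin; it is
  continuous there, hence unique away from the origin.\<close>

definition asymptotic_estimates ::
    "real \<Rightarrow> real \<Rightarrow> real \<Rightarrow> real \<Rightarrow> (real ^ 'n \<Rightarrow> real) \<Rightarrow> bool" where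
  "asymptotic_estimates \<gamma>\<^sub>1 \<gamma>\<^sub>2 C\<^sub>1 C\<^sub>2 u \<longleftrightarrow>
     (\<exists>w. (AE x in lebesgue. w x = u x) \<and> (\<forall>x. x \<noteq> 0 \<longrightarrow> w differentiable (at x)) \<and>
        ((\<lambda>x. w x * norm x powr \<gamma>\<^sub>1) \<longlongrightarrow> C\<^sub>1) (at 0) \<and>
        ((\<lambda>x. w x * norm x powr \<gamma>\<^sub>2) \<longlongrightarrow> C\<^sub>2) at_infinity \<and>
        ((\<lambda>x. norm (grad w x) * norm x powr (\<gamma>\<^sub>1 + 1)) \<longlongrightarrow> \<bar>\<gamma>\<^sub>1\<bar> * C\<^sub>1) (at 0) \<and>
        ((\<lambda>x. norm (grad w x) * norm x powr (\<gamma>\<^sub>2 + 1)) \<longlongrightarrow> \<gamma>\<^sub>2 * C\<^sub>2) at_infinity)"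

end

theory Submission
  imports Defs
begin

text \<open>Write \<open>t = ln |x|\<close>, \<open>\<kappa> = (N - p) / p\<close>, \<open>p' = p / (p - 1)\<close> and \<open>q = p*(s)\<close>. A radial function
\<open>u(x) = F (ln |x|)\<close> is rescaled to \<open>V t = e^(\<kappa> t) F t\<close>; a dilation of \<open>u\<close> is then a translation
of \<open>V\<close>. With \<open>y\<close> the radial flux \<open>|u'|^(p-2) u'\<close>, multiplied by \<open>e^(\<kappa> (p-1) t + (p-1) t)\<close>, the
equation becomes the autonomous Hamiltonian system
\<open>V' = \<kappa> V + |y|^(p'-2) y\<close>, \<open>y' = - \<kappa> y - \<mu> V^(p-1) - V^(q-1)\<close>.

The energy \<open>\<kappa> V y + |y|^p' / p' + \<mu> V^p / p + V^q / q\<close> is conserved. For a function in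
\<open>D^{1,p}\<close> both \<open>V^(p*(0))\<close> and \<open>|y|^p'\<close> are integrable on the line, so \<open>V\<close> and \<open>y\<close> are small
simultaneously at suitable times and the energy is zero (\<open>emden_fowler.energy\<close>). On this level
\<open>V\<close> has no zeros, and the slope \<open>\<gamma> = - r u' / u\<close> and its power
\<open>\<theta> = |\<gamma>|^(p-2) \<gamma> = - y / V^(p-1)\<close> satisfy
\<open>P \<theta> = (p / q) V^(q-p)\<close> with \<open>P \<theta> = \<kappa> p \<theta> - \<mu> - (p-1) |\<theta>|^p' = - \<Gamma>\<^sub>\<mu> \<gamma>\<close>.
This recovers \<open>V\<close> from \<open>\<theta>\<close>, and eliminating \<open>V\<close> leaves the scalar equation
\<open>\<theta>' = ((q-p) / p) P \<theta>\<close>, whose right-hand side is a concave function, positive along the orbit.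

Uniqueness: by separation of variables two orbits of this scalar equation are translates of each
other (\<open>shift_unique_of_autonomous\<close>), so the two solutions are dilations of each other.
Asymptotics: \<open>\<theta>\<close> increases from one root of \<open>P\<close> to the other at an exponential rate, and the
derivative \<open>\<gamma>\<^sub>i - \<gamma>\<close> of \<open>ln (V e^((\<gamma>\<^sub>i - \<kappa>) t))\<close> is integrable (\<open>approach_to_root\<close>), which
gives the limits of \<open>u |x|^\<gamma>\<^sub>i\<close>; the limits of the gradient follow from \<open>|u'| = |\<gamma>| u / r\<close>.

It remains to pass from the weak formulation to the system. A function in \<open>D^{1,p}\<close> is known
only up to null sets and its gradient \<open>g\<close> only as a limit of gradients of test functions. For a
flow \<open>\<Theta>\<close> generated by a vector field \<open>X\<close>, the increment \<open>u (\<Theta> a x) - u x\<close> is, for almost all \<open>x\<close>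
and \<open>a\<close>, the integral of \<open>g \<bullet> X\<close> along the orbit (\<open>measurable_flow.AE_increment\<close>). For dilations
this shows that \<open>F\<close> is absolutely continuous with derivative \<open>g \<bullet> x\<close>; for rotations in a
coordinate plane the increment vanishes, and \<open>g\<close> is parallel to \<open>x\<close> (\<open>radial_gradient\<close>). Test
functions of \<open>ln |x|\<close> turn the weak equation into one on the line, and the lemma of du
Bois-Reymond shows that the flux is continuously differentiable (\<open>solution_emden_fowler\<close>).\<close>

section \<open>Signed powers\<close>

text \<open>The duality map of exponent \<open>a\<close>: for conjugate exponents \<open>a\<close> and \<open>b\<close> the maps \<open>spow a\<close> and
  \<open>spow b\<close> are inverse to each other. It turns a gradient into a flux, and a slope \<open>\<gamma>\<close> into the
  variable \<open>\<theta>\<close> whose equation has a concave right-hand side.\<close>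

definition spow :: "real \<Rightarrow> real \<Rightarrow> real" where
  "spow a z = \<bar>z\<bar> powr (a - 2) * z"

lemma spow_eq_sgn: "spow a z = sgn z * \<bar>z\<bar> powr (a - 1)"
proof (cases "z = 0")
  case False
  have "\<bar>z\<bar> powr (a - 1) = \<bar>z\<bar> powr (a - 2) * \<bar>z\<bar> powr 1"
    using powr_add[of "\<bar>z\<bar>" "a - 2" 1] by (simp add: algebra_simps)
  then show ?thesis using False by (auto simp: spow_def sgn_if)
qed (simp add: spow_def)

lemma spow_0 [simp]: "spow a 0 = 0"
  by (simp add: spow_def)

lemma abs_spow: "\<bar>spow a z\<bar> = \<bar>z\<bar> powr (a - 1)"
  by (cases "z = 0") (auto simp: spow_eq_sgn abs_mult sgn_if)

lemma sgn_spow: "sgn (spow a z) = sgn z"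
  by (cases "z = 0") (auto simp: spow_eq_sgn sgn_mult sgn_if)

lemma spow_nonneg: "0 \<le> z \<Longrightarrow> spow a z = z powr (a - 1)"
  by (cases "z = 0") (auto simp: spow_eq_sgn)

lemma spow_minus: "spow a (- z) = - spow a z"
  by (simp add: spow_def)

lemma spow_mult_self: "spow a z * z = \<bar>z\<bar> powr a"
proof (cases "z = 0")
  case False
  have "\<bar>z\<bar> powr a = \<bar>z\<bar> powr (a - 1) * \<bar>z\<bar> powr 1"
    using powr_add[of "\<bar>z\<bar>" "a - 1" 1] by (simp add: algebra_simps)
  then show ?thesis using False by (auto simp: spow_eq_sgn sgn_if)
qed simp

lemma spow_mult: "0 < c \<Longrightarrow> spow a (c * z) = c powr (a - 1) * spow a z"
  by (simp add: spow_eq_sgn abs_mult powr_mult sgn_mult)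

lemma spow_inverse:
  assumes "(a - 1) * (b - 1) = 1"
  shows "spow b (spow a z) = z"
proof -
  have "spow b (spow a z) = sgn z * \<bar>z\<bar> powr ((a - 1) * (b - 1))"
    by (subst spow_eq_sgn) (simp add: sgn_spow abs_spow powr_powr)
  then show ?thesis using assms by (cases "z = 0") (auto simp: sgn_mult_abs)
qed

lemma has_real_derivative_abs_powr:
  assumes "1 < a"
  shows "((\<lambda>x. \<bar>x\<bar> powr a) has_real_derivative a * spow a x) (at x)"
proof (cases "x = 0")
  case True
  have "(\<lambda>h. \<bar>h\<bar> powr (a - 1)) \<midarrow>0\<rightarrow> 0"
    using tendsto_powr'[of "\<lambda>h::real. \<bar>h\<bar>" 0 "at 0" "\<lambda>_. a - 1" "a - 1"] assms
    by (auto intro!: tendsto_eq_intros)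
  then have "(\<lambda>h. sgn h * \<bar>h\<bar> powr (a - 1)) \<midarrow>0\<rightarrow> 0"
    by (rule Lim_null_comparison[rotated]) (auto simp: abs_mult sgn_if)
  moreover have "\<bar>h\<bar> powr a / h = sgn h * \<bar>h\<bar> powr (a - 1)" if "h \<noteq> 0" for h :: real
    using that spow_mult_self[of a h] by (simp add: spow_eq_sgn field_simps)
  ultimately have "(\<lambda>h. \<bar>h\<bar> powr a / h) \<midarrow>0\<rightarrow> 0"
    by (auto intro: Lim_transform_eventually simp: eventually_at_filter)
  then show ?thesis using True by (simp add: DERIV_def)
next
  case False
  show ?thesis
  proof (cases "x > 0")
    case True
    have "((\<lambda>x. x powr a) has_real_derivative a * spow a x) (at x)"
      using True by (auto intro!: derivative_eq_intros simp: spow_nonneg)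
    moreover have "eventually (\<lambda>x. x powr a = \<bar>x\<bar> powr a) (nhds x)"
      using eventually_nhds_in_open[of "{0<..}" x] True by (auto elim!: eventually_mono)
    ultimately show ?thesis by (simp add: DERIV_cong_ev)
  next
    case False
    with \<open>x \<noteq> 0\<close> have neg: "x < 0" by simp
    have "((\<lambda>x. (- x) powr a) has_real_derivative a * spow a x) (at x)"
      using neg by (auto intro!: derivative_eq_intros simp: spow_eq_sgn)
    moreover have "eventually (\<lambda>x. (- x) powr a = \<bar>x\<bar> powr a) (nhds x)"
      using eventually_nhds_in_open[of "{..<0}" x] neg by (auto elim!: eventually_mono)
    ultimately show ?thesis by (simp add: DERIV_cong_ev)
  qed
qed

lemma has_real_derivative_spow:
  assumes "x \<noteq> 0"
  shows "(spow a has_real_derivative (a - 1) * \<bar>x\<bar> powr (a - 2)) (at x)"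
proof (cases "x > 0")
  case True
  have "((\<lambda>x. x powr (a - 1)) has_real_derivative (a - 1) * \<bar>x\<bar> powr (a - 2)) (at x)"
    using True by (auto intro!: derivative_eq_intros)
  moreover have "eventually (\<lambda>x. x powr (a - 1) = spow a x) (nhds x)"
    using eventually_nhds_in_open[of "{0<..}" x] True
    by (auto elim!: eventually_mono simp: spow_nonneg)
  ultimately show ?thesis by (simp add: DERIV_cong_ev)
next
  case False
  with assms have neg: "x < 0" by simp
  have "((\<lambda>x. - ((- x) powr (a - 1))) has_real_derivative (a - 1) * \<bar>x\<bar> powr (a - 2)) (at x)"
    using neg by (auto intro!: derivative_eq_intros)
  moreover have "eventually (\<lambda>x. - ((- x) powr (a - 1)) = spow a x) (nhds x)"
    using eventually_nhds_in_open[of "{..<0}" x] neg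
    by (auto elim!: eventually_mono simp: spow_eq_sgn)
  ultimately show ?thesis by (simp add: DERIV_cong_ev)
qed

lemma isCont_spow:
  assumes "1 < a"
  shows "isCont (spow a) x"
proof (cases "x = 0")
  case True
  have "(\<lambda>h. \<bar>h\<bar> powr (a - 1)) \<midarrow>0\<rightarrow> 0"
    using tendsto_powr'[of "\<lambda>h::real. \<bar>h\<bar>" 0 "at 0" "\<lambda>_. a - 1" "a - 1"] assms
    by (auto intro!: tendsto_eq_intros)
  then have "spow a \<midarrow>0\<rightarrow> 0"
    by (rule Lim_null_comparison[rotated]) (auto simp: abs_spow)
  then show ?thesis using True by (simp add: isCont_def)
next
  case False
  then show ?thesis using has_real_derivative_spow DERIV_isCont by blast
qed

lemma continuous_on_spow [continuous_intros]:
  assumes "1 < a" "continuous_on S f"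
  shows "continuous_on S (\<lambda>x. spow a (f x))"
proof -
  have "continuous_on UNIV (spow a)"
    using isCont_spow[OF assms(1)] by (simp add: continuous_at_imp_continuous_on)
  then show ?thesis using assms(2) continuous_on_compose2 by blast
qed

lemma spow_strict_mono:
  assumes "1 < a" "x < y"
  shows "spow a x < spow a y"
proof -
  consider "0 \<le> x" | "x < 0" "0 < y" | "x < 0" "y \<le> 0" by linarith
  then show ?thesis
  proof cases
    case 1
    then show ?thesis using assms by (auto simp: spow_nonneg intro!: powr_less_mono2)
  next
    case 2
    then show ?thesis by (simp add: spow_eq_sgn)
       (smt (verit) powr_gt_zero)
  next
    case 3
    then have "spow a (- y) < spow a (- x)"
      using assms by (auto simp: spow_nonneg intro!: powr_less_mono2)
    then show ?thesis by (simp add: spow_minus)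
  qed
qed

lemma spow_less_iff: "1 < a \<Longrightarrow> spow a x < spow a y \<longleftrightarrow> x < y"
  by (metis spow_strict_mono linorder_neqE_linordered_idom order_less_asym)

lemma spow_le_iff: "1 < a \<Longrightarrow> spow a x \<le> spow a y \<longleftrightarrow> x \<le> y"
  by (metis spow_less_iff not_le)

lemma convex_on_abs_powr: "1 < a \<Longrightarrow> convex_on UNIV (\<lambda>x::real. \<bar>x\<bar> powr a)"
  by (rule convex_on_realI[where f' = "\<lambda>x. a * spow a x"])
     (auto simp: has_real_derivative_abs_powr spow_le_iff)

section \<open>Scalar autonomous equations with a concave right-hand side\<close>

text \<open>Separation of variables. The clock \<open>T\<close>, a primitive of \<open>1 / P\<close>, advances at unit speed along
  every solution, and it is injective because \<open>P\<close> is positive. Concavity makes \<open>{x. P x > 0}\<close> an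
  interval, so that one clock serves both solutions.\<close>

lemma shift_unique_of_autonomous:
  fixes P a b :: "real \<Rightarrow> real"
  assumes cont: "continuous_on UNIV P" and conc: "concave_on UNIV P"
    and a: "\<And>t. (a has_real_derivative P (a t)) (at t)" "\<And>t. P (a t) > 0"
    and b: "\<And>t. (b has_real_derivative P (b t)) (at t)" "\<And>t. P (b t) > 0"
  shows "\<exists>\<sigma>. \<forall>t. b t = a (t + \<sigma>)"
proof -
  define I where "I = {x. P x > 0}"
  have "open I"
    unfolding I_def using cont by (intro open_Collect_less continuous_on_const)
  have seg: "{x..y} \<subseteq> I" if "x \<in> I" "y \<in> I" for x y
  proof
    fix z assume z: "z \<in> {x..y}"
    show "z \<in> I"
    proof (cases "x = y")
      case False
      with z have xy: "x < y" by auto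
      define u where "u = (z - x) / (y - x)"
      have u: "0 \<le> u" "u \<le> 1"
        using z xy by (auto simp: u_def field_simps)
      have "u * (y - x) = z - x" using xy by (simp add: u_def)
      then have uz: "z = (1 - u) * x + u * y" by (simp add: algebra_simps)
      have "(1 - u) * P x + u * P y \<le> P z"
        using concave_onD[OF conc u, of x y] uz by simp
      moreover have "(1 - u) * P x + u * P y > 0"
        using that u unfolding I_def
        by (smt (verit) mult_nonneg_nonneg mult_pos_pos mem_Collect_eq)
      ultimately show ?thesis by (simp add: I_def)
    qed (use that z in auto)
  qed
  define x0 where "x0 = a 0"
  have x0: "x0 \<in> I" using a(2) by (simp add: x0_def I_def)
  define T where "T x = (LBINT y=x0..x. 1 / P y)" for x :: real
  have T: "(T has_real_derivative 1 / P x) (at x)" if x: "x \<in> I" for x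
  proof -
    obtain e1 where e1: "e1 > 0" "cball x0 e1 \<subseteq> I"
      using \<open>open I\<close> x0 open_contains_cball by metis
    obtain e2 where e2: "e2 > 0" "cball x e2 \<subseteq> I"
      using \<open>open I\<close> x open_contains_cball by metis
    define l where "l = min (x0 - e1) (x - e2)"
    define r where "r = max (x0 + e1) (x + e2)"
    have "l \<in> I" "r \<in> I"
      using e1 e2 by (auto simp: l_def r_def min_def max_def subset_iff dist_real_def)
    then have lr: "{l..r} \<subseteq> I" by (rule seg)
    have "continuous_on {l..r} (\<lambda>y. 1 / P y)"
      using lr by (intro continuous_intros continuous_on_subset[OF cont]) (auto simp: I_def)
    then have "((\<lambda>u. LBINT y=x0..u. 1 / P y) has_vector_derivative 1 / P x) (at x within {l..r})"
      using e1 e2 by (intro interval_integral_FTC2) (auto simp: l_def r_def)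
    moreover have "at x within {l..r} = at x"
      using e1 e2 by (intro at_within_interior) (auto simp: l_def r_def)
    ultimately show ?thesis
      unfolding T_def has_real_derivative_iff_has_vector_derivative by metis
  qed
  have T_mono: "T x < T y" if "x \<in> I" "y \<in> I" "x < y" for x y
  proof (rule DERIV_pos_imp_increasing[OF \<open>x < y\<close>])
    fix z assume "x \<le> z" "z \<le> y"
    then have "z \<in> I" using seg[OF that(1,2)] by auto
    then show "\<exists>d. (T has_real_derivative d) (at z) \<and> 0 < d"
      using T[of z] by (auto simp: I_def)
  qed
  have clock: "T (c t) = t + T (c 0)"
    if c: "\<And>t. (c has_real_derivative P (c t)) (at t)" "\<And>t. P (c t) > 0" for c t
  proof -
    have "((\<lambda>t. T (c t) - t) has_real_derivative 0) (at t)" for t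
    proof -
      have "P (c t) \<noteq> 0" using c(2)[of t] by simp
      then show ?thesis
        using DERIV_chain2[OF T c(1), of t] c(2)[of t]
        by (auto intro!: derivative_eq_intros simp: I_def)
    qed
    then have "T (c t) - t = T (c 0) - 0"
      by (rule DERIV_isconst_all[rule_format])
    then show ?thesis by simp
  qed
  have "b t = a (t + (T (b 0) - T (a 0)))" for t
  proof -
    have "T (b t) = T (a (t + (T (b 0) - T (a 0))))"
      using clock[OF a, of "t + (T (b 0) - T (a 0))"] clock[OF b, of t] by linarith
    moreover have "b t \<in> I" "a (t + (T (b 0) - T (a 0))) \<in> I"
      using a(2) b(2) by (auto simp: I_def)
    ultimately show ?thesis
      using T_mono by (metis linorder_neqE_linordered_idom less_irrefl)
  qed
  then show ?thesis by blast
qed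

text \<open>The definition of concavity, cleared of denominators.\<close>

lemma concave_three_points:
  fixes f :: "real \<Rightarrow> real"
  assumes "concave_on UNIV f" "x \<le> y" "y \<le> z" "x < z"
  shows "(z - y) * f x + (y - x) * f z \<le> (z - x) * f y"
proof -
  define u where "u = (y - x) / (z - x)"
  have u: "0 \<le> u" "u \<le> 1" using assms by (auto simp: u_def field_simps)
  have ux: "u * (z - x) = y - x" using assms by (simp add: u_def)
  have "(1 - u) * x + u * z = y" using ux by (simp add: algebra_simps)
  then have "(1 - u) * f x + u * f z \<le> f y"
    using concave_onD[OF assms(1) u, of x z] by simp
  then have "(z - x) * ((1 - u) * f x + u * f z) \<le> (z - x) * f y"
    using assms by (intro mult_left_mono) auto
  also have "(z - x) * ((1 - u) * f x + u * f z) = (z - y) * f x + (y - x) * f z"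
  proof -
    have "(z - x) * ((1 - u) * f x + u * f z) = (z - x - u * (z - x)) * f x + u * (z - x) * f z"
      by (simp add: algebra_simps)
    then show ?thesis by (simp add: ux)
  qed
  finally show ?thesis .
qed

text \<open>Outside the interval the nearer root would lie between a point where \<open>P\<close> is positive and the
  other root; concavity would make \<open>P\<close> positive there.\<close>

lemma concave_pos_between_roots:
  fixes P :: "real \<Rightarrow> real"
  assumes "concave_on UNIV P" "P r = 0" "P s = 0" "r < s" "P x > 0"
  shows "r < x" "x < s"
proof -
  show "r < x"
  proof (rule ccontr)
    assume "\<not> r < x"
    then have x: "x \<le> r" by simp
    then have "(s - r) * P x \<le> 0"
      using concave_three_points[OF assms(1) x, of s] assms by simp
    then show False using assms by (simp add: mult_le_0_iff)
  qed
  show "x < s"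
  proof (rule ccontr)
    assume "\<not> x < s"
    then have x: "s \<le> x" by simp
    then have "(s - r) * P x \<le> 0"
      using concave_three_points[OF assms(1) _ x, of r] assms by simp
    then show False using assms by (simp add: mult_le_0_iff)
  qed
qed

text \<open>\<open>K\<close> and \<open>W - K\<close> both increase, so an upper bound for \<open>W\<close> is one for \<open>K\<close>. This is
  convergence of the integral of \<open>K'\<close> by comparison with that of \<open>W'\<close>.\<close>

lemma dominated_derivative_convergent:
  fixes K W :: "real \<Rightarrow> real"
  assumes K: "\<And>t. t \<ge> t0 \<Longrightarrow> (K has_real_derivative K' t) (at t)" "\<And>t. t \<ge> t0 \<Longrightarrow> 0 \<le> K' t"
    and W: "\<And>t. t \<ge> t0 \<Longrightarrow> (W has_real_derivative W' t) (at t)" "\<And>t. t \<ge> t0 \<Longrightarrow> K' t \<le> W' t"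
    and B: "\<And>t. t \<ge> t0 \<Longrightarrow> W t \<le> B"
  shows "\<exists>l. (K \<longlongrightarrow> l) at_top"
proof -
  have mono: "K s \<le> K t" if "t0 \<le> s" "s \<le> t" for s t
    using that K by (intro DERIV_nonneg_imp_nondecreasing[where f = K]) (meson order_trans)+
  have up: "K t \<le> K t0 + B - W t0" if "t0 \<le> t" for t
  proof -
    have "W t0 - K t0 \<le> W t - K t"
    proof (rule DERIV_nonneg_imp_nondecreasing[where f = "\<lambda>t. W t - K t", OF that])
      fix x assume "t0 \<le> x"
      then show "\<exists>d. ((\<lambda>t. W t - K t) has_real_derivative d) (at x) \<and> 0 \<le> d"
        using DERIV_diff[OF W(1)[of x] K(1)[of x]] W(2)[of x] by auto
    qed
    then show ?thesis using B[OF that] by linarith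
  qed
  define l where "l = (SUP t\<in>{t0..}. K t)"
  have bdd: "bdd_above (K ` {t0..})"
    using up by (auto intro!: bdd_aboveI)
  have "(K \<longlongrightarrow> l) at_top"
  proof (rule increasing_tendsto)
    show "\<forall>\<^sub>F t in at_top. K t \<le> l"
      using eventually_ge_at_top[of t0] by eventually_elim (auto simp: l_def intro!: cSUP_upper bdd)
    fix x assume "x < l"
    then obtain s where s: "s \<ge> t0" "x < K s"
      unfolding l_def using less_cSUP_iff[OF _ bdd] by auto
    show "\<forall>\<^sub>F t in at_top. x < K t"
      using eventually_ge_at_top[of s]
    proof eventually_elim
      case (elim t)
      with s mono[of s t] show ?case by linarith
    qed
  qed
  then show ?thesis ..
qed

text \<open>The chord of the concave function \<open>P\<close> from the root \<open>r = spow p a\<close> to \<open>\<theta> 0\<close> gives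
  \<open>P (\<theta> t) \<ge> c * (\<theta> t - r)\<close>, hence exponential decay of \<open>\<theta> - r\<close> backwards in time. The second claim
  says that \<open>\<gamma> - a\<close>, with \<open>\<gamma> = spow p' \<theta>\<close>, is integrable near \<open>- \<infinity>\<close>: it is dominated by the
  derivative of a bounded function \<open>W\<close>. For \<open>a \<noteq> 0\<close> the map \<open>spow p'\<close> is Lipschitz at \<open>r\<close>, and
  \<open>W\<close> is a multiple of \<open>\<theta>\<close>. For \<open>a = 0\<close> it need not be, but then
  \<open>\<gamma>' / \<gamma> = (p' - 1) * \<theta>' / \<theta>\<close> is at least a positive constant, and \<open>W\<close> is a multiple of \<open>\<gamma>\<close>.\<close>

lemma approach_to_root:
  fixes P \<theta> :: "real \<Rightarrow> real"
  assumes p: "1 < p" and \<nu>: "0 < \<nu>" and conc: "concave_on UNIV P"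
    and root: "P (spow p a) = 0"
    and d\<theta>: "\<And>t. (\<theta> has_real_derivative \<nu> * P (\<theta> t)) (at t)"
    and pos: "\<And>t. P (\<theta> t) > 0" and gt: "\<And>t. spow p a < \<theta> t"
  shows "(\<theta> \<longlongrightarrow> spow p a) at_bot"
    and "\<exists>W W' t0 B. \<forall>t\<le>t0. (W has_real_derivative W' t) (at t)
           \<and> spow (p / (p - 1)) (\<theta> t) - a \<le> W' t \<and> \<bar>W t\<bar> \<le> (B::real)"
proof -
  let ?p' = "p / (p - 1)"
  have p': "?p' > 1" "(p - 1) * (?p' - 1) = 1" using p by (auto simp: field_simps)
  define r where "r = spow p a"
  have ra: "spow ?p' r = a" unfolding r_def by (rule spow_inverse[OF p'(2)])
  define c where "c = P (\<theta> 0) / (\<theta> 0 - r)"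
  have c: "c > 0" using pos[of 0] gt[of 0] by (simp add: c_def r_def)
  have mono: "\<theta> s \<le> \<theta> t" if "s \<le> t" for s t
    using that d\<theta> pos \<nu> by (intro DERIV_nonneg_imp_nondecreasing[where f = \<theta>])
      (auto intro!: exI[of _ "\<nu> * P (\<theta> _)"] less_imp_le)
  have lower: "P (\<theta> t) \<ge> c * (\<theta> t - r)" if "t \<le> 0" for t
  proof -
    have "(\<theta> 0 - \<theta> t) * P r + (\<theta> t - r) * P (\<theta> 0) \<le> (\<theta> 0 - r) * P (\<theta> t)"
      using gt[of t] gt[of 0] mono[OF that]
      by (intro concave_three_points[OF conc]) (auto simp: r_def)
    then show ?thesis
      using root gt[of 0] by (simp add: c_def r_def field_simps)
  qed
  have decay: "\<theta> t - r \<le> (\<theta> 0 - r) * exp (\<nu> * c * t)" if "t \<le> 0" for t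
  proof -
    have "(\<theta> t - r) * exp (- (\<nu> * c) * t) \<le> (\<theta> 0 - r) * exp (- (\<nu> * c) * 0)"
    proof (rule DERIV_nonneg_imp_nondecreasing[where f = "\<lambda>t. (\<theta> t - r) * exp (- (\<nu> * c) * t)", OF that])
      fix x :: real assume "x \<le> 0"
      have "((\<lambda>t. (\<theta> t - r) * exp (- (\<nu> * c) * t)) has_real_derivative
          exp (- (\<nu> * c) * x) * (\<nu> * (P (\<theta> x) - c * (\<theta> x - r)))) (at x)"
        by (rule derivative_eq_intros d\<theta> refl | simp add: algebra_simps)+
      moreover have "0 \<le> exp (- (\<nu> * c) * x) * (\<nu> * (P (\<theta> x) - c * (\<theta> x - r)))"
        using lower[OF \<open>x \<le> 0\<close>] \<nu> by simp
      ultimately show "\<exists>d. ((\<lambda>t. (\<theta> t - r) * exp (- (\<nu> * c) * t)) has_real_derivative d) (at x) \<and> 0 \<le> d"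
        by blast
    qed
    then have "(\<theta> t - r) * exp (- (\<nu> * c) * t) * exp (\<nu> * c * t) \<le> (\<theta> 0 - r) * exp (\<nu> * c * t)"
      by (intro mult_right_mono) auto
    then show ?thesis by (simp add: mult.assoc exp_add[symmetric])
  qed
  have "((\<lambda>t. exp (\<nu> * c * t)) \<longlongrightarrow> 0) at_bot"
    using \<nu> c
    by (intro filterlim_compose[OF exp_at_bot] filterlim_tendsto_pos_mult_at_bot[OF tendsto_const _ filterlim_ident])
       auto
  then have "((\<lambda>t. (\<theta> 0 - r) * exp (\<nu> * c * t)) \<longlongrightarrow> 0) at_bot"
    using tendsto_mult_right_zero by blast
  then have "((\<lambda>t. \<theta> t - r) \<longlongrightarrow> 0) at_bot"
  proof (rule Lim_null_comparison[rotated])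
    show "\<forall>\<^sub>F t in at_bot. norm (\<theta> t - r) \<le> (\<theta> 0 - r) * exp (\<nu> * c * t)"
      using eventually_le_at_bot[of 0]
    proof eventually_elim
      case (elim t)
      then show ?case using decay[OF elim] gt[of t] by (simp add: r_def)
    qed
  qed
  then show lim: "(\<theta> \<longlongrightarrow> spow p a) at_bot"
    using Lim_null[of \<theta> "spow p a" at_bot] by (simp add: r_def)
  show "\<exists>W W' t0 B. \<forall>t\<le>t0. (W has_real_derivative W' t) (at t)
           \<and> spow ?p' (\<theta> t) - a \<le> W' t \<and> \<bar>W t\<bar> \<le> (B::real)"
  proof (cases "a = 0")
    case True
    define k where "k = 1 / ((?p' - 1) * \<nu> * c)"
    define W where "W t = k * spow ?p' (\<theta> t)" for t
    define W' where "W' t = k * ((?p' - 1) * \<bar>\<theta> t\<bar> powr (?p' - 2) * (\<nu> * P (\<theta> t)))" for t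
    have k: "k > 0" "k * (?p' - 1) * \<nu> * c = 1" using p' \<nu> c by (auto simp: k_def)
    have th: "\<theta> t > 0" for t using gt[of t] True by simp
    have "(W has_real_derivative W' t) (at t)" for t
      unfolding W_def W'_def using th[of t]
      by (intro DERIV_cmult DERIV_chain2[OF has_real_derivative_spow d\<theta>]) auto
    moreover have "spow ?p' (\<theta> t) - a \<le> W' t" if "t \<le> 0" for t
    proof -
      have r0: "r = 0" using True by (simp add: r_def)
      have "spow ?p' (\<theta> t) - a = k * (?p' - 1) * \<nu> * c * (\<bar>\<theta> t\<bar> powr (?p' - 2) * \<theta> t)"
        unfolding k(2) using True by (simp add: spow_def)
      also have "\<dots> = (k * (?p' - 1) * \<nu> * \<bar>\<theta> t\<bar> powr (?p' - 2)) * (c * (\<theta> t - r))"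
        by (simp add: r0)
      also have "\<dots> \<le> (k * (?p' - 1) * \<nu> * \<bar>\<theta> t\<bar> powr (?p' - 2)) * P (\<theta> t)"
        using k p' \<nu> by (intro mult_left_mono lower that) auto
      finally show ?thesis by (simp add: W'_def ac_simps)
    qed
    moreover have "\<bar>W t\<bar> \<le> k * spow ?p' (\<theta> 0)" if "t \<le> 0" for t
    proof -
      have "spow ?p' (\<theta> t) \<le> spow ?p' (\<theta> 0)" using mono[OF that] p' by (simp add: spow_le_iff)
      moreover have "0 \<le> spow ?p' (\<theta> t)" using th[of t] by (simp add: spow_def)
      ultimately show ?thesis using k by (simp add: W_def abs_mult)
    qed
    ultimately show ?thesis by blast
  next
    case False
    then have r0: "r \<noteq> 0" using ra by auto
    define D where "D = (?p' - 1) * \<bar>r\<bar> powr (?p' - 2)"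
    define M where "M = \<bar>D\<bar> + 1"
    have "((\<lambda>x. (spow ?p' x - spow ?p' r) / (x - r)) \<longlongrightarrow> D) (at r)"
      using has_real_derivative_spow[OF r0, of ?p'] by (simp add: D_def has_field_derivative_iff)
    then have "\<forall>\<^sub>F x in at r. (spow ?p' x - spow ?p' r) / (x - r) < M"
      by (rule order_tendstoD) (simp add: M_def)
    moreover have "filterlim \<theta> (at r) at_bot"
      using lim gt by (auto simp: filterlim_at r_def intro!: always_eventually) (metis less_irrefl)
    ultimately have "\<forall>\<^sub>F t in at_bot. (spow ?p' (\<theta> t) - spow ?p' r) / (\<theta> t - r) < M"
      using eventually_compose_filterlim by blast
    then obtain t1 where t1: "\<And>t. t \<le> t1 \<Longrightarrow> (spow ?p' (\<theta> t) - spow ?p' r) / (\<theta> t - r) < M"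
      by (auto simp: eventually_at_bot_linorder)
    define k where "k = M / (\<nu> * c)"
    have M: "M > 0" by (simp add: M_def)
    have k: "k > 0" "k * \<nu> * c = M" using M \<nu> c by (auto simp: k_def)
    have "((\<lambda>t. k * \<theta> t) has_real_derivative k * (\<nu> * P (\<theta> t))) (at t)" for t
      by (intro DERIV_cmult d\<theta>)
    moreover have "spow ?p' (\<theta> t) - a \<le> k * (\<nu> * P (\<theta> t))" if "t \<le> min t1 0" for t
    proof -
      have "spow ?p' (\<theta> t) - a \<le> M * (\<theta> t - r)"
        using t1[of t] that gt[of t] by (simp add: ra r_def[symmetric] divide_less_eq)
      also have "\<dots> = k * \<nu> * (c * (\<theta> t - r))" using k(2) by simp
      also have "\<dots> \<le> k * \<nu> * P (\<theta> t)"
        using that k \<nu> by (intro mult_left_mono lower) auto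
      finally show ?thesis by simp
    qed
    moreover have "\<bar>k * \<theta> t\<bar> \<le> k * (\<bar>r\<bar> + \<bar>\<theta> 0\<bar>)" if "t \<le> min t1 0" for t
    proof -
      have "\<bar>\<theta> t\<bar> \<le> \<bar>r\<bar> + \<bar>\<theta> 0\<bar>"
        using mono[of t 0] gt[of t] that by (auto simp: r_def)
      then show ?thesis using k by (simp add: abs_mult)
    qed
    ultimately have "\<forall>t\<le>min t1 0. ((\<lambda>t. k * \<theta> t) has_real_derivative k * (\<nu> * P (\<theta> t))) (at t)
        \<and> spow ?p' (\<theta> t) - a \<le> k * (\<nu> * P (\<theta> t)) \<and> \<bar>k * \<theta> t\<bar> \<le> k * (\<bar>r\<bar> + \<bar>\<theta> 0\<bar>)"
      by simp
    then show ?thesis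
      by (rule exI[where x = "\<lambda>t. k * \<theta> t", OF exI[where x = "\<lambda>t. k * (\<nu> * P (\<theta> t))",
            OF exI[where x = "min t1 0", OF exI[where x = "k * (\<bar>r\<bar> + \<bar>\<theta> 0\<bar>)"]]]])
  qed
qed

section \<open>The rescaled radial equation\<close>

text \<open>The system satisfied by the rescaled profile \<open>V\<close> and the rescaled flux \<open>y\<close>. The assumption
  \<open>small\<close> is what is kept of the integrability of \<open>u\<close> and its gradient.\<close>

locale emden_fowler =
  fixes p q \<kappa> \<mu> :: real and V y :: "real \<Rightarrow> real"
  assumes p: "1 < p" and pq: "p < q" and \<kappa>: "0 < \<kappa>"
    and V_nonneg: "\<And>t. 0 \<le> V t"
    and dV: "\<And>t. (V has_real_derivative \<kappa> * V t + spow (p / (p - 1)) (y t)) (at t)"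
    and dy: "\<And>t. (y has_real_derivative
                 - \<kappa> * y t - \<mu> * V t powr (p - 1) - V t powr (q - 1)) (at t)"
    and small: "\<And>\<epsilon>. 0 < \<epsilon> \<Longrightarrow> \<exists>t. V t < \<epsilon> \<and> \<bar>y t\<bar> < \<epsilon>"
    and nontrivial: "\<exists>t. 0 < V t"
begin

abbreviation p' :: real where "p' \<equiv> p / (p - 1)"

text \<open>The rescaled radial derivative \<open>r u'\<close>, which is \<open>V' - \<kappa> V\<close>.\<close>

definition z :: "real \<Rightarrow> real" where "z t = spow p' (y t)"

text \<open>\<open>P (spow p \<gamma>) = - \<Gamma>\<^sub>\<mu> \<gamma>\<close> when \<open>\<kappa> p = N - p\<close>. In the variable \<open>\<theta> = spow p \<gamma>\<close> it is concave.\<close>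

definition P :: "real \<Rightarrow> real" where
  "P \<theta> = \<kappa> * p * \<theta> - \<mu> - (p - 1) * \<bar>\<theta>\<bar> powr p'"

text \<open>\<open>\<theta> = spow p \<gamma>\<close> for the slope \<open>\<gamma> = - z / V = - r u' / u\<close>.\<close>

definition \<theta> :: "real \<Rightarrow> real" where "\<theta> t = - y t / V t powr (p - 1)"

lemma p': "1 < p'" "(p' - 1) * (p - 1) = 1" "(p - 1) * (p' - 1) = 1" "(p - 1) * p' = p"
  using p by (auto simp: field_simps)

text \<open>The left-hand side \<open>H\<close> is a Hamiltonian of the system, \<open>V' = \<partial>H/\<partial>y\<close> and \<open>y' = - \<partial>H/\<partial>V\<close>, hence
  constant, and by \<open>small\<close> it is arbitrarily small at suitable times.\<close>

lemma energy: "\<kappa> * V t * y t + \<bar>y t\<bar> powr p' / p' + \<mu> * V t powr p / p + V t powr q / q = 0"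
proof -
  define H where
    "H t = \<kappa> * V t * y t + \<bar>y t\<bar> powr p' / p' + \<mu> * \<bar>V t\<bar> powr p / p + \<bar>V t\<bar> powr q / q" for t
  have "q > 1" "p' \<noteq> 0" using p pq by auto
  have "(H has_real_derivative 0) (at t)" for t
  proof -
    define v where "v = \<kappa> * V t + spow p' (y t)"
    define w where "w = - \<kappa> * y t - \<mu> * V t powr (p - 1) - V t powr (q - 1)"
    have dV': "(V has_real_derivative v) (at t)" and dy': "(y has_real_derivative w) (at t)"
      using dV[of t] dy[of t] by (simp_all add: v_def w_def)
    note chain = DERIV_chain2[OF has_real_derivative_abs_powr[OF p'(1)] dy']
      DERIV_chain2[OF has_real_derivative_abs_powr[OF p] dV']
      DERIV_chain2[OF has_real_derivative_abs_powr[OF \<open>q > 1\<close>] dV']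
    have d1: "((\<lambda>t. \<kappa> * V t * y t) has_real_derivative \<kappa> * v * y t + \<kappa> * V t * w) (at t)"
      by (rule derivative_eq_intros dV' dy' refl | simp add: algebra_simps)+
    have "(H has_real_derivative
        (\<kappa> * v * y t + \<kappa> * V t * w) + (p' * spow p' (y t) * w) / p'
          + \<mu> * (p * spow p (V t) * v) / p + (q * spow q (V t) * v) / q) (at t)"
      unfolding H_def by (intro DERIV_add DERIV_cdivide DERIV_cmult d1 chain)
    moreover have "(p' * spow p' (y t) * w) / p' = spow p' (y t) * w"
      "\<mu> * (p * spow p (V t) * v) / p = \<mu> * spow p (V t) * v"
      "(q * spow q (V t) * v) / q = spow q (V t) * v"
      using \<open>q > 1\<close> \<open>p' \<noteq> 0\<close> p by simp_all
    moreover have "\<kappa> * v * y t + \<kappa> * V t * w + spow p' (y t) * w + \<mu> * spow p (V t) * v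
        + spow q (V t) * v = (\<kappa> * y t + \<mu> * spow p (V t) + spow q (V t)) * v + v * w"
      by (simp add: v_def algebra_simps)
    moreover have "\<kappa> * y t + \<mu> * spow p (V t) + spow q (V t) = - w"
      by (simp add: w_def spow_nonneg[OF V_nonneg])
    ultimately show ?thesis by simp
  qed
  then have const: "H s = H t" for s t
    using DERIV_isconst_all by blast
  obtain \<tau> where \<tau>: "V (\<tau> n) < 1 / real (Suc n)" "\<bar>y (\<tau> n)\<bar> < 1 / real (Suc n)" for n
    using small[of "1 / real (Suc n)" for n] by (metis of_nat_0_less_iff zero_less_Suc zero_less_divide_1_iff)
  have lim: "(\<lambda>n. 1 / real (Suc n)) \<longlonglongrightarrow> 0"
    by (rule LIMSEQ_Suc) (rule lim_1_over_n)
  have Vt: "(\<lambda>n. V (\<tau> n)) \<longlonglongrightarrow> 0"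
    by (rule Lim_null_comparison[OF _ lim]) (use \<tau>(1) V_nonneg in \<open>auto intro!: always_eventually less_imp_le\<close>)
  have yt: "(\<lambda>n. y (\<tau> n)) \<longlonglongrightarrow> 0"
    by (rule Lim_null_comparison[OF _ lim]) (use \<tau>(2) in \<open>auto intro!: always_eventually less_imp_le\<close>)
  have pw: "(\<lambda>n. \<bar>f n\<bar> powr a) \<longlonglongrightarrow> 0" if "f \<longlonglongrightarrow> 0" "a > 0" for f :: "nat \<Rightarrow> real" and a
    using tendsto_powr'[of "\<lambda>n. \<bar>f n\<bar>" 0 sequentially "\<lambda>_. a" a] that
    by (auto intro!: tendsto_eq_intros)
  have "(\<lambda>n. H (\<tau> n)) \<longlonglongrightarrow> \<kappa> * 0 * 0 + 0 / p' + \<mu> * 0 / p + 0 / q"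
    unfolding H_def using p'(1) \<open>q > 1\<close> p by (intro tendsto_intros Vt yt pw) auto
  then have "(\<lambda>n. H t) \<longlonglongrightarrow> 0"
    using const[of "\<tau> _" t] by simp
  then have "H t = 0" using LIMSEQ_const_iff by blast
  then show ?thesis using V_nonneg[of t] by (simp add: H_def)
qed

lemma abs_y_powr: "\<bar>y t\<bar> powr p' = \<bar>z t\<bar> powr p" "\<bar>y t\<bar> = \<bar>z t\<bar> powr (p - 1)"
proof -
  have "(p' - 1) * p = p'" using p by (simp add: field_simps)
  then show "\<bar>y t\<bar> powr p' = \<bar>z t\<bar> powr p" by (simp add: z_def abs_spow powr_powr)
  show "\<bar>y t\<bar> = \<bar>z t\<bar> powr (p - 1)"
    using p' by (cases "y t = 0") (simp_all add: z_def abs_spow powr_powr)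
qed

text \<open>Multiplied by \<open>p\<close>, the energy identity expresses \<open>(p - 1) * \<bar>z\<bar> powr p\<close> by terms that contain a
  factor \<open>V\<close>; where \<open>\<bar>z\<bar> > V\<close> these are at most \<open>(\<kappa> * p + \<bar>\<mu>\<bar>) * V * \<bar>z\<bar> powr (p - 1)\<close>.\<close>

lemma slope_bound: "\<bar>z t\<bar> \<le> max 1 ((\<kappa> * p + \<bar>\<mu>\<bar>) / (p - 1)) * V t"
proof (cases "\<bar>z t\<bar> \<le> V t")
  case True
  have "V t \<le> max 1 ((\<kappa> * p + \<bar>\<mu>\<bar>) / (p - 1)) * V t"
    using V_nonneg[of t] mult_right_mono[of 1 "max 1 ((\<kappa> * p + \<bar>\<mu>\<bar>) / (p - 1))" "V t"] by simp
  with True show ?thesis by simp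
next
  case False
  define Z where "Z = \<bar>z t\<bar>"
  have Z: "Z > V t" "Z > 0" using False V_nonneg[of t] by (auto simp: Z_def)
  have split: "x powr p = x powr (p - 1) * x" if "x \<ge> 0" for x :: real
    using that powr_add[of x "p - 1" 1] by (cases "x = 0") auto
  have "p * (\<kappa> * V t * y t + Z powr p / p' + \<mu> * V t powr p / p + V t powr q / q) = 0"
    using energy[of t] by (simp add: abs_y_powr(1) Z_def)
  moreover have "p * (Z powr p / p') = (p - 1) * Z powr p" "p * (\<mu> * V t powr p / p) = \<mu> * V t powr p"
    "p * (V t powr q / q) = p / q * V t powr q"
    using p by simp_all
  ultimately have "p * (\<kappa> * V t * y t) + (p - 1) * Z powr p + \<mu> * V t powr p + p / q * V t powr q = 0"
    by (metis distrib_left)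
  then have eq: "(p - 1) * Z powr p = - (\<kappa> * p * V t * y t) - \<mu> * V t powr p - p / q * V t powr q"
    by (simp add: mult.assoc mult.left_commute)
  have "\<kappa> * p * V t * - y t \<le> \<kappa> * p * V t * Z powr (p - 1)"
    using \<kappa> p V_nonneg[of t] abs_y_powr(2)[of t] by (intro mult_left_mono) (auto simp: Z_def)
  then have "- (\<kappa> * p * V t * y t) \<le> \<kappa> * p * V t * Z powr (p - 1)" by simp
  moreover have "- \<mu> * V t powr p \<le> \<bar>\<mu>\<bar> * (V t * Z powr (p - 1))"
  proof -
    have "V t powr p \<le> Z powr (p - 1) * V t"
      using Z V_nonneg[of t] p by (subst split) (auto intro!: mult_right_mono powr_mono2)
    then have "\<bar>\<mu>\<bar> * V t powr p \<le> \<bar>\<mu>\<bar> * (V t * Z powr (p - 1))"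
      by (intro mult_left_mono) (auto simp: mult.commute)
    moreover have "- \<mu> * V t powr p \<le> \<bar>\<mu>\<bar> * V t powr p"
      by (intro mult_right_mono) auto
    ultimately show ?thesis by linarith
  qed
  moreover have "p / q * V t powr q \<ge> 0" using p pq by simp
  ultimately have "(p - 1) * (Z powr (p - 1) * Z) \<le> (\<kappa> * p + \<bar>\<mu>\<bar>) * V t * Z powr (p - 1)"
    using eq split[of Z] Z by (simp add: algebra_simps)
  then have "(p - 1) * Z * Z powr (p - 1) \<le> (\<kappa> * p + \<bar>\<mu>\<bar>) * V t * Z powr (p - 1)"
    by (simp add: ac_simps)
  then have "(p - 1) * Z \<le> (\<kappa> * p + \<bar>\<mu>\<bar>) * V t"
    using Z by (simp add: mult_le_cancel_right)
  then have "Z \<le> (\<kappa> * p + \<bar>\<mu>\<bar>) / (p - 1) * V t"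
    using p by (simp add: field_simps)
  also have "\<dots> \<le> max 1 ((\<kappa> * p + \<bar>\<mu>\<bar>) / (p - 1)) * V t"
    using V_nonneg[of t] by (intro mult_right_mono) auto
  finally show ?thesis by (simp add: Z_def)
qed

text \<open>By \<open>slope_bound\<close> the logarithmic derivative of \<open>V\<close> is bounded, so \<open>V\<close> cannot reach zero from a
  positive value in finite time (Gronwall). The right-hand side of the system
  need not be Lipschitz at zero, so this does not follow from uniqueness of solutions.\<close>

lemma V_pos: "0 < V t"
proof -
  define K where "K = \<kappa> + max 1 ((\<kappa> * p + \<bar>\<mu>\<bar>) / (p - 1))"
  have bound: "\<bar>\<kappa> * V t + z t\<bar> \<le> K * V t" for t
    using slope_bound[of t] V_nonneg[of t] \<kappa> abs_triangle_ineq[of "\<kappa> * V t" "z t"]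
    by (simp add: K_def algebra_simps abs_mult)
  obtain t0 where t0: "0 < V t0" using nontrivial by blast
  show ?thesis
  proof (cases "t0 \<le> t")
    case True
    have "exp (K * t0) * V t0 \<le> exp (K * t) * V t"
    proof (rule DERIV_nonneg_imp_nondecreasing[OF True, where f = "\<lambda>t. exp (K * t) * V t"])
      fix x
      have "((\<lambda>t. exp (K * t) * V t) has_real_derivative exp (K * x) * (K * V x + (\<kappa> * V x + z x))) (at x)"
        unfolding z_def by (rule derivative_eq_intros dV refl | simp add: algebra_simps)+
      moreover have "0 \<le> K * V x + (\<kappa> * V x + z x)" using bound[of x] by linarith
      ultimately show "\<exists>d. ((\<lambda>t. exp (K * t) * V t) has_real_derivative d) (at x) \<and> 0 \<le> d"
        by (meson exp_ge_zero mult_nonneg_nonneg)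
    qed
    with t0 show ?thesis by (smt (verit) exp_gt_zero mult_pos_pos zero_less_mult_pos)
  next
    case False
    have "exp (- K * t0) * V t0 \<le> exp (- K * t) * V t"
    proof (rule DERIV_nonpos_imp_nonincreasing[where f = "\<lambda>t. exp (- K * t) * V t"])
      show "t \<le> t0" using False by simp
      fix x
      have "((\<lambda>t. exp (- K * t) * V t) has_real_derivative exp (- K * x) * (- K * V x + (\<kappa> * V x + z x))) (at x)"
        unfolding z_def by (rule derivative_eq_intros dV refl | simp add: algebra_simps)+
      moreover have "- K * V x + (\<kappa> * V x + z x) \<le> 0" using bound[of x] by linarith
      ultimately show "\<exists>d. ((\<lambda>t. exp (- K * t) * V t) has_real_derivative d) (at x) \<and> d \<le> 0"
        by (meson exp_ge_zero mult_nonneg_nonpos)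
    qed
    with t0 show ?thesis by (smt (verit) exp_gt_zero mult_pos_pos zero_less_mult_pos)
  qed
qed

lemma y_eq: "y t = V t powr (p - 1) * - \<theta> t"
  using V_pos[of t] by (simp add: \<theta>_def)

lemma z_eq: "z t = - spow p' (\<theta> t) * V t"
proof -
  have "z t = (V t powr (p - 1)) powr (p' - 1) * spow p' (- \<theta> t)"
    unfolding z_def y_eq[of t] using V_pos[of t] by (intro spow_mult) simp
  also have "(V t powr (p - 1)) powr (p' - 1) = V t"
    using V_pos[of t] p' by (simp add: powr_powr)
  finally show ?thesis by (simp add: spow_minus)
qed

lemma dV_\<theta>: "(V has_real_derivative (\<kappa> - spow p' (\<theta> t)) * V t) (at t)"
  using dV[of t] z_eq[of t] by (simp add: z_def algebra_simps)

text \<open>The energy identity, multiplied by \<open>p\<close> and divided by \<open>V powr p\<close>.\<close>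

lemma P_\<theta>: "P (\<theta> t) = p / q * V t powr (q - p)"
proof -
  have V: "V t powr p = V t powr (p - 1) * V t"
    using powr_add[of "V t" "p - 1" 1] V_nonneg[of t] by (simp add: powr_one)
  have Vq: "V t powr q = V t powr p * V t powr (q - p)"
    using powr_add[of "V t" p "q - p"] by simp
  have y': "\<bar>y t\<bar> powr p' = V t powr p * \<bar>\<theta> t\<bar> powr p'"
    unfolding y_eq[of t] using p' by (simp add: abs_mult powr_mult powr_powr)
  define A where "A = V t powr p"
  define B where "B = V t powr (q - p)"
  have "\<kappa> * V t * y t = - A * \<kappa> * \<theta> t"
    unfolding A_def V y_eq[of t] by simp
  then have "p * (- A * \<kappa> * \<theta> t + A * \<bar>\<theta> t\<bar> powr p' / p' + \<mu> * A / p + A * B / q) = 0"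
    using energy[of t] unfolding y' Vq A_def[symmetric] B_def[symmetric] by simp
  moreover have "p * (- A * \<kappa> * \<theta> t + A * \<bar>\<theta> t\<bar> powr p' / p' + \<mu> * A / p + A * B / q)
      = A * (p / q * B - P (\<theta> t))"
    using p by (simp add: P_def field_simps)
  ultimately have "A * (p / q * B - P (\<theta> t)) = 0" by (simp only:)
  moreover have "A \<noteq> 0" using V_pos[of t] by (simp add: A_def)
  ultimately show ?thesis by (simp add: B_def)
qed

lemma P_\<theta>_pos: "0 < P (\<theta> t)"
  using P_\<theta>[of t] V_pos[of t] p pq by simp

text \<open>Differentiating \<open>\<theta> = - y * V powr (1 - p)\<close> gives \<open>\<theta>' = V powr (q - p) - P \<theta>\<close>; the first term is
  \<open>q / p * P \<theta>\<close> by the energy identity.\<close>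

lemma d\<theta>: "(\<theta> has_real_derivative (q - p) / p * P (\<theta> t)) (at t)"
proof -
  let ?W = "V t powr (1 - p)"
  have "((\<lambda>t. - y t * V t powr (1 - p)) has_real_derivative
      - (- \<kappa> * y t - \<mu> * V t powr (p - 1) - V t powr (q - 1)) * ?W
       + - y t * ((1 - p) * V t powr (1 - p - 1) * ((\<kappa> - spow p' (\<theta> t)) * V t))) (at t)"
    using DERIV_mult[OF DERIV_minus[OF dy[of t]] DERIV_fun_powr[OF dV_\<theta>[of t] V_pos[of t], of "1 - p"]]
    by (rule back_subst) (simp add: fun_eq_iff)
  moreover have "(\<lambda>t. - y t * V t powr (1 - p)) = \<theta>"
  proof
    fix t
    have "V t powr (1 - p) = 1 / V t powr (p - 1)"
      using powr_minus_divide[of "V t" "p - 1"] by simp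
    then show "- y t * V t powr (1 - p) = \<theta> t" by (simp add: \<theta>_def)
  qed
  moreover have "- (- \<kappa> * y t - \<mu> * V t powr (p - 1) - V t powr (q - 1)) * ?W
       + - y t * ((1 - p) * V t powr (1 - p - 1) * ((\<kappa> - spow p' (\<theta> t)) * V t))
       = (q - p) / p * P (\<theta> t)"
  proof -
    have W: "V t powr (p - 1) * ?W = 1" "V t powr (q - 1) * ?W = V t powr (q - p)"
      using V_pos[of t] by (subst powr_add[symmetric]; simp)+
    have W3: "V t powr (1 - p - 1) * V t = ?W"
      using V_pos[of t] powr_add[of "V t" "1 - p - 1" 1] by (simp only: powr_one) simp
    have yW: "y t * ?W = - \<theta> t"
      using W(1) y_eq[of t] by (simp add: algebra_simps)
    have "- (- \<kappa> * y t - \<mu> * V t powr (p - 1) - V t powr (q - 1)) * ?W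
       + - y t * ((1 - p) * V t powr (1 - p - 1) * ((\<kappa> - spow p' (\<theta> t)) * V t))
      = \<kappa> * (y t * ?W) + \<mu> * (V t powr (p - 1) * ?W) + V t powr (q - 1) * ?W
       - y t * ((1 - p) * (V t powr (1 - p - 1) * V t) * (\<kappa> - spow p' (\<theta> t)))"
      by (simp add: algebra_simps)
    also have "\<dots> = \<kappa> * (y t * ?W) + \<mu> + V t powr (q - p)
       - (y t * ?W) * ((1 - p) * (\<kappa> - spow p' (\<theta> t)))"
      by (simp only: W W3) (simp add: algebra_simps)
    also have "\<dots> = - \<kappa> * \<theta> t + \<mu> + V t powr (q - p) + (1 - p) * \<kappa> * \<theta> t
       + (p - 1) * (spow p' (\<theta> t) * \<theta> t)"
      by (simp only: yW) (simp add: algebra_simps)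
    also have "\<dots> = V t powr (q - p) - P (\<theta> t)"
      unfolding spow_mult_self P_def by (simp add: algebra_simps)
    also have "\<dots> = (q - p) / p * P (\<theta> t)"
      using p pq P_\<theta>[of t] by (simp add: field_simps)
    finally show ?thesis .
  qed
  ultimately show ?thesis by simp
qed

lemma V_eq: "V t = (q / p * P (\<theta> t)) powr (1 / (q - p))"
proof -
  have "q / p * P (\<theta> t) = V t powr (q - p)" using p pq by (simp add: P_\<theta>)
  then have "(q / p * P (\<theta> t)) powr (1 / (q - p)) = V t powr ((q - p) * (1 / (q - p)))"
    by (simp only: powr_powr)
  then show ?thesis using pq V_nonneg[of t] by simp
qed

lemma continuous_P: "continuous_on UNIV P"
proof -
  have "continuous_on UNIV (\<lambda>x::real. \<bar>x\<bar> powr p')"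
    using DERIV_isCont[OF has_real_derivative_abs_powr[OF p'(1)]]
    by (simp add: continuous_at_imp_continuous_on)
  then show ?thesis
    unfolding P_def[abs_def]
    by (intro continuous_on_diff continuous_on_mult_left continuous_on_const continuous_on_id)
qed

lemma concave_P: "concave_on UNIV P"
proof -
  have "convex_on UNIV (\<lambda>x::real. - \<kappa> * p * x + \<mu>)"
  proof (rule convex_on_realI[where f' = "\<lambda>_. - \<kappa> * p"])
    show "((\<lambda>x. - \<kappa> * p * x + \<mu>) has_real_derivative - \<kappa> * p) (at x)" for x
      using DERIV_add[OF DERIV_cmult_Id[of "- \<kappa> * p" x] DERIV_const[of \<mu>]] by simp
  qed auto
  moreover have "convex_on UNIV (\<lambda>x. (p - 1) * \<bar>x\<bar> powr p')"
    using p convex_on_abs_powr[OF p'(1)] by (intro convex_on_cmul) auto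
  ultimately have "convex_on UNIV (\<lambda>x. (p - 1) * \<bar>x\<bar> powr p' + (- \<kappa> * p * x + \<mu>))"
    by (rule convex_on_add[rotated])
  moreover have "(\<lambda>x. (p - 1) * \<bar>x\<bar> powr p' + (- \<kappa> * p * x + \<mu>)) = (\<lambda>x. - P x)"
    by (simp add: P_def fun_eq_iff)
  ultimately show ?thesis by (simp add: concave_on_def)
qed

end

text \<open>The variables \<open>\<theta>\<close> of the two solutions are translates of each other, and \<open>V\<close> is a function
  of \<open>\<theta>\<close>.\<close>

theorem emden_fowler_unique:
  assumes "emden_fowler p q \<kappa> \<mu> V y" "emden_fowler p q \<kappa> \<mu> W w"
  shows "\<exists>\<sigma>. \<forall>t. W t = V (t + \<sigma>)"
proof -
  interpret a: emden_fowler p q \<kappa> \<mu> V y by fact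
  interpret b: emden_fowler p q \<kappa> \<mu> W w by fact
  let ?c = "(q - p) / p"
  have c: "?c > 0" using a.p a.pq by simp
  have "\<exists>\<sigma>. \<forall>t. b.\<theta> t = a.\<theta> (t + \<sigma>)"
  proof (rule shift_unique_of_autonomous[where P = "\<lambda>x. ?c * a.P x"])
    show "continuous_on UNIV (\<lambda>x. ?c * a.P x)"
      by (intro continuous_intros a.continuous_P)
    show "concave_on UNIV (\<lambda>x. ?c * a.P x)"
      using c a.concave_P convex_on_cmul[of ?c UNIV "\<lambda>x. - a.P x"]
      by (simp add: concave_on_def)
    show "(a.\<theta> has_real_derivative ?c * a.P (a.\<theta> t)) (at t)" for t by (rule a.d\<theta>)
    show "(b.\<theta> has_real_derivative ?c * a.P (b.\<theta> t)) (at t)" for t by (rule b.d\<theta>)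
    show "?c * a.P (a.\<theta> t) > 0" for t by (intro mult_pos_pos c a.P_\<theta>_pos)
    show "?c * a.P (b.\<theta> t) > 0" for t by (intro mult_pos_pos c b.P_\<theta>_pos)
  qed
  then obtain \<sigma> where \<sigma>: "\<And>t. b.\<theta> t = a.\<theta> (t + \<sigma>)" by blast
  have "W t = V (t + \<sigma>)" for t
    unfolding b.V_eq[of t] a.V_eq[of "t + \<sigma>"] \<sigma> ..
  then show ?thesis by blast
qed

context emden_fowler begin

context
  fixes a b :: real
  assumes ab: "a < b" and Pa: "P (spow p a) = 0" and Pb: "P (spow p b) = 0"
begin

lemma \<theta>_between: "spow p a < \<theta> t" "\<theta> t < spow p b"
  using concave_pos_between_roots[OF concave_P Pa Pb spow_strict_mono[OF p ab] P_\<theta>_pos] by auto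

text \<open>With \<open>\<alpha>\<close> the limit of the slope at one end, the right-hand side tends to zero there.\<close>

lemma d_ln_V: "((\<lambda>t. ln (V t) + (\<alpha> - \<kappa>) * t) has_real_derivative \<alpha> - spow p' (\<theta> t)) (at t)"
proof -
  have "((\<lambda>t. ln (V t)) has_real_derivative \<kappa> - spow p' (\<theta> t)) (at t)"
    using DERIV_chain2[OF DERIV_ln_divide dV_\<theta>, OF V_pos, of t] V_pos[of t] by simp
  then show ?thesis using DERIV_add[OF _ DERIV_cmult_Id[of "\<alpha> - \<kappa>" t]] by fastforce
qed

lemma exp_ln_V: "exp (ln (V t) + (\<alpha> - \<kappa>) * t) = V t * exp ((\<alpha> - \<kappa>) * t)"
  using V_pos[of t] by (simp add: exp_add)

lemma limit_at_bot:
  "\<exists>C>0. ((\<lambda>t. V t * exp ((a - \<kappa>) * t)) \<longlongrightarrow> C) at_bot"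
  "((\<lambda>t. spow p' (\<theta> t)) \<longlongrightarrow> a) at_bot"
proof -
  have \<nu>: "(q - p) / p > 0" using p pq by simp
  note root = approach_to_root[OF p \<nu> concave_P Pa d\<theta> P_\<theta>_pos \<theta>_between(1)]
  obtain W W' t0 B where W: "\<And>t. t \<le> t0 \<Longrightarrow> (W has_real_derivative W' t) (at t)"
    "\<And>t. t \<le> t0 \<Longrightarrow> spow p' (\<theta> t) - a \<le> W' t" "\<And>t. t \<le> t0 \<Longrightarrow> \<bar>W t\<bar> \<le> (B::real)"
    using root(2) by blast
  have "\<exists>l. ((\<lambda>s. ln (V (- s)) + (a - \<kappa>) * - s) \<longlongrightarrow> l) at_top"
  proof (rule dominated_derivative_convergent)
    fix t assume t: "- t0 \<le> t"
    show "((\<lambda>s. ln (V (- s)) + (a - \<kappa>) * - s) has_real_derivative (spow p' (\<theta> (- t)) - a)) (at t)"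
      using DERIV_chain2[OF d_ln_V[of a "- t"] DERIV_minus[OF DERIV_ident, of t]] by simp
    have "spow p (spow p' (\<theta> (- t))) = \<theta> (- t)" by (rule spow_inverse[OF p'(2)])
    then have "a < spow p' (\<theta> (- t))" using \<theta>_between(1)[of "- t"] p spow_less_iff by metis
    then show "0 \<le> spow p' (\<theta> (- t)) - a" by simp
    show "((\<lambda>s. - W (- s)) has_real_derivative W' (- t)) (at t)"
      using DERIV_minus[OF DERIV_chain2[OF W(1)[of "- t"] DERIV_minus[OF DERIV_ident, of t]]] t by simp
    show "spow p' (\<theta> (- t)) - a \<le> W' (- t)" "- W (- t) \<le> B"
      using W(2,3)[of "- t"] t by auto
  qed
  then obtain l where "((\<lambda>s. ln (V (- s)) + (a - \<kappa>) * - s) \<longlongrightarrow> l) at_top" ..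
  then have "((\<lambda>t. ln (V t) + (a - \<kappa>) * t) \<longlongrightarrow> l) at_bot"
    by (simp add: filterlim_at_bot_mirror)
  then have "((\<lambda>t. V t * exp ((a - \<kappa>) * t)) \<longlongrightarrow> exp l) at_bot"
    using tendsto_exp exp_ln_V by fastforce
  then show "\<exists>C>0. ((\<lambda>t. V t * exp ((a - \<kappa>) * t)) \<longlongrightarrow> C) at_bot" by (meson exp_gt_zero)
  have "spow p' (spow p a) = a" by (rule spow_inverse[OF p'(3)])
  then show "((\<lambda>t. spow p' (\<theta> t)) \<longlongrightarrow> a) at_bot"
    using isCont_tendsto_compose[OF isCont_spow[OF p'(1)] root(1)] by simp
qed

text \<open>The reflection \<open>- \<theta> (- t)\<close> solves the equation for \<open>P (- x)\<close>, so \<open>approach_to_root\<close> also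
  describes the behaviour at \<open>+ \<infinity>\<close>, with \<open>- b\<close> as the limit of the slope.\<close>

lemma limit_at_top:
  "\<exists>C>0. ((\<lambda>t. V t * exp ((b - \<kappa>) * t)) \<longlongrightarrow> C) at_top"
  "((\<lambda>t. spow p' (\<theta> t)) \<longlongrightarrow> b) at_top"
proof -
  have \<nu>: "(q - p) / p > 0" using p pq by simp
  have conc: "concave_on UNIV (\<lambda>x. P (- x))"
    unfolding concave_on_def
  proof (rule convex_onI)
    fix t x y :: real assume "0 < t" "t < 1"
    then show "- P (- ((1 - t) *\<^sub>R x + t *\<^sub>R y)) \<le> (1 - t) * - P (- x) + t * - P (- y)"
      using concave_onD[OF concave_P, of t "- x" "- y"] by (simp add: algebra_simps)
  qed auto
  have d: "((\<lambda>s. - \<theta> (- s)) has_real_derivative (q - p) / p * P (- (- \<theta> (- s)))) (at s)" for s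
    using DERIV_minus[OF DERIV_chain2[OF d\<theta>[of "- s"] DERIV_minus[OF DERIV_ident, of s]]] by simp
  note root = approach_to_root[OF p \<nu> conc _ d, of "- b"]
  have root1: "((\<lambda>s. - \<theta> (- s)) \<longlongrightarrow> spow p (- b)) at_bot"
    by (rule root(1)) (use Pb P_\<theta>_pos \<theta>_between(2) in \<open>auto simp: spow_minus\<close>)
  have "\<exists>W W' t0 B. \<forall>t\<le>t0. (W has_real_derivative W' t) (at t)
           \<and> spow p' (- \<theta> (- t)) - - b \<le> W' t \<and> \<bar>W t\<bar> \<le> (B::real)"
    by (rule root(2)) (use Pb P_\<theta>_pos \<theta>_between(2) in \<open>auto simp: spow_minus\<close>)
  then obtain W W' t0 B where W: "\<And>t. t \<le> t0 \<Longrightarrow> (W has_real_derivative W' t) (at t)"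
    "\<And>t. t \<le> t0 \<Longrightarrow> spow p' (- \<theta> (- t)) - - b \<le> W' t" "\<And>t. t \<le> t0 \<Longrightarrow> \<bar>W t\<bar> \<le> (B::real)"
    by blast
  have "\<exists>l. ((\<lambda>s. ln (V s) + (b - \<kappa>) * s) \<longlongrightarrow> l) at_top"
  proof (rule dominated_derivative_convergent)
    fix t assume t: "- t0 \<le> t"
    show "((\<lambda>s. ln (V s) + (b - \<kappa>) * s) has_real_derivative (b - spow p' (\<theta> t))) (at t)"
      by (rule d_ln_V)
    have "spow p (spow p' (\<theta> t)) = \<theta> t" by (rule spow_inverse[OF p'(2)])
    then have "spow p' (\<theta> t) < b" using \<theta>_between(2)[of t] p spow_less_iff by metis
    then show "0 \<le> b - spow p' (\<theta> t)" by simp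
    show "((\<lambda>s. - W (- s)) has_real_derivative W' (- t)) (at t)"
      using DERIV_minus[OF DERIV_chain2[OF W(1)[of "- t"] DERIV_minus[OF DERIV_ident, of t]]] t by simp
    show "b - spow p' (\<theta> t) \<le> W' (- t)" "- W (- t) \<le> B"
      using W(2,3)[of "- t"] t by (auto simp: spow_minus)
  qed
  then obtain l where "((\<lambda>t. ln (V t) + (b - \<kappa>) * t) \<longlongrightarrow> l) at_top" ..
  then have "((\<lambda>t. V t * exp ((b - \<kappa>) * t)) \<longlongrightarrow> exp l) at_top"
    using tendsto_exp exp_ln_V by fastforce
  then show "\<exists>C>0. ((\<lambda>t. V t * exp ((b - \<kappa>) * t)) \<longlongrightarrow> C) at_top" by (meson exp_gt_zero)
  have "spow p' (spow p b) = b" by (rule spow_inverse[OF p'(3)])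
  moreover have "(\<theta> \<longlongrightarrow> spow p b) at_top"
    using tendsto_minus[OF root1] by (simp add: spow_minus filterlim_at_bot_mirror)
  ultimately show "((\<lambda>t. spow p' (\<theta> t)) \<longlongrightarrow> b) at_top"
    using isCont_tendsto_compose[OF isCont_spow[OF p'(1)]] by fastforce
qed

end

end

section \<open>Integration on the line and in the radial variable\<close>

text \<open>On a bounded interval the positive and the negative part of \<open>d\<close> are densities of finite
  measures that agree on half-lines, so the two parts are equal almost everywhere.\<close>

lemma AE_zero_of_interval_integrals:
  fixes d :: "real \<Rightarrow> real"
  assumes int: "\<And>a b. set_integrable lborel {a..b} d"
    and zero: "\<And>a b. a \<le> b \<Longrightarrow> (LINT t:{a..b}|lborel. d t) = 0"
  shows "AE t in lborel. d t = 0"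
proof -
  have "AE t in lborel. indicator {- real n..real n} t * d t = 0" for n
  proof -
    define D where "D t = indicator {- real n..real n} t * d t" for t
    have D: "integrable lborel D"
      using int[of "- real n" "real n"] by (simp add: D_def[abs_def] set_integrable_def)
    have [measurable]: "D \<in> borel_measurable lborel"
      using D by (rule borel_measurable_integrable)
    have tail: "(\<integral>\<^sup>+t\<in>{x<..}. ennreal (D t) \<partial>lborel) = (\<integral>\<^sup>+t\<in>{x<..}. ennreal (- D t) \<partial>lborel)" for x
    proof -
      define E where "E t = indicator {x<..} t * D t" for t
      have E: "integrable lborel E"
        unfolding E_def using integrable_mult_indicator[OF _ D, of "{x<..}"] by simp
      have "(LINT t|lborel. E t) = 0"
      proof (cases "max x (- real n) \<le> real n")
        case True
        have "AE t in lborel. t \<noteq> max x (- real n)"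
          by (rule AE_lborel_singleton)
        then have "AE t in lborel. E t = indicator {max x (- real n)..real n} t *\<^sub>R d t"
          by eventually_elim (auto simp: E_def D_def indicator_def)
        then have "(LINT t|lborel. E t) = (LINT t:{max x (- real n)..real n}|lborel. d t)"
          unfolding set_lebesgue_integral_def
          using E int[of "max x (- real n)" "real n"]
          by (intro integral_cong_AE) (auto simp: set_integrable_def)
        then show ?thesis using zero[OF True] by simp
      next
        case False
        then have "E t = 0" for t by (auto simp: E_def D_def indicator_def)
        then show ?thesis by simp
      qed
      moreover have "(\<integral>\<^sup>+t. ennreal (E t) \<partial>lborel) < \<infinity>" "(\<integral>\<^sup>+t. ennreal (- E t) \<partial>lborel) < \<infinity>"
        using real_integrable_def[of lborel E] E by (auto simp: top.not_eq_extremum)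
      ultimately have "(\<integral>\<^sup>+t. ennreal (E t) \<partial>lborel) = (\<integral>\<^sup>+t. ennreal (- E t) \<partial>lborel)"
        using real_lebesgue_integral_def[OF E]
        by (metis (no_types, lifting) diff_eq_diff_eq ennreal_enn2real diff_self infinity_ennreal_def)
      moreover have "ennreal (E t) = ennreal (D t) * indicator {x<..} t"
          "ennreal (- E t) = ennreal (- D t) * indicator {x<..} t" for t
        by (auto simp: E_def indicator_def)
      ultimately show ?thesis by simp
    qed
    have "density lborel (\<lambda>t. ennreal (D t)) = density lborel (\<lambda>t. ennreal (- D t))"
    proof (rule measure_eqI_lessThan)
      fix x
      show "emeasure (density lborel (\<lambda>t. ennreal (D t))) {x<..}
          = emeasure (density lborel (\<lambda>t. ennreal (- D t))) {x<..}"
        using tail[of x] by (simp add: emeasure_density)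
      have "(\<integral>\<^sup>+t\<in>{x<..}. ennreal (D t) \<partial>lborel) \<le> (\<integral>\<^sup>+t. ennreal (D t) \<partial>lborel)"
        by (intro nn_integral_mono) (auto simp: indicator_def)
      also have "\<dots> < \<infinity>"
        using real_integrable_def[of lborel D] D by (auto simp: top.not_eq_extremum)
      finally show "emeasure (density lborel (\<lambda>t. ennreal (D t))) {x<..} < \<infinity>"
        by (simp add: emeasure_density)
    qed auto
    then have "AE t in lborel. ennreal (D t) = ennreal (- D t)"
      by (intro sigma_finite_measure.density_unique[OF lborel.sigma_finite_measure_axioms]) auto
    then show ?thesis
      unfolding D_def[symmetric]
    proof eventually_elim
      case (elim t)
      then show ?case
        by (cases "0 \<le> D t") (auto simp: ennreal_neg ennreal_eq_0_iff dest: sym)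
    qed
  qed
  then have "AE t in lborel. \<forall>n::nat. indicator {- real n..real n} t * d t = 0"
    unfolding AE_all_countable by blast
  then show ?thesis
  proof eventually_elim
    case (elim t)
    obtain n :: nat where "\<bar>t\<bar> \<le> real n" using real_arch_simple by blast
    with elim[rule_format, of n] show ?case by (auto simp: indicator_def abs_le_iff split: if_splits)
  qed
qed

lemma AE_lborel_eq_imp_eq:
  fixes f g :: "'a::euclidean_space \<Rightarrow> real"
  assumes "continuous_on UNIV f" "continuous_on UNIV g" "AE x in lborel. f x = g x"
  shows "f x = g x"
proof -
  have "closed {x. f x = g x}" using assms by (intro closed_Collect_eq)
  moreover have "AE x in lebesgue. x \<in> {x. f x = g x}"
    using AE_completion[OF assms(3)] by simp
  ultimately show ?thesis using mem_closed_if_AE_lebesgue by blast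
qed

lemma primitive_diff:
  fixes G :: "real \<Rightarrow> real"
  assumes G: "\<And>a b. set_integrable lborel {a..b} G" and "a \<le> b"
  shows "(LBINT t=0..b. G t) - (LBINT t=0..a. G t) = (LINT t:{a..b}|lborel. G t)"
proof -
  define l r where "l = min 0 a" and "r = max 0 b"
  have "set_integrable lborel (einterval (ereal l) (ereal r)) G"
    by (rule set_integrable_subset[OF G[of l r]]) (auto simp: einterval_iff)
  then have "interval_lebesgue_integrable lborel (min 0 (min (ereal a) (ereal b))) (max 0 (max (ereal a) (ereal b))) G"
    using \<open>a \<le> b\<close> unfolding interval_lebesgue_integrable_def l_def r_def
    by (simp add: min_def max_def zero_ereal_def split: if_splits)
  then have "(LBINT t=0..ereal a. G t) + (LBINT t=ereal a..ereal b. G t) = (LBINT t=0..ereal b. G t)"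
    by (rule interval_integral_sum)
  then show ?thesis using interval_integral_Icc[OF \<open>a \<le> b\<close>, of G] by simp
qed

lemma continuous_on_primitive:
  fixes G :: "real \<Rightarrow> real"
  assumes G: "\<And>a b. set_integrable lborel {a..b} G"
  shows "continuous_on UNIV (\<lambda>a. LBINT t=0..ereal a. G t)"
proof -
  have "isCont (\<lambda>a. LBINT t=0..ereal a. G t) x" for x :: real
  proof -
    define l where "l = x - 1"
    have eq: "(LBINT t=0..a. G t) = (LBINT t=0..l. G t) + integral {l..a} G" if "a \<in> {l..x + 1}" for a
      using primitive_diff[OF G, of l a] set_borel_integral_eq_integral(2)[OF G[of l a]] that by simp
    have cont: "continuous_on {l..x + 1} (\<lambda>a. (LBINT t=0..l. G t) + integral {l..a} G)"
      using set_borel_integral_eq_integral(1)[OF G]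
      by (intro continuous_intros indefinite_integral_continuous_1)
    have "continuous_on {l..x + 1} (\<lambda>a. LBINT t=0..ereal a. G t)"
      by (rule continuous_on_eq[OF cont eq[symmetric]])
    then show ?thesis
      by (rule continuous_on_interior) (simp add: l_def)
  qed
  then show ?thesis by (simp add: continuous_at_imp_continuous_on)
qed

lemma AE_zero_of_primitive:
  fixes G :: "real \<Rightarrow> real"
  assumes G: "\<And>a b. set_integrable lborel {a..b} G" and ae: "AE a in lborel. (LBINT t=0..a. G t) = 0"
  shows "AE t in lborel. G t = 0"
proof -
  have z: "(LBINT t=0..ereal a. G t) = 0" for a
    using AE_lborel_eq_imp_eq[OF continuous_on_primitive[OF G] continuous_on_const ae] .
  show ?thesis
  proof (rule AE_zero_of_interval_integrals[OF G])
    show "(LINT t:{a..b}|lborel. G t) = 0" if "a \<le> b" for a b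
      using primitive_diff[OF G that] z[of a] z[of b] by simp
  qed
qed

lemma set_integral_shift:
  fixes h :: "real \<Rightarrow> real"
  shows "(LINT t:{a..b}|lborel. h (t + c)) = (LINT t:{a + c..b + c}|lborel. h t)"
    and "set_integrable lborel {a..b} (\<lambda>t. h (t + c)) \<longleftrightarrow> set_integrable lborel {a + c..b + c} h"
proof -
  have "indicator {a..b} t *\<^sub>R h (t + c) = indicator {a + c..b + c} (c + 1 * t) *\<^sub>R h (c + 1 * t)" for t
    by (simp add: indicator_def add.commute)
  then show "(LINT t:{a..b}|lborel. h (t + c)) = (LINT t:{a + c..b + c}|lborel. h t)"
    "set_integrable lborel {a..b} (\<lambda>t. h (t + c)) \<longleftrightarrow> set_integrable lborel {a + c..b + c} h"
    using lborel_integral_real_affine[of 1 "\<lambda>t. indicator {a + c..b + c} t *\<^sub>R h t" c]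
      lborel_integrable_real_affine_iff[of 1 "\<lambda>t. indicator {a + c..b + c} t *\<^sub>R h t" c]
    unfolding set_lebesgue_integral_def set_integrable_def by simp_all
qed

lemma AE_lborel_shift:
  fixes c :: real
  assumes "AE t in lborel. Q t"
  shows "AE t in lborel. Q (t + c)"
proof -
  from assms obtain Z where Z: "Z \<in> null_sets lborel" "{x. \<not> Q x} \<subseteq> Z"
    by (auto elim!: AE_E simp: null_sets_def)
  then have "AE t in lborel. t \<notin> Z" by (simp add: AE_not_in)
  moreover have "Measurable.pred borel (\<lambda>t. t \<notin> Z)" using Z by auto
  ultimately have "AE t in lborel. c + 1 * t \<notin> Z"
    by (intro AE_borel_affine[where P = "\<lambda>t. t \<notin> Z"]) auto
  then show ?thesis
    by eventually_elim (use Z in \<open>auto simp: add.commute\<close>)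
qed

lemma has_real_derivative_primitive:
  fixes f :: "real \<Rightarrow> real"
  assumes f: "continuous_on UNIV f"
  shows "((\<lambda>t. LBINT s=0..ereal t. f s) has_real_derivative f t) (at t)"
proof -
  define l r where "l = min 0 t - 1" and "r = max 0 t + 1"
  have "((\<lambda>t. LBINT s=ereal 0..ereal t. f s) has_vector_derivative f t) (at t within {l..r})"
    by (intro interval_integral_FTC2 continuous_on_subset[OF f]) (auto simp: l_def r_def)
  moreover have "at t within {l..r} = at t"
    by (intro at_within_interior) (auto simp: l_def r_def)
  ultimately show ?thesis
    by (simp add: zero_ereal_def has_real_derivative_iff_has_vector_derivative)
qed

lemma set_integrable_continuous:
  fixes f :: "real \<Rightarrow> real"
  shows "continuous_on UNIV f \<Longrightarrow> set_integrable lborel {a..b} f"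
  by (rule borel_integrable_atLeastAtMost'[OF continuous_on_subset[OF _ subset_UNIV]])

text \<open>Polar coordinates for functions of \<open>ln |x|\<close>. Both measures are determined by their values on
  half-lines, and the left one gives the volumes of balls; since the half-lines of finite
  measure extend to \<open>- \<infinity>\<close>, the comparison is made for \<open>- ln |x|\<close>.\<close>

lemma distr_ln_norm:
  fixes C N :: real
  defines "N \<equiv> real DIM('a::euclidean_space)"
  defines "C \<equiv> N * unit_ball_vol N"
  shows "distr lborel borel (\<lambda>x::'a. ln (norm x)) = density lborel (\<lambda>t. ennreal (C * exp (N * t)))"
proof -
  have N: "N > 0" by (simp add: N_def)
  have C: "C \<ge> 0" using N by (simp add: C_def)
  let ?M = "distr lborel borel (\<lambda>x::'a. - ln (norm x))"
  let ?D = "density lborel (\<lambda>t. ennreal (C * exp (- N * t)))"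
  have eq: "emeasure ?M {x<..} = ennreal (unit_ball_vol N * exp (- N * x))" for x
  proof -
    have "emeasure ?M {x<..} = emeasure lborel ((\<lambda>y::'a. - ln (norm y)) -` {x<..})"
      by (subst emeasure_distr) (auto simp: borel_measurable_ln)
    also have "\<dots> = emeasure lborel (ball 0 (exp (- x)) :: 'a set)"
    proof (rule emeasure_eq_AE)
      have "AE y in lborel. y \<noteq> (0::'a)" by (rule AE_lborel_singleton)
      then show "AE y in lborel. (y \<in> (\<lambda>y::'a. - ln (norm y)) -` {x<..}) = (y \<in> ball 0 (exp (- x)))"
      proof eventually_elim
        case (elim y)
        then have "ln (norm y) < - x \<longleftrightarrow> norm y < exp (- x)"
          by (metis exp_less_cancel_iff exp_ln zero_less_norm_iff)
        then show ?case by auto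
      qed
      have [measurable]: "(\<lambda>y::'a. - ln (norm y)) \<in> borel_measurable borel" by measurable
      show "(\<lambda>y::'a. - ln (norm y)) -` {x<..} \<in> sets lborel"
        using measurable_sets[of "\<lambda>y::'a. - ln (norm y)" borel borel "{x<..}"] by simp
    qed auto
    also have "\<dots> = ennreal (unit_ball_vol N * exp (- N * x))"
      by (subst emeasure_ball) (auto simp: N_def exp_of_nat_mult[symmetric] algebra_simps)
    finally show ?thesis .
  qed
  have "?M = ?D"
  proof (rule measure_eqI_lessThan)
    fix x
    show "emeasure ?M {x<..} < \<infinity>" by (simp add: eq)
    have "emeasure ?D {x<..} = (\<integral>\<^sup>+t. ennreal (C * exp (- N * t)) * indicator {x<..} t \<partial>lborel)"
      by (simp add: emeasure_density)
    also have "\<dots> = (\<integral>\<^sup>+t. ennreal (C * exp (- N * t)) * indicator {x..} t \<partial>lborel)"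
      by (intro nn_integral_cong_AE, rule AE_mp[OF AE_lborel_singleton[of x]])
         (auto simp: indicator_def)
    also have "\<dots> = ennreal (0 - - (unit_ball_vol N * exp (- N * x)))"
    proof (rule nn_integral_FTC_atLeast)
      fix t
      show "((\<lambda>t. - (unit_ball_vol N * exp (- N * t))) has_real_derivative C * exp (- N * t)) (at t)"
        by (auto intro!: derivative_eq_intros simp: C_def)
      have "((\<lambda>t. exp (- N * t)) \<longlongrightarrow> 0) at_top"
        using N by (intro filterlim_compose[OF exp_at_bot] filterlim_tendsto_neg_mult_at_bot[OF tendsto_const _ filterlim_ident])
           auto
      then show "((\<lambda>t. - (unit_ball_vol N * exp (- N * t))) \<longlongrightarrow> 0) at_top"
        using tendsto_minus[OF tendsto_mult_right_zero[of _ _ "unit_ball_vol N"]] by fastforce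
    qed (use C in auto)
    finally show "emeasure ?M {x<..} = emeasure ?D {x<..}" by (simp add: eq)
  qed auto
  then have "distr ?M borel uminus = distr ?D borel uminus" by simp
  moreover have "distr ?M borel uminus = distr lborel borel (\<lambda>x::'a. ln (norm x))"
    by (subst distr_distr) (auto simp: comp_def)
  moreover have "distr ?D borel uminus = density lborel (\<lambda>t. ennreal (C * exp (N * t)))"
  proof (rule measure_eqI)
    fix A :: "real set" assume "A \<in> sets (distr ?D borel uminus)"
    then have [measurable]: "A \<in> sets borel" by simp
    have "emeasure (distr ?D borel uminus) A
        = (\<integral>\<^sup>+t. ennreal (C * exp (- N * t)) * indicator (uminus -` A) t \<partial>lborel)"
      by (subst emeasure_distr) (auto simp: emeasure_density measurable_sets_borel[of uminus borel])
    also have "\<dots> = (\<integral>\<^sup>+t. ennreal (C * exp (N * t)) * indicator A t \<partial>distr lborel borel uminus)"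
      by (subst nn_integral_distr) (auto intro!: nn_integral_cong simp: indicator_def)
    also have "\<dots> = emeasure (density lborel (\<lambda>t. ennreal (C * exp (N * t)))) A"
      by (simp add: lborel_distr_uminus emeasure_density)
    finally show "emeasure (distr ?D borel uminus) A
        = emeasure (density lborel (\<lambda>t. ennreal (C * exp (N * t)))) A" .
  qed simp
  ultimately show ?thesis by simp
qed

lemma AE_ln_norm:
  assumes "AE t in lborel. Q t"
  shows "AE x in lborel. Q (ln (norm (x::'a::euclidean_space)))"
proof -
  from assms obtain Z where Z: "Z \<in> null_sets lborel" "{x. \<not> Q x} \<subseteq> Z"
    by (auto elim!: AE_E simp: null_sets_def)
  have [measurable]: "Z \<in> sets borel" using Z by auto
  have "AE t in lborel. t \<notin> Z" using Z by (simp add: AE_not_in)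
  then have "AE t in distr lborel borel (\<lambda>x::'a. ln (norm x)). t \<notin> Z"
    unfolding distr_ln_norm by (subst AE_density) auto
  then have "AE x in lborel. ln (norm (x::'a)) \<notin> Z"
    by (subst (asm) AE_distr_iff) auto
  then show ?thesis by eventually_elim (use Z in auto)
qed

lemma nn_integral_ln_norm:
  fixes K :: "real \<Rightarrow> ennreal"
  defines "N \<equiv> real DIM('a::euclidean_space)"
  assumes [measurable]: "K \<in> borel_measurable borel"
  shows "(\<integral>\<^sup>+x. K (ln (norm (x::'a))) \<partial>lborel) = (\<integral>\<^sup>+t. ennreal (N * unit_ball_vol N * exp (N * t)) * K t \<partial>lborel)"
proof -
  have "(\<integral>\<^sup>+x. K (ln (norm (x::'a))) \<partial>lborel) = (\<integral>\<^sup>+t. K t \<partial>distr lborel borel (\<lambda>x::'a. ln (norm x)))"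
    by (subst nn_integral_distr) auto
  then show ?thesis unfolding distr_ln_norm N_def by (simp add: nn_integral_density)
qed

lemma integral_ln_norm:
  fixes K :: "real \<Rightarrow> real"
  defines "N \<equiv> real DIM('a::euclidean_space)"
  assumes [measurable]: "K \<in> borel_measurable borel"
  shows "(LINT x|lborel. K (ln (norm (x::'a)))) = N * unit_ball_vol N * (LINT t|lborel. exp (N * t) * K t)"
proof -
  have "(LINT x|lborel. K (ln (norm (x::'a)))) = (LINT t|distr lborel borel (\<lambda>x::'a. ln (norm x)). K t)"
    by (subst integral_distr) auto
  also have "\<dots> = (LINT t|lborel. (N * unit_ball_vol N * exp (N * t)) *\<^sub>R K t)"
    unfolding distr_ln_norm N_def by (subst integral_density) auto
  also have "\<dots> = N * unit_ball_vol N * (LINT t|lborel. exp (N * t) * K t)"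
    by (simp add: mult.assoc)
  finally show ?thesis .
qed

lemma AE_of_AE_ln_norm:
  assumes "Measurable.pred borel Q" "AE x in lborel. Q (ln (norm (x::'a::euclidean_space)))"
  shows "AE t in lborel. Q t"
proof -
  have [measurable]: "{t. Q t} \<in> sets borel" using assms(1) by (simp add: pred_def)
  have pos: "0 < real DIM('a) * unit_ball_vol (real DIM('a)) * exp (real DIM('a) * t)" for t
    by simp
  have "AE t in distr lborel borel (\<lambda>x::'a. ln (norm x)). Q t"
    using assms by (subst AE_distr_iff) auto
  then have "AE t in lborel. 0 < ennreal (real DIM('a) * unit_ball_vol (real DIM('a)) * exp (real DIM('a) * t)) \<longrightarrow> Q t"
    unfolding distr_ln_norm by (subst (asm) AE_density) auto
  then show ?thesis by eventually_elim (use pos in simp)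
qed

text \<open>The proof of uniqueness of translation invariant measures. With \<open>B\<close> the unit ball, the double
  integral of \<open>1\<^sub>A (y + T x) * 1\<^sub>B y\<close> over \<open>x\<close> and \<open>y\<close> is evaluated in both orders, using
  translation invariance and the invariance of \<open>B\<close> under \<open>T\<close>; this gives the measure of \<open>A\<close>
  under the two measures, times the volume of \<open>B\<close>.\<close>

lemma lborel_distr_orthogonal:
  fixes T :: "'a::euclidean_space \<Rightarrow> 'a"
  assumes T: "orthogonal_transformation T"
  shows "distr lborel borel T = lborel"
proof -
  define S where "S = inv T"
  have bij: "bij T" using T by (simp add: orthogonal_transformation_bij)
  have TS: "T (S y) = y" "S (T y) = y" for y
    using bij by (simp_all add: S_def bij_is_inj bij_is_surj surj_f_inv_f)
  have lin: "linear T" using T by (rule orthogonal_transformation_linear)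
  have S: "orthogonal_transformation S" using T by (simp add: S_def orthogonal_transformation_inv)
  have [measurable]: "T \<in> borel_measurable borel"
    by (intro borel_measurable_continuous_onI linear_continuous_on linear_conv_bounded_linear[THEN iffD1] lin)
  define B where "B = ball (0::'a) 1"
  have [measurable]: "B \<in> sets borel" by (simp add: B_def)
  have B: "emeasure lborel (ball y 1 :: 'a set) = emeasure lborel B" for y :: 'a
    by (simp add: B_def emeasure_ball)
  have shift: "(\<integral>\<^sup>+x. f (c + x) \<partial>lborel) = (\<integral>\<^sup>+x. f x \<partial>lborel)" if [measurable]: "f \<in> borel_measurable borel"
    for f :: "'a \<Rightarrow> ennreal" and c
  proof -
    have "(\<integral>\<^sup>+x. f x \<partial>lborel) = (\<integral>\<^sup>+x. f x \<partial>distr lborel borel ((+) c))"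
      by (simp add: lborel_distr_plus)
    then show ?thesis by (simp add: nn_integral_distr)
  qed
  show ?thesis
  proof (rule measure_eqI)
    fix A :: "'a set" assume "A \<in> sets (distr lborel borel T)"
    then have [measurable]: "A \<in> sets borel" by simp
    let ?A = "indicator A :: 'a \<Rightarrow> ennreal" and ?B = "indicator B :: 'a \<Rightarrow> ennreal"
    have "emeasure (distr lborel borel T) A = (\<integral>\<^sup>+x. ?A (T x) \<partial>lborel)"
      by (simp add: nn_integral_indicator[symmetric] nn_integral_distr del: nn_integral_indicator)
    then have "emeasure (distr lborel borel T) A * emeasure lborel B
        = (\<integral>\<^sup>+y. (\<integral>\<^sup>+x. ?A (T x) \<partial>lborel) * ?B y \<partial>lborel)"
      by (simp add: nn_integral_cmult)
    also have "\<dots> = (\<integral>\<^sup>+y. (\<integral>\<^sup>+x. ?A (y + T x) * ?B y \<partial>lborel) \<partial>lborel)"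
    proof (rule nn_integral_cong)
      fix y
      have "(\<integral>\<^sup>+x. ?A (T x) \<partial>lborel) = (\<integral>\<^sup>+x. ?A (T (S y + x)) \<partial>lborel)"
        by (rule shift[symmetric]) simp
      also have "\<dots> = (\<integral>\<^sup>+x. ?A (y + T x) \<partial>lborel)"
        by (simp add: linear_add[OF lin] TS)
      finally show "(\<integral>\<^sup>+x. ?A (T x) \<partial>lborel) * ?B y = (\<integral>\<^sup>+x. ?A (y + T x) * ?B y \<partial>lborel)"
        by (simp add: nn_integral_multc)
    qed
    also have "\<dots> = (\<integral>\<^sup>+x. (\<integral>\<^sup>+y. ?A (y + T x) * ?B y \<partial>lborel) \<partial>lborel)"
      by (rule lborel_pair.Fubini') simp
    also have "\<dots> = (\<integral>\<^sup>+x. (\<integral>\<^sup>+y. ?A y * ?B (y - T x) \<partial>lborel) \<partial>lborel)"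
    proof (rule nn_integral_cong)
      fix x
      show "(\<integral>\<^sup>+y. ?A (y + T x) * ?B y \<partial>lborel) = (\<integral>\<^sup>+y. ?A y * ?B (y - T x) \<partial>lborel)"
        using shift[of "\<lambda>y. ?A y * ?B (y - T x)" "T x"] by (simp add: add.commute)
    qed
    also have "\<dots> = (\<integral>\<^sup>+y. (\<integral>\<^sup>+x. ?A y * ?B (y - T x) \<partial>lborel) \<partial>lborel)"
      by (rule lborel_pair.Fubini') simp
    also have "\<dots> = (\<integral>\<^sup>+y. ?A y * emeasure lborel B \<partial>lborel)"
    proof (rule nn_integral_cong)
      fix y
      have "?B (y - T x) = indicator (ball (S y) 1) x" for x
      proof -
        have "S y - x = S (y - T x)"
          using linear_diff[OF orthogonal_transformation_linear[OF S]] by (simp add: TS)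
        then have "norm (S y - x) = norm (y - T x)"
          using orthogonal_transformation_norm[OF S] by metis
        then show ?thesis by (simp add: B_def indicator_def dist_norm norm_minus_commute[of "T x"])
      qed
      then show "(\<integral>\<^sup>+x. ?A y * ?B (y - T x) \<partial>lborel) = ?A y * emeasure lborel B"
        using nn_integral_cmult_indicator[of "ball (S y) 1" lborel "?A y"] by (simp add: B)
    qed
    also have "\<dots> = emeasure lborel A * emeasure lborel B"
      by (simp add: nn_integral_multc)
    finally have "emeasure (distr lborel borel T) A * emeasure lborel B = emeasure lborel A * emeasure lborel B" .
    moreover have "emeasure lborel B \<noteq> 0" "emeasure lborel B \<noteq> top"
      by (auto simp: B_def emeasure_ball ennreal_eq_0_iff not_le)
    ultimately show "emeasure (distr lborel borel T) A = emeasure lborel A"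
      by (simp add: ennreal_mult_cancel_left mult.commute[of _ "emeasure lborel B"])
  qed simp
qed

section \<open>Increments along flows\<close>

lemma borel_measurable_ball [measurable]: "ball c r \<in> sets borel"
  by simp

text \<open>This stands for the passage to an almost everywhere convergent subsequence: a quantity bounded
  by every \<open>f k\<close> vanishes almost everywhere.\<close>

lemma AE_INF_eq_0:
  fixes f :: "nat \<Rightarrow> 'a \<Rightarrow> ennreal"
  assumes [measurable]: "\<And>k. f k \<in> borel_measurable M" and "(INF k. \<integral>\<^sup>+x. f k x \<partial>M) = 0"
  shows "AE x in M. (INF k. f k x) = 0"
proof -
  have "(\<integral>\<^sup>+x. (INF k. f k x) \<partial>M) \<le> (INF k. \<integral>\<^sup>+x. f k x \<partial>M)"
    by (intro INF_greatest nn_integral_mono INF_lower) auto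
  then have "(\<integral>\<^sup>+x. (INF k. f k x) \<partial>M) = 0" using assms(2) by simp
  then show ?thesis by (subst (asm) nn_integral_0_iff_AE) auto
qed

lemma ennreal_interval_integral_le:
  fixes f :: "real \<Rightarrow> real"
  assumes f: "set_integrable lborel {- T..T} f" and a: "a \<in> {- T..T}"
  shows "ennreal \<bar>LBINT t=0..a. f t\<bar> \<le> (\<integral>\<^sup>+t\<in>{- T..T}. ennreal \<bar>f t\<bar> \<partial>lborel)"
proof -
  define E where "E = {min 0 a..max 0 a}"
  have E: "E \<subseteq> {- T..T}" using a by (auto simp: E_def)
  have fE: "set_integrable lborel E f"
    by (rule set_integrable_subset[OF f]) (use E in \<open>auto simp: E_def\<close>)
  have "\<bar>LBINT t=0..a. f t\<bar> = \<bar>LINT t:E|lborel. f t\<bar>"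
  proof (cases "0 \<le> a")
    case True
    then show ?thesis using interval_integral_Icc[of 0 a f] by (simp add: E_def zero_ereal_def)
  next
    case False
    then show ?thesis using interval_integral_Icc[of a 0 f]
      interval_integral_endpoints_reverse[of 0 a f] by (simp add: E_def zero_ereal_def)
  qed
  then have "ennreal \<bar>LBINT t=0..a. f t\<bar> = ennreal (norm (LINT t|lborel. indicator E t *\<^sub>R f t))"
    by (simp add: set_lebesgue_integral_def)
  also have "\<dots> \<le> (\<integral>\<^sup>+t. ennreal (norm (indicator E t *\<^sub>R f t)) \<partial>lborel)"
    using fE by (intro integral_norm_bound_ennreal) (simp add: set_integrable_def)
  also have "\<dots> \<le> (\<integral>\<^sup>+t\<in>{- T..T}. ennreal \<bar>f t\<bar> \<partial>lborel)"
    using E by (intro nn_integral_mono) (auto simp: indicator_def)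
  finally show ?thesis .
qed

text \<open>A family of maps whose orbits are integral curves of \<open>X\<close>, and which multiplies Lebesgue
  measure by a factor \<open>1 / d t\<close>.\<close>

locale measurable_flow =
  fixes \<Theta> :: "real \<Rightarrow> 'a::euclidean_space \<Rightarrow> 'a" and X :: "'a \<Rightarrow> 'a" and d :: "real \<Rightarrow> real"
  assumes cont: "continuous_on UNIV (\<lambda>(t, x). \<Theta> t x)"
    and start: "\<And>x. \<Theta> 0 x = x"
    and cont_X: "continuous_on UNIV X"
    and deriv: "\<And>t x. ((\<lambda>t. \<Theta> t x) has_vector_derivative X (\<Theta> t x)) (at t)"
    and d_pos: "\<And>t. 0 < d t"
    and d_bounded: "\<And>T. \<exists>D. \<forall>t\<in>{- T..T}. d t \<le> D"
    and nn_integral_flow: "\<And>f t. f \<in> borel_measurable borel \<Longrightarrow>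
           (\<integral>\<^sup>+x. f (\<Theta> t x) \<partial>lborel) = ennreal (d t) * (\<integral>\<^sup>+x. f x \<partial>lborel)"
begin

lemma measurable_flow [measurable (raw)]:
  assumes "f \<in> borel_measurable M" "h \<in> borel_measurable M"
  shows "(\<lambda>w. \<Theta> (f w) (h w)) \<in> borel_measurable M"
proof -
  have "(\<lambda>(t, x). \<Theta> t x) \<in> borel_measurable borel"
    by (rule borel_measurable_continuous_onI[OF cont])
  from measurable_compose[OF _ this, of "\<lambda>w. (f w, h w)" M] assms
  show ?thesis by (simp add: borel_prod[symmetric])
qed

lemma measurable_X [measurable]: "X \<in> borel_measurable borel"
  by (rule borel_measurable_continuous_onI[OF cont_X])

text \<open>By Fubini's theorem, since each map of the flow preserves null sets in both directions.\<close>

lemma AE_flow_iff: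
  assumes [measurable]: "Measurable.pred borel Q"
  shows "(AE x in lborel. AE t in lborel. Q (\<Theta> t x)) \<longleftrightarrow> (AE x in lborel. Q x)"
proof -
  define Z :: "'a \<Rightarrow> ennreal" where "Z x = (if Q x then 0 else 1)" for x
  have [measurable]: "Z \<in> borel_measurable borel" unfolding Z_def by measurable
  have Z: "Z x = 0 \<longleftrightarrow> Q x" for x by (simp add: Z_def)
  have "(AE x in lborel. AE t in lborel. Q (\<Theta> t x))
      \<longleftrightarrow> (AE x in lborel. (\<integral>\<^sup>+t. Z (\<Theta> t x) \<partial>lborel) = 0)"
    by (subst nn_integral_0_iff_AE) (auto simp: Z)
  also have "\<dots> \<longleftrightarrow> (\<integral>\<^sup>+x. (\<integral>\<^sup>+t. Z (\<Theta> t x) \<partial>lborel) \<partial>lborel) = 0"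
    by (subst nn_integral_0_iff_AE) auto
  also have "(\<integral>\<^sup>+x. (\<integral>\<^sup>+t. Z (\<Theta> t x) \<partial>lborel) \<partial>lborel) = (\<integral>\<^sup>+t. (\<integral>\<^sup>+x. Z (\<Theta> t x) \<partial>lborel) \<partial>lborel)"
    by (rule lborel_pair.Fubini'[symmetric]) simp
  also have "\<dots> = (\<integral>\<^sup>+t. ennreal (d t) * (\<integral>\<^sup>+x. Z x \<partial>lborel) \<partial>lborel)"
    by (simp add: nn_integral_flow)
  also have "\<dots> = 0 \<longleftrightarrow> (\<integral>\<^sup>+x. Z x \<partial>lborel) = 0"
  proof
    assume int: "(\<integral>\<^sup>+t. ennreal (d t) * (\<integral>\<^sup>+x. Z x \<partial>lborel) \<partial>lborel) = 0"
    have "(\<lambda>t. ennreal (d t) * (\<integral>\<^sup>+x. Z x \<partial>lborel)) = (\<lambda>t. \<integral>\<^sup>+x. Z (\<Theta> t x) \<partial>lborel)"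
      by (simp add: nn_integral_flow)
    also have "\<dots> \<in> borel_measurable lborel" by measurable
    finally have "AE t in lborel. ennreal (d t) * (\<integral>\<^sup>+x. Z x \<partial>lborel) = 0"
      using int by (subst (asm) nn_integral_0_iff_AE) auto
    then have "\<exists>t. ennreal (d t) * (\<integral>\<^sup>+x. Z x \<partial>lborel) = 0"
      by (rule eventually_happens'[rotated]) (simp add: ae_filter_eq_bot_iff)
    then show "(\<integral>\<^sup>+x. Z x \<partial>lborel) = 0" using d_pos by (auto simp: ennreal_eq_0_iff not_le[symmetric])
  qed simp
  also have "\<dots> \<longleftrightarrow> (AE x in lborel. Q x)"
    by (subst nn_integral_0_iff_AE) (auto simp: Z)
  finally show ?thesis .
qed

lemma AE_flow:
  assumes "AE x in lborel. Q x"
  shows "AE x in lborel. AE t in lborel. Q (\<Theta> t x)"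
proof -
  from assms obtain Z where Z: "Z \<in> null_sets lborel" "{x. \<not> Q x} \<subseteq> Z"
    by (auto elim!: AE_E simp: null_sets_def)
  then have "AE x in lborel. x \<notin> Z" by (simp add: AE_not_in)
  moreover have "Measurable.pred borel (\<lambda>x. x \<notin> Z)" using Z by auto
  ultimately have "AE x in lborel. AE t in lborel. \<Theta> t x \<notin> Z"
    by (rule AE_flow_iff[THEN iffD2, rotated])
  then show ?thesis
    by eventually_elim (use Z in \<open>auto elim!: eventually_mono\<close>)
qed

lemma orbit_bound: "\<exists>R'. \<forall>t\<in>{- T..T}. \<forall>x\<in>ball 0 R. \<Theta> t x \<in> ball 0 R'"
proof -
  have "compact ((\<lambda>(t, x). \<Theta> t x) ` ({- T..T} \<times> cball 0 R))"
    by (intro compact_continuous_image compact_Times continuous_on_subset[OF cont]) auto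
  then have "bounded ((\<lambda>(t, x). \<Theta> t x) ` ({- T..T} \<times> cball 0 R))" by (rule compact_imp_bounded)
  then obtain B where B: "\<forall>y \<in> (\<lambda>(t, x). \<Theta> t x) ` ({- T..T} \<times> cball 0 R). norm y \<le> B"
    unfolding bounded_iff by blast
  have "norm (\<Theta> t x) < B + 1" if "t \<in> {- T..T}" "x \<in> ball 0 R" for t x
    using bspec[OF B, of "\<Theta> t x"] that by force
  then show ?thesis by (intro exI[of _ "B + 1"]) simp
qed

text \<open>Orbits of bounded duration that start in a ball stay in a larger ball, and the change of
  measure along them is bounded.\<close>

lemma nn_integral_sweep:
  assumes "0 \<le> T"
  obtains C R' where "0 \<le> C"
    "\<And>w. w \<in> borel_measurable borel \<Longrightarrow> (\<integral>\<^sup>+x\<in>ball 0 R. (\<integral>\<^sup>+t\<in>{- T..T}. w (\<Theta> t x) \<partial>lborel) \<partial>lborel)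
       \<le> ennreal C * (\<integral>\<^sup>+x\<in>ball 0 R'. w x \<partial>lborel)"
proof -
  obtain R' where R': "\<And>t x. t \<in> {- T..T} \<Longrightarrow> x \<in> ball 0 R \<Longrightarrow> \<Theta> t x \<in> ball 0 R'"
    using orbit_bound[of T R] by blast
  obtain D where D: "\<And>t. t \<in> {- T..T} \<Longrightarrow> d t \<le> D" using d_bounded[of T] by blast
  have D0: "0 \<le> D" using D[of 0] d_pos[of 0] assms by auto
  have "(\<integral>\<^sup>+x\<in>ball 0 R. (\<integral>\<^sup>+t\<in>{- T..T}. w (\<Theta> t x) \<partial>lborel) \<partial>lborel)
       \<le> ennreal (D * (2 * T)) * (\<integral>\<^sup>+x\<in>ball 0 R'. w x \<partial>lborel)"
    if [measurable]: "w \<in> borel_measurable borel" for w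
  proof -
    define W where "W = (\<integral>\<^sup>+x\<in>ball 0 R'. w x \<partial>lborel)"
    define w' where "w' x = w x * indicator (ball 0 R') x" for x
    have [measurable]: "w' \<in> borel_measurable borel" unfolding w'_def by measurable
    have "(\<integral>\<^sup>+x\<in>ball 0 R. (\<integral>\<^sup>+t\<in>{- T..T}. w (\<Theta> t x) \<partial>lborel) \<partial>lborel)
        = (\<integral>\<^sup>+x. (\<integral>\<^sup>+t. w (\<Theta> t x) * indicator {- T..T} t * indicator (ball 0 R) x \<partial>lborel) \<partial>lborel)"
      by (intro nn_integral_cong nn_integral_multc[symmetric]) simp
    also have "\<dots> \<le> (\<integral>\<^sup>+x. (\<integral>\<^sup>+t. w' (\<Theta> t x) * indicator {- T..T} t \<partial>lborel) \<partial>lborel)"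
      using R' by (intro nn_integral_mono) (auto simp: indicator_def w'_def)
    also have "\<dots> = (\<integral>\<^sup>+t. (\<integral>\<^sup>+x. w' (\<Theta> t x) * indicator {- T..T} t \<partial>lborel) \<partial>lborel)"
      by (rule lborel_pair.Fubini'[symmetric]) simp
    also have "\<dots> = (\<integral>\<^sup>+t. ennreal (d t) * W * indicator {- T..T} t \<partial>lborel)"
      by (intro nn_integral_cong)
         (simp add: nn_integral_multc nn_integral_flow W_def w'_def[symmetric])
    also have "\<dots> \<le> (\<integral>\<^sup>+t. ennreal D * W * indicator {- T..T} t \<partial>lborel)"
      using D by (intro nn_integral_mono) (auto simp: indicator_def intro!: mult_right_mono ennreal_leI)
    also have "\<dots> = ennreal (D * (2 * T)) * W"
    proof -
      have "(\<integral>\<^sup>+t. ennreal D * W * indicator {- T..T} t \<partial>lborel) = ennreal D * W * emeasure lborel {- T..T}"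
        by (rule nn_integral_cmult_indicator) simp
      also have "emeasure lborel {- T..T} = ennreal (2 * T)" using assms by simp
      finally show ?thesis using assms D0 by (simp add: ennreal_mult ac_simps)
    qed
    finally show ?thesis by (simp add: W_def)
  qed
  with R' D0 assms show ?thesis
    by (intro that[of "D * (2 * T)" R']) auto
qed

text \<open>For the smooth approximations \<open>\<phi> k\<close> the increment along an orbit is the integral of the
  derivative \<open>\<phi>' k \<bullet> X\<close>. The error made in replacing \<open>\<phi> k\<close> by \<open>u\<close> and \<open>\<phi>' k\<close> by \<open>g\<close> on the
  orbit of \<open>x\<close>, integrated over the duration, is at most \<open>B k x\<close>; the integral of \<open>B k\<close> over a
  ball tends to zero because sweeping along the flow is bounded in \<open>L\<^sup>1\<close>.\<close>

theorem AE_increment: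
  fixes u :: "'a \<Rightarrow> real" and g :: "'a \<Rightarrow> 'a"
  assumes [measurable]: "u \<in> borel_measurable borel" "g \<in> borel_measurable borel"
    and d\<phi>: "\<And>k x. (\<phi> k has_derivative (\<lambda>h. \<phi>' k x \<bullet> h)) (at x)"
    and cont_\<phi>': "\<And>k::nat. continuous_on UNIV (\<phi>' k)"
    and lim_u: "\<And>R. (\<lambda>k. \<integral>\<^sup>+x\<in>ball 0 R. ennreal \<bar>\<phi> k x - u x\<bar> \<partial>lborel) \<longlonglongrightarrow> 0"
    and lim_g: "\<And>R. (\<lambda>k. \<integral>\<^sup>+x\<in>ball 0 R. ennreal (norm (\<phi>' k x - g x)) \<partial>lborel) \<longlonglongrightarrow> 0"
  defines "G \<equiv> \<lambda>x t. g (\<Theta> t x) \<bullet> X (\<Theta> t x)"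
  shows "AE x in lborel. (\<forall>a b. set_integrable lborel {a..b} (G x)) \<and>
           (AE a in lborel. u (\<Theta> a x) - u x = (LBINT t=0..a. G x t))"
proof -
  have cont_\<phi>: "continuous_on UNIV (\<phi> k)" for k
    using d\<phi> has_derivative_continuous by (metis continuous_at_imp_continuous_on)
  have [measurable]: "\<phi> k \<in> borel_measurable borel" "\<phi>' k \<in> borel_measurable borel" for k
    using cont_\<phi> cont_\<phi>' by (auto intro: borel_measurable_continuous_onI)
  have local: "AE x in lborel. x \<in> ball 0 (real m) \<longrightarrow> set_integrable lborel {- real (Suc n)..real (Suc n)} (G x) \<and>
      (AE a in lborel. a \<in> {- real (Suc n)..real (Suc n)} \<longrightarrow> u (\<Theta> a x) - u x = (LBINT t=0..a. G x t))"
    for n m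
  proof -
    define T where "T = real (Suc n)"
    define I where "I = {- T..T}"
    define R where "R = real m"
    have T: "0 < T" "0 \<le> T" by (simp_all add: T_def)
    have [measurable]: "I \<in> sets borel" by (simp add: I_def)
    have eI: "emeasure lborel I = ennreal (2 * T)" using T by (simp add: I_def)
    define e where "e k x = ennreal \<bar>\<phi> k x - u x\<bar>" for k x
    define f where "f k x = ennreal (norm (\<phi>' k x - g x) * norm (X x))" for k x
    have [measurable]: "e k \<in> borel_measurable borel" "f k \<in> borel_measurable borel" for k
      unfolding e_def f_def by measurable
    \<comment> \<open>the integral over \<open>a \<in> I\<close> of the bound \<open>e k (\<Theta> a x) + c k\<close> for the error at time \<open>a\<close>\<close>
    define B where "B k x = ((\<integral>\<^sup>+t\<in>I. e k (\<Theta> t x) \<partial>lborel) + ennreal (2 * T) * e k x)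
        + ennreal (2 * T) * (\<integral>\<^sup>+t\<in>I. f k (\<Theta> t x) \<partial>lborel)" for k x
    have [measurable]: "B k \<in> borel_measurable borel" for k
      unfolding B_def by measurable
    obtain C R' where C: "0 \<le> C"
      and sweep: "\<And>w. w \<in> borel_measurable borel \<Longrightarrow>
        (\<integral>\<^sup>+x\<in>ball 0 R. (\<integral>\<^sup>+t\<in>{- T..T}. w (\<Theta> t x) \<partial>lborel) \<partial>lborel) \<le> ennreal C * (\<integral>\<^sup>+x\<in>ball 0 R'. w x \<partial>lborel)"
      using nn_integral_sweep[OF T(2), of R] by blast
    note sweep = sweep[folded I_def]
    have "bounded (X ` cball 0 R')"
      by (intro compact_imp_bounded compact_continuous_image continuous_on_subset[OF cont_X]) auto
    then obtain K where K: "K > 0" "\<And>x. x \<in> cball 0 R' \<Longrightarrow> norm (X x) \<le> K"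
      by (auto simp: bounded_pos)
    have f_le: "(\<integral>\<^sup>+x\<in>ball 0 R'. f k x \<partial>lborel) \<le> ennreal K * (\<integral>\<^sup>+x\<in>ball 0 R'. ennreal (norm (\<phi>' k x - g x)) \<partial>lborel)" for k
    proof -
      have "(\<integral>\<^sup>+x\<in>ball 0 R'. f k x \<partial>lborel)
          \<le> (\<integral>\<^sup>+x. ennreal K * (ennreal (norm (\<phi>' k x - g x)) * indicator (ball 0 R') x) \<partial>lborel)"
        using K by (intro nn_integral_mono)
          (auto simp: f_def indicator_def ennreal_mult'[symmetric] mult.commute intro!: ennreal_leI mult_right_mono)
      also have "\<dots> = ennreal K * (\<integral>\<^sup>+x\<in>ball 0 R'. ennreal (norm (\<phi>' k x - g x)) \<partial>lborel)"
        by (rule nn_integral_cmult) simp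
      finally show ?thesis .
    qed
    define b where "b k = (ennreal C * (\<integral>\<^sup>+x\<in>ball 0 R'. e k x \<partial>lborel)
          + ennreal (2 * T) * (\<integral>\<^sup>+x\<in>ball 0 R. e k x \<partial>lborel))
          + ennreal (2 * T) * (ennreal C * (ennreal K * (\<integral>\<^sup>+x\<in>ball 0 R'. ennreal (norm (\<phi>' k x - g x)) \<partial>lborel)))" for k
    have B_le: "(\<integral>\<^sup>+x. B k x * indicator (ball 0 R) x \<partial>lborel) \<le> b k" for k
    proof -
      have "(\<integral>\<^sup>+x. B k x * indicator (ball 0 R) x \<partial>lborel)
         = ((\<integral>\<^sup>+x\<in>ball 0 R. (\<integral>\<^sup>+t\<in>I. e k (\<Theta> t x) \<partial>lborel) \<partial>lborel)
          + ennreal (2 * T) * (\<integral>\<^sup>+x\<in>ball 0 R. e k x \<partial>lborel))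
          + ennreal (2 * T) * (\<integral>\<^sup>+x\<in>ball 0 R. (\<integral>\<^sup>+t\<in>I. f k (\<Theta> t x) \<partial>lborel) \<partial>lborel)"
        by (simp add: B_def distrib_right nn_integral_add nn_integral_cmult mult.assoc)
      also have "\<dots> \<le> b k"
        unfolding b_def
        by (intro add_mono mult_left_mono sweep order_trans[OF sweep] f_le) auto
      finally show ?thesis .
    qed
    have "b \<longlonglongrightarrow> (ennreal C * 0 + ennreal (2 * T) * 0) + ennreal (2 * T) * (ennreal C * (ennreal K * 0))"
      unfolding b_def e_def
      by (intro tendsto_add ennreal_tendsto_cmult lim_u lim_g) auto
    then have b0: "b \<longlonglongrightarrow> 0" by simp
    have "(INF k. \<integral>\<^sup>+x. B k x * indicator (ball 0 R) x \<partial>lborel) \<le> 0"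
    proof (rule LIMSEQ_le_const[OF b0], intro exI allI impI)
      fix k show "(INF k. \<integral>\<^sup>+x. B k x * indicator (ball 0 R) x \<partial>lborel) \<le> b k"
        using B_le by (meson INF_lower2 UNIV_I)
    qed
    then have "AE x in lborel. (INF k. B k x * indicator (ball 0 R) x) = 0"
      by (intro AE_INF_eq_0) auto
    then have "AE x in lborel. x \<in> ball 0 R \<longrightarrow> set_integrable lborel I (G x) \<and>
      (AE a in lborel. a \<in> I \<longrightarrow> u (\<Theta> a x) - u x = (LBINT t=0..a. G x t))"
    proof (eventually_elim, intro impI)
      fix x assume inf: "(INF k. B k x * indicator (ball 0 R) x) = 0" and x: "x \<in> ball 0 R"
      have inf': "(INF k. B k x) = 0" using inf x by simp
      define Gk where "Gk k t = \<phi>' k (\<Theta> t x) \<bullet> X (\<Theta> t x)" for k t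
      have cont_orbit: "continuous_on UNIV (\<lambda>t. \<Theta> t x)"
        using deriv has_vector_derivative_continuous continuous_at_imp_continuous_on by blast
      have cont_Gk: "continuous_on UNIV (Gk k)" for k
        unfolding Gk_def
        by (intro continuous_intros continuous_on_compose2[OF cont_\<phi>' cont_orbit]
            continuous_on_compose2[OF cont_X cont_orbit]) auto
      have int_Gk: "set_integrable lborel I (Gk k)" for k
        unfolding I_def by (intro borel_integrable_atLeastAtMost' continuous_on_subset[OF cont_Gk]) auto
      have [measurable]: "G x \<in> borel_measurable borel" unfolding G_def by measurable
      have [measurable]: "Gk k \<in> borel_measurable borel" for k
        unfolding Gk_def by measurable
      have diff_le: "ennreal \<bar>Gk k t - G x t\<bar> \<le> f k (\<Theta> t x)" for k t
        unfolding f_def Gk_def G_def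
        by (intro ennreal_leI) (simp add: inner_diff_left[symmetric] Cauchy_Schwarz_ineq2)
      have "(INF k. B k x) < top" by (simp add: inf')
      then obtain k0 where "B k0 x < top" by (auto simp: INF_less_iff)
      then have "ennreal (2 * T) * (\<integral>\<^sup>+t\<in>I. f k0 (\<Theta> t x) \<partial>lborel) < top"
        unfolding B_def by (auto simp: less_top[symmetric] ennreal_add_eq_top)
      then have fin: "(\<integral>\<^sup>+t\<in>I. f k0 (\<Theta> t x) \<partial>lborel) < top"
        using T by (auto simp: ennreal_mult_less_top ennreal_eq_0_iff)
      have "set_integrable lborel I (\<lambda>t. Gk k0 t - G x t)"
        unfolding set_integrable_def
      proof (rule integrableI_bounded)
        have "(\<integral>\<^sup>+t. ennreal (norm (indicator I t *\<^sub>R (Gk k0 t - G x t))) \<partial>lborel) \<le> (\<integral>\<^sup>+t\<in>I. f k0 (\<Theta> t x) \<partial>lborel)"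
          using diff_le by (intro nn_integral_mono) (auto simp: indicator_def)
        also note fin
        finally show "(\<integral>\<^sup>+t. ennreal (norm (indicator I t *\<^sub>R (Gk k0 t - G x t))) \<partial>lborel) < \<infinity>"
          by simp
      qed measurable
      from set_integral_diff(1)[OF int_Gk[of k0] this]
      have int_G: "set_integrable lborel I (G x)" by simp
      define c where "c k = e k x + (\<integral>\<^sup>+t\<in>I. f k (\<Theta> t x) \<partial>lborel)" for k
      have E_le: "ennreal \<bar>u (\<Theta> a x) - u x - (LBINT t=0..a. G x t)\<bar> \<le> e k (\<Theta> a x) + c k"
        if a: "a \<in> I" for a k
      proof -
        have ftc: "(LBINT t=0..a. Gk k t) = \<phi> k (\<Theta> a x) - \<phi> k x"
        proof -
          have "((\<lambda>t. \<phi> k (\<Theta> t x)) has_vector_derivative Gk k t) (at t)" for t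
            using vector_derivative_diff_chain_within[of "\<lambda>t. \<Theta> t x" "X (\<Theta> t x)" t UNIV "\<phi> k" "\<lambda>h. \<phi>' k (\<Theta> t x) \<bullet> h"]
              deriv d\<phi> by (simp add: Gk_def comp_def has_derivative_at_withinI)
          then have "(LBINT t=ereal 0..ereal a. Gk k t) = \<phi> k (\<Theta> a x) - \<phi> k (\<Theta> 0 x)"
            by (intro interval_integral_FTC_finite continuous_on_subset[OF cont_Gk])
               (auto intro: has_vector_derivative_at_within)
          then show ?thesis by (simp add: start zero_ereal_def)
        qed
        have sub: "einterval (min 0 (ereal a)) (max 0 (ereal a)) \<subseteq> I"
          using a by (auto simp: einterval_iff I_def min_def max_def zero_ereal_def split: if_splits)
        have ii: "interval_lebesgue_integrable lborel 0 (ereal a) h" if "set_integrable lborel I h" for h :: "real \<Rightarrow> real"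
        proof -
          have "set_integrable lborel (einterval (min 0 (ereal a)) (max 0 (ereal a))) h"
            by (rule set_integrable_subset[OF that _ sub]) simp
          then show ?thesis
            by (auto simp: interval_lebesgue_integrable_def min_def max_def split: if_splits)
        qed
        have diff: "(LBINT t=0..a. Gk k t - G x t) = (LBINT t=0..a. Gk k t) - (LBINT t=0..a. G x t)"
          by (intro interval_lebesgue_integral_diff ii int_Gk int_G)
        have "ennreal \<bar>LBINT t=0..a. Gk k t - G x t\<bar> \<le> (\<integral>\<^sup>+t\<in>I. ennreal \<bar>Gk k t - G x t\<bar> \<partial>lborel)"
          using a set_integral_diff(1)[OF int_Gk[of k] int_G] unfolding I_def
          by (intro ennreal_interval_integral_le) auto
        also have "\<dots> \<le> (\<integral>\<^sup>+t\<in>I. f k (\<Theta> t x) \<partial>lborel)"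
          by (intro nn_integral_mono mult_right_mono diff_le) auto
        finally have L: "ennreal \<bar>LBINT t=0..a. Gk k t - G x t\<bar> \<le> (\<integral>\<^sup>+t\<in>I. f k (\<Theta> t x) \<partial>lborel)" .
        have "\<bar>u (\<Theta> a x) - u x - (LBINT t=0..a. G x t)\<bar>
            \<le> \<bar>\<phi> k (\<Theta> a x) - u (\<Theta> a x)\<bar> + (\<bar>\<phi> k x - u x\<bar> + \<bar>LBINT t=0..a. Gk k t - G x t\<bar>)"
          unfolding diff ftc by linarith
        then have "ennreal \<bar>u (\<Theta> a x) - u x - (LBINT t=0..a. G x t)\<bar>
            \<le> ennreal (\<bar>\<phi> k (\<Theta> a x) - u (\<Theta> a x)\<bar> + (\<bar>\<phi> k x - u x\<bar> + \<bar>LBINT t=0..a. Gk k t - G x t\<bar>))"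
          by (rule ennreal_leI)
        also have "\<dots> = e k (\<Theta> a x) + (e k x + ennreal \<bar>LBINT t=0..a. Gk k t - G x t\<bar>)"
          by (simp add: e_def)
        also have "\<dots> \<le> e k (\<Theta> a x) + c k"
          unfolding c_def by (intro add_left_mono L)
        finally show ?thesis .
      qed
      have "(\<integral>\<^sup>+a. (e k (\<Theta> a x) + c k) * indicator I a \<partial>lborel) = B k x" for k
      proof -
        have "(\<integral>\<^sup>+a. (e k (\<Theta> a x) + c k) * indicator I a \<partial>lborel)
            = (\<integral>\<^sup>+a. e k (\<Theta> a x) * indicator I a + c k * indicator I a \<partial>lborel)"
          by (simp add: distrib_right)
        also have "\<dots> = (\<integral>\<^sup>+a\<in>I. e k (\<Theta> a x) \<partial>lborel) + c k * emeasure lborel I"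
          by (subst nn_integral_add) (auto simp: nn_integral_cmult_indicator)
        also have "\<dots> = B k x"
          by (simp add: eI B_def c_def distrib_left add.assoc mult.commute)
        finally show ?thesis .
      qed
      then have "AE a in lborel. (INF k. (e k (\<Theta> a x) + c k) * indicator I a) = 0"
        using inf' by (intro AE_INF_eq_0) (auto simp: c_def)
      then have "AE a in lborel. a \<in> I \<longrightarrow> u (\<Theta> a x) - u x = (LBINT t=0..a. G x t)"
      proof (eventually_elim, intro impI)
        fix a assume "(INF k. (e k (\<Theta> a x) + c k) * indicator I a) = 0" and a: "a \<in> I"
        then have "(INF k. e k (\<Theta> a x) + c k) = 0" by simp
        moreover have "ennreal \<bar>u (\<Theta> a x) - u x - (LBINT t=0..a. G x t)\<bar> \<le> (INF k. e k (\<Theta> a x) + c k)"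
          using E_le[OF a] by (intro INF_greatest)
        ultimately show "u (\<Theta> a x) - u x = (LBINT t=0..a. G x t)"
          by (simp add: ennreal_eq_0_iff)
      qed
      with int_G show "set_integrable lborel I (G x) \<and>
        (AE a in lborel. a \<in> I \<longrightarrow> u (\<Theta> a x) - u x = (LBINT t=0..a. G x t))" ..
    qed
    then show ?thesis by (simp add: I_def T_def R_def)
  qed
  then have "AE x in lborel. \<forall>n m. x \<in> ball 0 (real m) \<longrightarrow> set_integrable lborel {- real (Suc n)..real (Suc n)} (G x) \<and>
      (AE a in lborel. a \<in> {- real (Suc n)..real (Suc n)} \<longrightarrow> u (\<Theta> a x) - u x = (LBINT t=0..a. G x t))"
    unfolding AE_all_countable by blast
  then show ?thesis
  proof (eventually_elim, intro conjI allI)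
    fix x
    assume *: "\<forall>n m. x \<in> ball 0 (real m) \<longrightarrow> set_integrable lborel {- real (Suc n)..real (Suc n)} (G x) \<and>
      (AE a in lborel. a \<in> {- real (Suc n)..real (Suc n)} \<longrightarrow> u (\<Theta> a x) - u x = (LBINT t=0..a. G x t))"
    obtain m :: nat where "norm x < real m" using reals_Archimedean2 by blast
    with * have int: "set_integrable lborel {- real (Suc n)..real (Suc n)} (G x)"
      and inc: "AE a in lborel. a \<in> {- real (Suc n)..real (Suc n)} \<longrightarrow> u (\<Theta> a x) - u x = (LBINT t=0..a. G x t)" for n
      by (auto simp del: of_nat_Suc)
    fix a b :: real
    obtain n :: nat where n: "max \<bar>a\<bar> \<bar>b\<bar> \<le> real n" using real_arch_simple by blast
    show "set_integrable lborel {a..b} (G x)"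
      by (rule set_integrable_subset[OF int[of n]]) (use n in auto)
  next
    fix x
    assume *: "\<forall>n m. x \<in> ball 0 (real m) \<longrightarrow> set_integrable lborel {- real (Suc n)..real (Suc n)} (G x) \<and>
      (AE a in lborel. a \<in> {- real (Suc n)..real (Suc n)} \<longrightarrow> u (\<Theta> a x) - u x = (LBINT t=0..a. G x t))"
    obtain m :: nat where "norm x < real m" using reals_Archimedean2 by blast
    with * have "AE a in lborel. a \<in> {- real (Suc n)..real (Suc n)} \<longrightarrow> u (\<Theta> a x) - u x = (LBINT t=0..a. G x t)" for n
      by (auto simp del: of_nat_Suc)
    then have "AE a in lborel. \<forall>n. a \<in> {- real (Suc n)..real (Suc n)} \<longrightarrow> u (\<Theta> a x) - u x = (LBINT t=0..a. G x t)"
      unfolding AE_all_countable by blast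
    then show "AE a in lborel. u (\<Theta> a x) - u x = (LBINT t=0..a. G x t)"
    proof eventually_elim
      case (elim a)
      obtain n :: nat where "\<bar>a\<bar> \<le> real n" using real_arch_simple by blast
      then have "a \<in> {- real (Suc n)..real (Suc n)}" by auto
      with elim show ?case by blast
    qed
  qed
qed

end

section \<open>The gradient of a radial function\<close>

lemma measurable_flow_dilation:
  "measurable_flow (\<lambda>t (x::'a::euclidean_space). exp t *\<^sub>R x) (\<lambda>x. x) (\<lambda>t. exp (- real DIM('a) * t))"
proof
  show "continuous_on UNIV (\<lambda>(t, x::'a). exp t *\<^sub>R x)"
    unfolding case_prod_beta by (intro continuous_intros)
  show "((\<lambda>t. exp t *\<^sub>R x) has_vector_derivative exp t *\<^sub>R x) (at t)" for t and x :: 'a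
    by (auto intro!: derivative_eq_intros simp: has_vector_derivative_def)
  show "\<exists>D. \<forall>t\<in>{- T..T}. exp (- real DIM('a) * t) \<le> D" for T
  proof (intro exI ballI)
    fix t assume "t \<in> {- T..T}"
    then show "exp (- real DIM('a) * t) \<le> exp (real DIM('a) * T)"
      using mult_left_mono[of "- t" T "real DIM('a)"] by simp
  qed
  fix f :: "'a \<Rightarrow> ennreal" and t :: real
  assume [measurable]: "f \<in> borel_measurable borel"
  define I where "I = (\<integral>\<^sup>+x. f (exp t *\<^sub>R x) \<partial>lborel)"
  have "(\<integral>\<^sup>+x. f x \<partial>lborel) = (\<integral>\<^sup>+x. f x \<partial>density (distr lborel borel (\<lambda>x. 0 + exp t *\<^sub>R x)) (\<lambda>_. \<bar>exp t\<bar> ^ DIM('a)))"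
    by (subst lborel_affine[of "exp t" 0]) simp_all
  also have "\<dots> = ennreal (exp t ^ DIM('a)) * I"
    by (simp add: nn_integral_density nn_integral_distr nn_integral_cmult I_def)
  finally have "ennreal (exp (- real DIM('a) * t)) * (\<integral>\<^sup>+x. f x \<partial>lborel)
      = ennreal (exp (- real DIM('a) * t) * exp t ^ DIM('a)) * I"
    by (simp add: ennreal_mult mult.assoc)
  moreover have "exp (- real DIM('a) * t) * exp t ^ DIM('a) = 1"
    by (simp add: exp_of_nat_mult[symmetric] exp_add[symmetric])
  ultimately show "(\<integral>\<^sup>+x. f (exp t *\<^sub>R x) \<partial>lborel) = ennreal (exp (- real DIM('a) * t)) * (\<integral>\<^sup>+x. f x \<partial>lborel)"
    by (simp add: I_def)
qed auto

text \<open>For orthonormal \<open>i\<close> and \<open>j\<close>, the rotation by the angle \<open>t\<close> in their plane.\<close>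

definition plane_rotation :: "'a::euclidean_space \<Rightarrow> 'a \<Rightarrow> real \<Rightarrow> 'a \<Rightarrow> 'a" where
  "plane_rotation i j t x = x + (cos t - 1) *\<^sub>R ((x \<bullet> i) *\<^sub>R i + (x \<bullet> j) *\<^sub>R j)
     + sin t *\<^sub>R ((x \<bullet> i) *\<^sub>R j - (x \<bullet> j) *\<^sub>R i)"

context
  fixes i j :: "'a::euclidean_space"
  assumes ij: "i \<in> Basis" "j \<in> Basis" "i \<noteq> j"
begin

lemma orthogonal_plane_rotation: "orthogonal_transformation (plane_rotation i j t)"
proof -
  have lin: "linear (plane_rotation i j t)"
    by (rule linearI) (simp_all add: plane_rotation_def inner_simps algebra_simps)
  have cs: "cos t * cos t = 1 - sin t * sin t"
    using sin_cos_squared_add[of t] by (simp add: power2_eq_square)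
  have "plane_rotation i j t v \<bullet> plane_rotation i j t v = v \<bullet> v" for v
  proof -
    define a b where "a = v \<bullet> i" and "b = v \<bullet> j"
    have "i \<bullet> i = 1" "j \<bullet> j = 1" "i \<bullet> j = 0" "j \<bullet> i = 0"
      using ij by (auto simp: inner_Basis)
    moreover have "i \<bullet> v = a" "j \<bullet> v = b" by (simp_all add: a_def b_def inner_commute)
    ultimately have "plane_rotation i j t v \<bullet> plane_rotation i j t v
        = v \<bullet> v + (2 * (cos t - 1) + (cos t - 1) * (cos t - 1) + sin t * sin t) * (a * a + b * b)"
      by (simp add: plane_rotation_def inner_simps a_def[symmetric] b_def[symmetric] algebra_simps cs)
    also have "2 * (cos t - 1) + (cos t - 1) * (cos t - 1) + sin t * sin t = 0"
      by (simp add: algebra_simps cs)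
    finally show ?thesis by simp
  qed
  then have "norm (plane_rotation i j t v) = norm v" for v
    by (simp add: norm_eq_sqrt_inner)
  with lin show ?thesis by (simp add: orthogonal_transformation)
qed

lemma measurable_flow_plane_rotation:
  "measurable_flow (plane_rotation i j) (\<lambda>x. (x \<bullet> i) *\<^sub>R j - (x \<bullet> j) *\<^sub>R i) (\<lambda>t. 1)"
proof
  show "continuous_on UNIV (\<lambda>(t, x). plane_rotation i j t x)"
    unfolding case_prod_beta plane_rotation_def by (intro continuous_intros)
  show "plane_rotation i j 0 x = x" for x by (simp add: plane_rotation_def)
  show "continuous_on UNIV (\<lambda>x. (x \<bullet> i) *\<^sub>R j - (x \<bullet> j) *\<^sub>R i)"
    by (intro continuous_intros)
  show "((\<lambda>t. plane_rotation i j t x) has_vector_derivative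
      (plane_rotation i j t x \<bullet> i) *\<^sub>R j - (plane_rotation i j t x \<bullet> j) *\<^sub>R i) (at t)" for t x
  proof -
    have "i \<bullet> i = 1" "j \<bullet> j = 1" "i \<bullet> j = 0" "j \<bullet> i = 0"
      using ij by (auto simp: inner_Basis)
    then have eq: "(plane_rotation i j t x \<bullet> i) *\<^sub>R j - (plane_rotation i j t x \<bullet> j) *\<^sub>R i
      = (- sin t) *\<^sub>R ((x \<bullet> i) *\<^sub>R i + (x \<bullet> j) *\<^sub>R j) + cos t *\<^sub>R ((x \<bullet> i) *\<^sub>R j - (x \<bullet> j) *\<^sub>R i)"
      by (simp add: plane_rotation_def inner_simps algebra_simps)
    have "((\<lambda>t. x + (cos t - 1) *\<^sub>R v + sin t *\<^sub>R w) has_vector_derivative (- sin t) *\<^sub>R v + cos t *\<^sub>R w) (at t)"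
      for v w :: 'a
      unfolding has_vector_derivative_def
      by (auto intro!: derivative_eq_intros simp: algebra_simps)
    then show ?thesis unfolding eq by (simp only: plane_rotation_def)
  qed
  show "\<exists>D. \<forall>t\<in>{- T..T}. (1::real) \<le> D" for T by auto
  fix f :: "'a \<Rightarrow> ennreal" and t :: real
  assume [measurable]: "f \<in> borel_measurable borel"
  have [measurable]: "plane_rotation i j t \<in> borel_measurable borel"
    unfolding plane_rotation_def by measurable
  have "(\<integral>\<^sup>+x. f x \<partial>lborel) = (\<integral>\<^sup>+x. f x \<partial>distr lborel borel (plane_rotation i j t))"
    by (simp add: lborel_distr_orthogonal[OF orthogonal_plane_rotation])
  then show "(\<integral>\<^sup>+x. f (plane_rotation i j t x) \<partial>lborel) = ennreal 1 * (\<integral>\<^sup>+x. f x \<partial>lborel)"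
    by (simp add: nn_integral_distr)
qed auto

end

text \<open>Along almost every ray the increment formula for dilations gives \<open>u\<close> as a primitive of
  \<open>g \<bullet> x\<close>; one such ray defines \<open>F\<close> and \<open>h\<close>. On another ray \<open>u\<close> takes the same values, so
  \<open>g \<bullet> x\<close> does too. Rotations leave \<open>u\<close> unchanged, so the components of \<open>g\<close> tangential to the
  spheres vanish.\<close>

theorem radial_gradient:
  fixes u f :: "_ \<Rightarrow> real" and g :: "'a::euclidean_space \<Rightarrow> 'a"
  assumes u[measurable]: "u \<in> borel_measurable borel" and g[measurable]: "g \<in> borel_measurable borel"
    and d\<phi>: "\<And>k x. (\<phi> k has_derivative (\<lambda>h. \<phi>' k x \<bullet> h)) (at x)"
    and cont_\<phi>': "\<And>k::nat. continuous_on UNIV (\<phi>' k)"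
    and lim_u: "\<And>R. (\<lambda>k. \<integral>\<^sup>+x\<in>ball 0 R. ennreal \<bar>\<phi> k x - u x\<bar> \<partial>lborel) \<longlonglongrightarrow> 0"
    and lim_g: "\<And>R. (\<lambda>k. \<integral>\<^sup>+x\<in>ball 0 R. ennreal (norm (\<phi>' k x - g x)) \<partial>lborel) \<longlonglongrightarrow> 0"
    and radial: "AE x in lborel. u x = f (norm x)"
  obtains F h where "continuous_on UNIV F" "h \<in> borel_measurable borel"
    "\<And>a b. set_integrable lborel {a..b} h"
    "\<And>a b. a \<le> b \<Longrightarrow> F b - F a = (LINT t:{a..b}|lborel. h t)"
    "AE x in lborel. u x = F (ln (norm x))"
    "AE x in lborel. g x = (h (ln (norm x)) / norm x ^ 2) *\<^sub>R x"
proof -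
  interpret D: measurable_flow "\<lambda>t (x::'a). exp t *\<^sub>R x" "\<lambda>x. x" "\<lambda>t. exp (- real DIM('a) * t)"
    by (rule measurable_flow_dilation)
  define \<Gamma> where "\<Gamma> y = g y \<bullet> y" for y
  have \<Gamma>_meas[measurable]: "\<Gamma> \<in> borel_measurable borel" unfolding \<Gamma>_def by measurable
  have inc: "AE x in lborel. (\<forall>a b. set_integrable lborel {a..b} (\<lambda>t. \<Gamma> (exp t *\<^sub>R x))) \<and>
      (AE a in lborel. u (exp a *\<^sub>R x) - u x = (LBINT t=0..a. \<Gamma> (exp t *\<^sub>R x)))"
    unfolding \<Gamma>_def by (rule D.AE_increment[OF u g d\<phi> cont_\<phi>' lim_u lim_g])
  have ne0: "AE x in lborel. x \<noteq> (0::'a)" by (rule AE_lborel_singleton)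
  have "AE x in lborel. (\<forall>a b. set_integrable lborel {a..b} (\<lambda>t. \<Gamma> (exp t *\<^sub>R x))) \<and>
      (AE a in lborel. u (exp a *\<^sub>R x) - u x = (LBINT t=0..a. \<Gamma> (exp t *\<^sub>R x))) \<and>
      (AE a in lborel. u (exp a *\<^sub>R x) = f (norm (exp a *\<^sub>R x))) \<and> x \<noteq> 0"
    using inc D.AE_flow[OF radial] ne0 by eventually_elim auto
  then have "\<exists>x. (\<forall>a b. set_integrable lborel {a..b} (\<lambda>t. \<Gamma> (exp t *\<^sub>R x))) \<and>
      (AE a in lborel. u (exp a *\<^sub>R x) - u x = (LBINT t=0..a. \<Gamma> (exp t *\<^sub>R x))) \<and>
      (AE a in lborel. u (exp a *\<^sub>R x) = f (norm (exp a *\<^sub>R x))) \<and> x \<noteq> 0"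
    by (rule eventually_happens'[rotated]) (simp add: ae_filter_eq_bot_iff)
  then obtain x0 where x0: "\<And>a b. set_integrable lborel {a..b} (\<lambda>t. \<Gamma> (exp t *\<^sub>R x0))"
      "AE a in lborel. u (exp a *\<^sub>R x0) - u x0 = (LBINT t=0..a. \<Gamma> (exp t *\<^sub>R x0))"
      "AE a in lborel. u (exp a *\<^sub>R x0) = f (norm (exp a *\<^sub>R x0))" "x0 \<noteq> 0"
    by blast
  define l where "l = ln (norm x0)"
  have norm_x0: "norm x0 = exp l" using x0(4) by (simp add: l_def)
  define h where "h t = \<Gamma> (exp (t - l) *\<^sub>R x0)" for t
  define F where "F t = u x0 + (LBINT s=0..ereal (t - l). \<Gamma> (exp s *\<^sub>R x0))" for t
  have h_meas[measurable]: "h \<in> borel_measurable borel" unfolding h_def by measurable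
  have cont_F: "continuous_on UNIV F"
    unfolding F_def
    by (intro continuous_intros continuous_on_compose2[OF continuous_on_primitive[OF x0(1)]]) auto
  have int_h: "set_integrable lborel {a..b} h" for a b
    using set_integral_shift(2)[of a b "\<lambda>s. \<Gamma> (exp s *\<^sub>R x0)" "- l"] x0(1) by (simp add: h_def[abs_def])
  have F_diff: "F b - F a = (LINT t:{a..b}|lborel. h t)" if "a \<le> b" for a b
    using primitive_diff[OF x0(1), of "a - l" "b - l"] that
      set_integral_shift(1)[of a b "\<lambda>s. \<Gamma> (exp s *\<^sub>R x0)" "- l"]
    by (simp add: h_def[abs_def] F_def)
  have "AE a in lborel. f (exp (a + l)) = F (a + l)"
    using x0(2,3) by eventually_elim (simp add: F_def norm_x0 exp_add)
  from AE_lborel_shift[OF this, of "- l"] have "AE t in lborel. f (exp t) = F t" by simp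
  then have "AE x in lborel. f (exp (ln (norm (x::'a)))) = F (ln (norm x))" by (rule AE_ln_norm)
  with radial ne0 have uF: "AE x in lborel. u x = F (ln (norm x))"
    by eventually_elim simp
  have "AE x in lborel. AE t in lborel. \<Gamma> (exp t *\<^sub>R x) = h (ln (norm (exp t *\<^sub>R x)))"
    using inc D.AE_flow[OF uF] ne0
  proof eventually_elim
    case (elim x)
    define m where "m = ln (norm x)"
    have ln: "ln (norm (exp a *\<^sub>R x)) = a + m" for a
      using elim(3) by (simp add: m_def ln_mult)
    define G where "G t = \<Gamma> (exp t *\<^sub>R x)" for t
    have G: "set_integrable lborel {a..b} G" for a b using elim(1) by (simp add: G_def[abs_def])
    have "AE a in lborel. F (a + m) - u x = (LBINT t=0..a. G t)"
      using elim(1)[THEN conjunct2] elim(2)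
    proof eventually_elim
      case (elim a)
      then show ?case unfolding ln by (simp add: G_def)
    qed
    then have inc': "F (a + m) - u x = (LBINT t=0..a. G t)" for a
      by (rule AE_lborel_eq_imp_eq[rotated 2])
         (intro continuous_intros continuous_on_primitive G continuous_on_compose2[OF cont_F] subset_UNIV)+
    have "AE t in lborel. G t - h (t + m) = 0"
    proof (rule AE_zero_of_interval_integrals)
      fix a b :: real
      have hm: "set_integrable lborel {a..b} (\<lambda>t. h (t + m))"
        by (simp add: set_integral_shift(2) int_h)
      show "set_integrable lborel {a..b} (\<lambda>t. G t - h (t + m))"
        by (intro set_integral_diff(1) G hm)
      assume ab: "a \<le> b"
      have "(LINT t:{a..b}|lborel. G t) = (LINT t:{a..b}|lborel. h (t + m))"
        using primitive_diff[OF G ab] inc'[of a] inc'[of b] F_diff[of "a + m" "b + m"] ab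
        by (simp add: set_integral_shift(1))
      then show "(LINT t:{a..b}|lborel. G t - h (t + m)) = 0"
        using set_integral_diff(2)[OF G hm] by simp
    qed
    then show ?case unfolding ln G_def by eventually_elim simp
  qed
  moreover have "Measurable.pred borel (\<lambda>x. \<Gamma> x = h (ln (norm x)))"
  proof -
    have "(\<lambda>x::'a. ln (norm x)) \<in> borel_measurable borel" by simp
    from borel_measurable_eq[OF \<Gamma>_meas measurable_compose[OF this h_meas]]
    show ?thesis unfolding pred_def .
  qed
  ultimately have \<Gamma>h: "AE x in lborel. \<Gamma> x = h (ln (norm x))"
    by (rule D.AE_flow_iff[where Q = "\<lambda>x. \<Gamma> x = h (ln (norm x))", THEN iffD1, rotated])
  have tang: "AE x in lborel. (x \<bullet> i) * (g x \<bullet> j) = (x \<bullet> j) * (g x \<bullet> i)"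
    if i: "i \<in> Basis" and j: "j \<in> Basis" for i j :: 'a
  proof (cases "i = j")
    case False
    interpret R: measurable_flow "plane_rotation i j" "\<lambda>x. (x \<bullet> i) *\<^sub>R j - (x \<bullet> j) *\<^sub>R i" "\<lambda>t. 1"
      by (rule measurable_flow_plane_rotation[OF i j False])
    define H where "H y = g y \<bullet> ((y \<bullet> i) *\<^sub>R j - (y \<bullet> j) *\<^sub>R i)" for y
    have [measurable]: "H \<in> borel_measurable borel" unfolding H_def by measurable
    have "AE x in lborel. (\<forall>a b. set_integrable lborel {a..b} (\<lambda>t. H (plane_rotation i j t x))) \<and>
      (AE a in lborel. u (plane_rotation i j a x) - u x = (LBINT t=0..a. H (plane_rotation i j t x)))"
      unfolding H_def by (rule R.AE_increment[OF u g d\<phi> cont_\<phi>' lim_u lim_g])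
    then have "AE x in lborel. AE t in lborel. H (plane_rotation i j t x) = 0"
      using R.AE_flow[OF radial] radial
    proof eventually_elim
      case (elim x)
      have "AE a in lborel. (LBINT t=0..a. H (plane_rotation i j t x)) = 0"
        using elim(1)[THEN conjunct2] elim(2)
      proof eventually_elim
        case (elim a)
        moreover have "norm (plane_rotation i j a x) = norm x"
          by (rule orthogonal_transformation_norm[OF orthogonal_plane_rotation[OF i j False]])
        ultimately show ?case using \<open>u x = f (norm x)\<close> by simp
      qed
      then show ?case by (rule AE_zero_of_primitive[rotated]) (use elim(1) in blast)
    qed
    moreover have "Measurable.pred borel (\<lambda>x. H x = 0)"
      unfolding pred_def by (rule borel_measurable_eq) simp_all
    ultimately have "AE x in lborel. H x = 0"
      by (rule R.AE_flow_iff[where Q = "\<lambda>x. H x = 0", THEN iffD1, rotated])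
    then show ?thesis by eventually_elim (simp add: H_def inner_diff_right)
  qed (simp add: mult.commute)
  have "AE x in lborel. \<forall>i\<in>Basis. \<forall>j\<in>Basis. (x \<bullet> i) * (g x \<bullet> j) = (x \<bullet> j) * (g x \<bullet> i)"
    using tang by (intro AE_finite_allI) auto
  with \<Gamma>h ne0 have "AE x in lborel. g x = (h (ln (norm x)) / norm x ^ 2) *\<^sub>R x"
  proof eventually_elim
    case (elim x)
    have "norm x ^ 2 *\<^sub>R g x = \<Gamma> x *\<^sub>R x"
    proof (rule euclidean_eqI)
      fix j :: 'a assume j: "j \<in> Basis"
      have "norm x ^ 2 * (g x \<bullet> j) = (\<Sum>i\<in>Basis. (x \<bullet> i) * (x \<bullet> i)) * (g x \<bullet> j)"
        by (simp add: power2_norm_eq_inner euclidean_inner[of x x])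
      also have "\<dots> = (\<Sum>i\<in>Basis. (x \<bullet> i) * ((x \<bullet> i) * (g x \<bullet> j)))"
        by (simp add: sum_distrib_right mult.assoc)
      also have "\<dots> = (\<Sum>i\<in>Basis. (x \<bullet> i) * ((x \<bullet> j) * (g x \<bullet> i)))"
        using elim(3) j by (intro sum.cong) auto
      also have "\<dots> = (x \<bullet> j) * (\<Sum>i\<in>Basis. (g x \<bullet> i) * (x \<bullet> i))"
        by (simp add: sum_distrib_left ac_simps)
      also have "\<dots> = (x \<bullet> j) * \<Gamma> x" by (simp add: \<Gamma>_def euclidean_inner[of "g x" x])
      finally show "(norm x ^ 2 *\<^sub>R g x) \<bullet> j = (\<Gamma> x *\<^sub>R x) \<bullet> j" by simp
    qed
    then have "(1 / norm x ^ 2) *\<^sub>R (norm x ^ 2 *\<^sub>R g x) = (1 / norm x ^ 2) *\<^sub>R (\<Gamma> x *\<^sub>R x)" by simp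
    then show ?case using elim(1,2) by simp
  qed
  with cont_F int_h F_diff uF show thesis by (intro that[of F h]) auto
qed

section \<open>Test functions on the line and the lemma of du Bois-Reymond\<close>

lemma derivative_eq_0_outside:
  fixes \<zeta> :: "real \<Rightarrow> real"
  assumes d: "\<And>t. (\<zeta> has_real_derivative \<zeta>' t) (at t)" and L: "\<And>t. L < \<bar>t\<bar> \<Longrightarrow> \<zeta> t = 0" and t: "L < \<bar>t\<bar>"
  shows "\<zeta>' t = 0"
proof -
  have "open {t. L < \<bar>t\<bar>}" by (intro open_Collect_less continuous_intros)
  then have "eventually (\<lambda>t. \<zeta> t = 0) (nhds t)"
    using eventually_nhds_in_open[of "{t. L < \<bar>t\<bar>}" t] t L by (auto elim!: eventually_mono)
  from DERIV_cong_ev[OF refl this refl] have "((\<lambda>t. 0) has_real_derivative \<zeta>' t) (at t)"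
    using d[of t] by blast
  then show ?thesis using DERIV_unique[OF _ DERIV_const] by blast
qed

primrec Ck_line :: "nat \<Rightarrow> (real \<Rightarrow> real) \<Rightarrow> bool" where
  "Ck_line 0 f \<longleftrightarrow> continuous_on UNIV f"
| "Ck_line (Suc k) f \<longleftrightarrow> (\<exists>f'. (\<forall>t. (f has_real_derivative f' t) (at t)) \<and> Ck_line k f')"

lemma Ck_line_SucI:
  "(\<And>t. (f has_real_derivative f' t) (at t)) \<Longrightarrow> Ck_line k f' \<Longrightarrow> Ck_line (Suc k) f"
  by (simp, rule exI[of _ f'], simp)

lemma Ck_line_SucD: "Ck_line (Suc k) f \<Longrightarrow> Ck_line k f"
proof (induction k arbitrary: f)
  case 0
  then show ?case
    by (auto intro!: continuous_at_imp_continuous_on dest: DERIV_isCont)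
next
  case (Suc k)
  then show ?case by (metis Ck_line.simps(2))
qed

lemma Ck_line_const: "Ck_line k (\<lambda>t. c)"
  by (induction k arbitrary: c) (auto intro!: exI[of _ "\<lambda>t. 0"])

lemma Ck_line_add: "Ck_line k f \<Longrightarrow> Ck_line k g \<Longrightarrow> Ck_line k (\<lambda>t. f t + g t)"
proof (induction k arbitrary: f g)
  case (Suc k)
  then obtain f' g' where "\<And>t. (f has_real_derivative f' t) (at t)" "Ck_line k f'"
      "\<And>t. (g has_real_derivative g' t) (at t)" "Ck_line k g'" by auto
  with Suc.IH[of f' g'] show ?case
    by (auto intro!: exI[of _ "\<lambda>t. f' t + g' t"] DERIV_add)
qed (auto intro: continuous_intros)

lemma Ck_line_mult: "Ck_line k f \<Longrightarrow> Ck_line k g \<Longrightarrow> Ck_line k (\<lambda>t. f t * g t)"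
proof (induction k arbitrary: f g)
  case (Suc k)
  then obtain f' g' where *: "\<And>t. (f has_real_derivative f' t) (at t)" "Ck_line k f'"
      "\<And>t. (g has_real_derivative g' t) (at t)" "Ck_line k g'" by auto
  have "Ck_line k (\<lambda>t. f' t * g t + g' t * f t)"
    using * Suc Ck_line_SucD by (intro Ck_line_add Suc.IH) auto
  then show ?case using * by (auto intro!: exI[of _ "\<lambda>t. f' t * g t + g' t * f t"] DERIV_mult)
qed (auto intro: continuous_intros)

lemma Ck_line_affine: "Ck_line k f \<Longrightarrow> Ck_line k (\<lambda>t. f (c * t + d))"
proof (induction k arbitrary: f)
  case 0
  then show ?case by (auto intro!: continuous_intros continuous_on_compose2[of UNIV f])
next
  case (Suc k)
  then obtain f' where *: "\<And>t. (f has_real_derivative f' t) (at t)" "Ck_line k f'" by auto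
  have "((\<lambda>t. f (c * t + d)) has_real_derivative f' (c * t + d) * c) (at t)" for t
    by (rule DERIV_chain2[OF *(1)]) (auto intro!: derivative_eq_intros)
  moreover have "Ck_line k (\<lambda>t. f' (c * t + d) * c)"
    using Suc.IH[OF *(2)] Ck_line_const by (rule Ck_line_mult)
  ultimately show ?case by (rule Ck_line_SucI)
qed

lemma Ck_line_exp: "Ck_line k (\<lambda>t. exp (c * t))"
proof (induction k)
  case (Suc k)
  have "((\<lambda>t. exp (c * t)) has_real_derivative exp (c * t) * c) (at t)" for t
    by (auto intro!: derivative_eq_intros)
  moreover have "Ck_line k (\<lambda>t. exp (c * t) * c)"
    using Suc Ck_line_const by (rule Ck_line_mult)
  ultimately show ?case by (rule Ck_line_SucI)
qed (auto intro!: continuous_intros)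

text \<open>The case \<open>m = 0\<close> is the smooth function \<open>exp (- 1 / x)\<close> extended by zero; the factors
  \<open>1 / x ^ m\<close> make the family closed under differentiation, up to linear combinations.\<close>

definition flat_exp :: "nat \<Rightarrow> real \<Rightarrow> real" where
  "flat_exp m x = (if x > 0 then inverse x ^ m * exp (- inverse x) else 0)"

lemma flat_exp_tendsto_0: "(flat_exp m \<longlongrightarrow> 0) (at 0)"
proof -
  have "((\<lambda>y::real. y ^ m / exp y) \<longlongrightarrow> 0) at_top" by (rule tendsto_power_div_exp_0)
  moreover have "filterlim (inverse :: real \<Rightarrow> real) at_top (at_right 0)"
    by (rule filterlim_inverse_at_top_right)
  ultimately have "((\<lambda>x::real. inverse x ^ m / exp (inverse x)) \<longlongrightarrow> 0) (at_right 0)"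
    by (rule filterlim_compose)
  then have r: "(flat_exp m \<longlongrightarrow> 0) (at_right 0)"
    by (rule Lim_transform_eventually)
       (auto simp: eventually_at_right_field flat_exp_def exp_minus divide_inverse intro: exI[of _ 1])
  have l: "(flat_exp m \<longlongrightarrow> 0) (at_left 0)"
    by (rule Lim_transform_eventually[OF tendsto_const])
       (auto simp: eventually_at_left_field flat_exp_def intro: exI[of _ "- 1"])
  from l r show ?thesis by (simp add: filterlim_at_split)
qed

lemma has_real_derivative_flat_exp:
  "(flat_exp m has_real_derivative - real m * flat_exp (m + 1) x + flat_exp (m + 2) x) (at x)"
proof -
  consider "x > 0" | "x < 0" | "x = 0" by linarith
  then show ?thesis
  proof cases
    case 1
    have d: "(inverse has_real_derivative - (inverse x * inverse x)) (at x)"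
      using DERIV_inverse[of x UNIV] 1 by (simp add: power2_eq_square)
    have "((\<lambda>x. inverse x ^ m * exp (- inverse x)) has_real_derivative
        real m * (inverse x ^ (m - 1) * - (inverse x * inverse x)) * exp (- inverse x)
          + inverse x ^ m * (exp (- inverse x) * (inverse x * inverse x))) (at x)"
      by (rule derivative_eq_intros d refl | simp add: ac_simps)+
    also have "real m * (inverse x ^ (m - 1) * - (inverse x * inverse x)) * exp (- inverse x)
          + inverse x ^ m * (exp (- inverse x) * (inverse x * inverse x))
        = - real m * flat_exp (m + 1) x + flat_exp (m + 2) x"
      using 1 by (cases m) (simp_all add: flat_exp_def algebra_simps)
    finally have "((\<lambda>x. inverse x ^ m * exp (- inverse x)) has_real_derivative
        - real m * flat_exp (m + 1) x + flat_exp (m + 2) x) (at x)" .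
    moreover have "eventually (\<lambda>x. inverse x ^ m * exp (- inverse x) = flat_exp m x) (nhds x)"
      using eventually_nhds_in_open[of "{0<..}" x] 1
      by (auto elim!: eventually_mono simp: flat_exp_def)
    ultimately show ?thesis by (simp add: DERIV_cong_ev)
  next
    case 2
    have d: "((\<lambda>x. 0) has_real_derivative - real m * flat_exp (m + 1) x + flat_exp (m + 2) x) (at x)"
      using 2 by (simp add: flat_exp_def)
    have "eventually (\<lambda>x. 0 = flat_exp m x) (nhds x)"
      using eventually_nhds_in_open[of "{..<0}" x] 2
      by (auto elim!: eventually_mono simp: flat_exp_def)
    from DERIV_cong_ev[OF refl this refl] d show ?thesis by blast
  next
    case 3
    have "(\<lambda>h. flat_exp m h / h) = flat_exp (m + 1)"
      by (auto simp: fun_eq_iff flat_exp_def divide_inverse)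
    then have "(\<lambda>h. flat_exp m h / h) \<midarrow>0\<rightarrow> 0" using flat_exp_tendsto_0 by simp
    then show ?thesis using 3 by (simp add: DERIV_def flat_exp_def)
  qed
qed

lemma Ck_line_flat_exp: "Ck_line k (flat_exp m)"
proof (induction k arbitrary: m)
  case 0
  then show ?case
    using has_real_derivative_flat_exp by (auto intro!: continuous_at_imp_continuous_on dest: DERIV_isCont)
next
  case (Suc k)
  have "Ck_line k (\<lambda>x. - real m * flat_exp (m + 1) x + flat_exp (m + 2) x)"
    by (intro Ck_line_add Ck_line_mult Ck_line_const Suc)
  with has_real_derivative_flat_exp show ?case by (rule Ck_line_SucI)
qed

definition test_line :: "(real \<Rightarrow> real) \<Rightarrow> bool" where
  "test_line \<zeta> \<longleftrightarrow> (\<forall>k. Ck_line k \<zeta>) \<and> (\<exists>L. \<forall>t. L < \<bar>t\<bar> \<longrightarrow> \<zeta> t = 0)"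

lemma test_line_continuous: "test_line \<zeta> \<Longrightarrow> continuous_on UNIV \<zeta>"
  unfolding test_line_def by (metis Ck_line.simps(1))

lemma test_line_linear: "test_line \<zeta> \<Longrightarrow> test_line \<eta> \<Longrightarrow> test_line (\<lambda>t. \<zeta> t + c * \<eta> t)"
proof -
  assume *: "test_line \<zeta>" "test_line \<eta>"
  then obtain L M where "\<And>t. L < \<bar>t\<bar> \<Longrightarrow> \<zeta> t = 0" "\<And>t. M < \<bar>t\<bar> \<Longrightarrow> \<eta> t = 0"
    by (auto simp: test_line_def)
  then have "\<forall>t. max L M < \<bar>t\<bar> \<longrightarrow> \<zeta> t + c * \<eta> t = 0" by simp
  with * show "test_line (\<lambda>t. \<zeta> t + c * \<eta> t)"
    unfolding test_line_def by (intro conjI allI Ck_line_add Ck_line_mult Ck_line_const) blast+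
qed

lemma integrable_test_line:
  fixes Y :: "real \<Rightarrow> real"
  assumes [measurable]: "Y \<in> borel_measurable borel" and Y: "\<And>a b. set_integrable lborel {a..b} Y"
    and \<zeta>: "continuous_on UNIV \<zeta>" "\<And>t. L < \<bar>t\<bar> \<Longrightarrow> \<zeta> t = 0"
  shows "integrable lborel (\<lambda>t. Y t * \<zeta> t)"
proof -
  have [measurable]: "\<zeta> \<in> borel_measurable borel" using \<zeta>(1) by (rule borel_measurable_continuous_onI)
  have "bounded (\<zeta> ` {- L..L})"
    by (intro compact_imp_bounded compact_continuous_image continuous_on_subset[OF \<zeta>(1)]) auto
  then obtain B where "\<forall>y \<in> \<zeta> ` {- L..L}. norm y \<le> B" unfolding bounded_iff by blast
  then have B: "\<bar>\<zeta> t\<bar> \<le> B" if "t \<in> {- L..L}" for t using that by auto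
  show ?thesis
  proof (rule Bochner_Integration.integrable_bound)
    show "integrable lborel (\<lambda>t. B * (indicator {- L..L} t *\<^sub>R Y t))"
      using Y[of "- L" L] by (intro integrable_mult_right) (simp add: set_integrable_def)
    show "AE t in lborel. norm (Y t * \<zeta> t) \<le> norm (B * (indicator {- L..L} t *\<^sub>R Y t))"
    proof (rule AE_I2)
      fix t
      show "norm (Y t * \<zeta> t) \<le> norm (B * (indicator {- L..L} t *\<^sub>R Y t))"
      proof (cases "t \<in> {- L..L}")
        case True
        then have "\<bar>\<zeta> t\<bar> \<le> \<bar>B\<bar>" using B[of t] by linarith
        then show ?thesis using True mult_right_mono[of "\<bar>\<zeta> t\<bar>" "\<bar>B\<bar>" "\<bar>Y t\<bar>"] by (simp add: abs_mult mult.commute)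
      next
        case False
        then have "L < \<bar>t\<bar>" by auto
        then show ?thesis using \<zeta>(2)[of t] by simp
      qed
    qed
  qed measurable
qed

text \<open>The primitive that vanishes far to the left also vanishes far to the right, because the total
  integral is zero.\<close>

lemma test_line_primitive:
  assumes \<zeta>: "test_line \<zeta>" and zero: "(LINT t|lborel. \<zeta> t) = 0"
  obtains \<eta> where "test_line \<eta>" "\<And>t. (\<eta> has_real_derivative \<zeta> t) (at t)"
proof -
  obtain L0 where L0: "\<And>t. L0 < \<bar>t\<bar> \<Longrightarrow> \<zeta> t = 0" using \<zeta> by (auto simp: test_line_def)
  define L where "L = max L0 0"
  have L: "\<And>t. L < \<bar>t\<bar> \<Longrightarrow> \<zeta> t = 0" "0 \<le> L" using L0 by (auto simp: L_def)
  note cont = test_line_continuous[OF \<zeta>]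
  note int = set_integrable_continuous[OF cont]
  define \<eta> where "\<eta> t = (LBINT s=0..ereal t. \<zeta> s) - (LBINT s=0..ereal (- L). \<zeta> s)" for t
  have d: "(\<eta> has_real_derivative \<zeta> t) (at t)" for t
    unfolding \<eta>_def using DERIV_diff[OF has_real_derivative_primitive[OF cont, of t] DERIV_const] by simp
  have "Ck_line k \<eta>" for k
  proof (cases k)
    case 0
    then show ?thesis using d by (auto intro!: continuous_at_imp_continuous_on dest: DERIV_isCont)
  next
    case (Suc k)
    then show ?thesis using d \<zeta> by (auto simp: test_line_def)
  qed
  moreover have "\<eta> t = 0" if "L < \<bar>t\<bar>" for t
  proof (cases "t < 0")
    case True
    then have "t \<le> - L" using that by simp
    have "(LINT s|lborel. indicator {t..- L} s *\<^sub>R \<zeta> s) = 0"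
    proof (rule integral_eq_zero_AE)
      show "AE s in lborel. indicator {t..- L} s *\<^sub>R \<zeta> s = 0"
        using AE_lborel_singleton[of "- L"]
      proof eventually_elim
        case (elim s)
        then show ?case using L(1)[of s] by (cases "s \<in> {t..- L}") auto
      qed
    qed
    then have "(LINT s:{t..- L}|lborel. \<zeta> s) = 0" by (simp add: set_lebesgue_integral_def)
    then show ?thesis
      using primitive_diff[OF int \<open>t \<le> - L\<close>] by (simp add: \<eta>_def)
  next
    case False
    then have t: "- L \<le> t" "L < t" using that L(2) by auto
    have "(LINT s:{- L..t}|lborel. \<zeta> s) = (LINT s|lborel. \<zeta> s)"
      unfolding set_lebesgue_integral_def
    proof (rule Bochner_Integration.integral_cong[OF refl])
      show "indicator {- L..t} s *\<^sub>R \<zeta> s = \<zeta> s" for s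
        using t L(1)[of s] by (cases "s \<in> {- L..t}") auto
    qed
    then show ?thesis
      using primitive_diff[OF int t(1)] zero by (simp add: \<eta>_def)
  qed
  ultimately have "test_line \<eta>" by (auto simp: test_line_def)
  with d show thesis by (intro that)
qed

text \<open>Smooth functions supported in \<open>{a..b}\<close> that increase to the indicator function of \<open>{a<..<b}\<close>.\<close>

definition bump :: "real \<Rightarrow> real \<Rightarrow> nat \<Rightarrow> real \<Rightarrow> real" where
  "bump a b n t = flat_exp 0 (real (Suc n) * (t - a)) * flat_exp 0 (real (Suc n) * (b - t))"

lemma flat_exp_0_bounds: "0 \<le> flat_exp 0 x" "flat_exp 0 x \<le> 1"
  by (auto simp: flat_exp_def)

lemma bump_bounds: "0 \<le> bump a b n t" "bump a b n t \<le> 1"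
  using flat_exp_0_bounds by (auto simp: bump_def intro: mult_le_one)

lemma bump_eq_0: "t \<notin> {a<..<b} \<Longrightarrow> bump a b n t = 0"
  by (auto simp: bump_def flat_exp_def zero_less_mult_iff)

lemma test_line_bump: "test_line (bump a b n)"
  unfolding test_line_def
proof (intro conjI allI)
  fix k
  have "Ck_line k (\<lambda>t. flat_exp 0 (real (Suc n) * t + - real (Suc n) * a) * flat_exp 0 (- real (Suc n) * t + real (Suc n) * b))"
    by (intro Ck_line_mult Ck_line_affine Ck_line_flat_exp)
  also have "(\<lambda>t. flat_exp 0 (real (Suc n) * t + - real (Suc n) * a) * flat_exp 0 (- real (Suc n) * t + real (Suc n) * b)) = bump a b n"
    by (simp add: bump_def fun_eq_iff algebra_simps)
  finally show "Ck_line k (bump a b n)" .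
  show "\<exists>L. \<forall>t. L < \<bar>t\<bar> \<longrightarrow> bump a b n t = 0"
    by (rule exI[of _ "max \<bar>a\<bar> \<bar>b\<bar>"]) (auto intro!: bump_eq_0)
qed

lemma bump_tendsto: "(\<lambda>n. bump a b n t) \<longlonglongrightarrow> indicator {a<..<b} t"
proof (cases "t \<in> {a<..<b}")
  case True
  have lim: "(\<lambda>n. flat_exp 0 (real (Suc n) * x)) \<longlonglongrightarrow> 1" if "x > 0" for x
  proof -
    have "(\<lambda>n. exp (- (inverse (real (Suc n)) * (1 / x)))) \<longlonglongrightarrow> exp (- (0 * (1 / x)))"
      by (intro tendsto_intros LIMSEQ_inverse_real_of_nat)
    moreover have "exp (- (inverse (real (Suc n)) * (1 / x))) = flat_exp 0 (real (Suc n) * x)" for n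
      using that by (simp add: flat_exp_def zero_less_mult_iff inverse_eq_divide)
    ultimately show ?thesis by simp
  qed
  have "(\<lambda>n. bump a b n t) \<longlonglongrightarrow> 1 * 1"
    unfolding bump_def using True by (intro tendsto_mult lim) auto
  then show ?thesis using True by simp
qed (simp add: bump_eq_0)

lemma AE_zero_of_test_line:
  fixes v :: "real \<Rightarrow> real"
  assumes [measurable]: "v \<in> borel_measurable borel" and v: "\<And>a b. set_integrable lborel {a..b} v"
    and zero: "\<And>\<zeta>. test_line \<zeta> \<Longrightarrow> (LINT t|lborel. v t * \<zeta> t) = 0"
  shows "AE t in lborel. v t = 0"
proof (rule AE_zero_of_interval_integrals[OF v])
  fix a b :: real assume ab: "a \<le> b"
  have "(\<lambda>n. LINT t|lborel. v t * bump a b n t) \<longlonglongrightarrow> (LINT t|lborel. v t * indicator {a<..<b} t)"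
  proof (rule integral_dominated_convergence)
    have [measurable]: "bump a b n \<in> borel_measurable borel" for n
      using test_line_continuous[OF test_line_bump] by (rule borel_measurable_continuous_onI)
    show "(\<lambda>t. v t * bump a b n t) \<in> borel_measurable lborel" for n by measurable
    show "integrable lborel (\<lambda>t. norm (indicator {a..b} t *\<^sub>R v t))"
      using v[of a b] unfolding set_integrable_def by (rule integrable_norm)
    show "AE t in lborel. (\<lambda>n. v t * bump a b n t) \<longlonglongrightarrow> v t * indicator {a<..<b} t"
      by (intro AE_I2 tendsto_mult_left bump_tendsto)
    show "AE t in lborel. norm (v t * bump a b n t) \<le> norm (indicator {a..b} t *\<^sub>R v t)" for n
    proof (rule AE_I2)
      fix t
      show "norm (v t * bump a b n t) \<le> norm (indicator {a..b} t *\<^sub>R v t)"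
        using bump_bounds[of a b n t] bump_eq_0[of t a b n]
        by (cases "t \<in> {a<..<b}") (auto simp: abs_mult mult_left_le)
    qed
  qed measurable
  then have "(LINT t|lborel. v t * indicator {a<..<b} t) = 0"
    unfolding zero[OF test_line_bump] by (simp add: LIMSEQ_const_iff)
  moreover have "(LINT t:{a..b}|lborel. v t) = (LINT t|lborel. v t * indicator {a<..<b} t)"
    unfolding set_lebesgue_integral_def
  proof (rule integral_cong_AE)
    show "AE t in lborel. indicator {a..b} t *\<^sub>R v t = v t * indicator {a<..<b} t"
      using AE_lborel_singleton[of a] AE_lborel_singleton[of b]
      by eventually_elim (auto simp: indicator_def)
  qed measurable
  ultimately show "(LINT t:{a..b}|lborel. v t) = 0" by simp
qed

text \<open>With \<open>W\<close> a primitive of \<open>S\<close>, integration by parts shows that \<open>v = Y + W\<close> is orthogonal to all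
  derivatives of test functions, that is, to all test functions of integral zero. Subtracting
  a multiple of a fixed bump from a test function makes its integral zero, so \<open>v\<close> minus a
  suitable constant is orthogonal to all test functions.\<close>

theorem du_Bois_Reymond:
  fixes Y S :: "real \<Rightarrow> real"
  assumes Ym[measurable]: "Y \<in> borel_measurable borel" and Y: "\<And>a b. set_integrable lborel {a..b} Y"
    and S: "continuous_on UNIV S"
    and weak: "\<And>\<zeta> \<zeta>'. test_line \<zeta> \<Longrightarrow> (\<And>t. (\<zeta> has_real_derivative \<zeta>' t) (at t)) \<Longrightarrow>
                 (LINT t|lborel. Y t * \<zeta>' t) = (LINT t|lborel. S t * \<zeta> t)"
  obtains Z where "\<And>t. (Z has_real_derivative - S t) (at t)" "AE t in lborel. Y t = Z t"
proof -
  define W where "W t = (LBINT s=0..ereal t. S s)" for t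
  have dW: "(W has_real_derivative S t) (at t)" for t
    unfolding W_def by (rule has_real_derivative_primitive[OF S])
  have contW: "continuous_on UNIV W"
    using dW by (auto intro!: continuous_at_imp_continuous_on dest: DERIV_isCont)
  have [measurable]: "W \<in> borel_measurable borel" "S \<in> borel_measurable borel"
    using contW S by (auto intro: borel_measurable_continuous_onI)
  note intW = set_integrable_continuous[OF contW] and intS = set_integrable_continuous[OF S]
  define v where "v t = Y t + W t" for t
  have [measurable]: "v \<in> borel_measurable borel" unfolding v_def by measurable
  have intv: "set_integrable lborel {a..b} v" for a b
    unfolding v_def by (intro set_integral_add(1) Y intW)
  have ortho: "(LINT t|lborel. v t * \<zeta>' t) = 0"
    if \<zeta>: "test_line \<zeta>" "\<And>t. (\<zeta> has_real_derivative \<zeta>' t) (at t)" "continuous_on UNIV \<zeta>'" for \<zeta> \<zeta>'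
  proof -
    obtain L0 where L0: "\<And>t. L0 < \<bar>t\<bar> \<Longrightarrow> \<zeta> t = 0" using \<zeta> by (auto simp: test_line_def)
    \<comment> \<open>the margin \<open>1\<close> makes \<open>\<zeta>\<close> vanish at the end points \<open>- L\<close> and \<open>L\<close>\<close>
    define L where "L = max L0 0 + 1"
    have L: "\<And>t. L < \<bar>t\<bar> \<Longrightarrow> \<zeta> t = 0" "0 \<le> L" "\<zeta> L = 0" "\<zeta> (- L) = 0" using L0 by (auto simp: L_def)
    have L': "\<zeta>' t = 0" if "L < \<bar>t\<bar>" for t
      by (rule derivative_eq_0_outside[OF \<zeta>(2) L(1) that])
    have i1: "integrable lborel (\<lambda>t. Y t * \<zeta>' t)"
      by (rule integrable_test_line[OF Ym Y \<zeta>(3) L'])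
    have i2: "integrable lborel (\<lambda>t. W t * \<zeta>' t)"
      by (rule integrable_test_line[OF _ intW \<zeta>(3) L']) simp
    have i3: "integrable lborel (\<lambda>t. S t * \<zeta> t)"
      by (rule integrable_test_line[OF _ intS test_line_continuous[OF \<zeta>(1)] L(1)]) simp
    have "(LINT t|lborel. (W t * \<zeta>' t + S t * \<zeta> t) * indicator {- L..L} t) = W L * \<zeta> L - W (- L) * \<zeta> (- L)"
    proof (rule integral_FTC_Icc_real)
      show "((\<lambda>t. W t * \<zeta> t) has_real_derivative W t * \<zeta>' t + S t * \<zeta> t) (at t)" for t
        using DERIV_mult[OF dW[of t] \<zeta>(2)[of t]] by (simp add: algebra_simps)
      show "isCont (\<lambda>t. W t * \<zeta>' t + S t * \<zeta> t) t" for t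
        using contW S \<zeta>(3) test_line_continuous[OF \<zeta>(1)]
        by (auto intro!: continuous_intros simp: continuous_on_eq_continuous_at)
    qed (use L in auto)
    moreover have "(W t * \<zeta>' t + S t * \<zeta> t) * indicator {- L..L} t = W t * \<zeta>' t + S t * \<zeta> t" for t
    proof (cases "t \<in> {- L..L}")
      case False
      then have "L < \<bar>t\<bar>" by auto
      then show ?thesis using L(1)[of t] L'[of t] by simp
    qed simp
    ultimately have "(LINT t|lborel. W t * \<zeta>' t) + (LINT t|lborel. S t * \<zeta> t) = 0"
      using i2 i3 L by simp
    moreover have "(LINT t|lborel. v t * \<zeta>' t) = (LINT t|lborel. Y t * \<zeta>' t) + (LINT t|lborel. W t * \<zeta>' t)"
      using i1 i2 by (simp add: v_def distrib_right)
    ultimately show ?thesis using weak[OF \<zeta>(1,2)] by simp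
  qed
  define m where "m = (LINT t|lborel. bump 0 1 0 t)"
  have int_test: "integrable lborel \<zeta>" if \<zeta>: "test_line \<zeta>" for \<zeta>
  proof -
    obtain L where "\<And>t. L < \<bar>t\<bar> \<Longrightarrow> \<zeta> t = 0" using \<zeta> by (auto simp: test_line_def)
    from integrable_test_line[OF _ set_integrable_continuous[of "\<lambda>t. 1"] test_line_continuous[OF \<zeta>] this]
    show ?thesis by simp
  qed
  have int_v_test: "integrable lborel (\<lambda>t. v t * \<zeta> t)" if \<zeta>: "test_line \<zeta>" for \<zeta>
  proof -
    obtain L where "\<And>t. L < \<bar>t\<bar> \<Longrightarrow> \<zeta> t = 0" using \<zeta> by (auto simp: test_line_def)
    from integrable_test_line[OF _ intv test_line_continuous[OF \<zeta>] this]
    show ?thesis by simp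
  qed
  have "m > 0"
  proof -
    have "m \<noteq> 0"
    proof
      assume "m = 0"
      then have "AE t in lborel. bump 0 1 0 t = 0"
        unfolding m_def using integral_nonneg_eq_0_iff_AE[OF int_test[OF test_line_bump]] bump_bounds(1) by auto
      then have "bump 0 1 0 (1/2) = (0::real)"
        using AE_lborel_eq_imp_eq[OF test_line_continuous[OF test_line_bump] continuous_on_const] by blast
      then show False by (simp add: bump_def flat_exp_def)
    qed
    moreover have "m \<ge> 0" unfolding m_def by (intro integral_nonneg_AE AE_I2 bump_bounds)
    ultimately show ?thesis by simp
  qed
  define c where "c = (LINT t|lborel. v t * bump 0 1 0 t) / m"
  have "AE t in lborel. v t - c = 0"
  proof (rule AE_zero_of_test_line)
    show "set_integrable lborel {a..b} (\<lambda>t. v t - c)" for a b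
      by (intro set_integral_diff(1) intv set_integrable_continuous continuous_on_const)
    fix \<zeta> assume \<zeta>: "test_line \<zeta>"
    define k where "k = (LINT t|lborel. \<zeta> t) / m"
    define \<xi> where "\<xi> t = \<zeta> t + - k * bump 0 1 0 t" for t
    have \<xi>: "test_line \<xi>" unfolding \<xi>_def by (intro test_line_linear \<zeta> test_line_bump)
    have "(LINT t|lborel. \<xi> t) = (LINT t|lborel. \<zeta> t) + (LINT t|lborel. - k * bump 0 1 0 t)"
      unfolding \<xi>_def using int_test[OF \<zeta>] int_test[OF test_line_bump]
      by (intro Bochner_Integration.integral_add integrable_mult_right) auto
    also have "\<dots> = 0" using \<open>m > 0\<close> by (simp add: k_def m_def[symmetric])
    finally obtain \<eta> where \<eta>: "test_line \<eta>" "\<And>t. (\<eta> has_real_derivative \<xi> t) (at t)"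
      using test_line_primitive[OF \<xi>] by blast
    have "(LINT t|lborel. v t * \<xi> t) = 0"
      by (rule ortho[OF \<eta> test_line_continuous[OF \<xi>]])
    moreover have "(LINT t|lborel. v t * \<xi> t)
        = (LINT t|lborel. v t * \<zeta> t) + (LINT t|lborel. - k * (v t * bump 0 1 0 t))"
      using Bochner_Integration.integral_add[OF int_v_test[OF \<zeta>] integrable_mult_right[OF int_v_test[OF test_line_bump[of 0 1 0]], of "- k"]]
      by (simp add: \<xi>_def right_diff_distrib mult.left_commute)
    ultimately have "(LINT t|lborel. v t * \<zeta> t) = k * (c * m)"
      using \<open>m > 0\<close> by (simp add: c_def)
    also have "\<dots> = c * (LINT t|lborel. \<zeta> t)" using \<open>m > 0\<close> by (simp add: k_def)
    finally show "(LINT t|lborel. (v t - c) * \<zeta> t) = 0"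
      using int_v_test[OF \<zeta>] int_test[OF \<zeta>] by (simp add: left_diff_distrib)
  qed simp
  then have "AE t in lborel. Y t = c - W t"
    by eventually_elim (simp add: v_def algebra_simps)
  moreover have "((\<lambda>t. c - W t) has_real_derivative - S t) (at t)" for t
    using DERIV_diff[OF DERIV_const dW[of t]] by simp
  ultimately show thesis by (intro that)
qed

lemma test_line_derivative:
  assumes "test_line \<zeta>" "\<And>t. (\<zeta> has_real_derivative \<zeta>' t) (at t)"
  shows "continuous_on UNIV \<zeta>'" "\<exists>L. \<forall>t. L < \<bar>t\<bar> \<longrightarrow> \<zeta> t = 0 \<and> \<zeta>' t = 0"
proof -
  have "Ck_line (Suc 0) \<zeta>" using assms(1) unfolding test_line_def by blast
  then obtain \<zeta>'' where \<zeta>'': "\<And>t. (\<zeta> has_real_derivative \<zeta>'' t) (at t)" "continuous_on UNIV \<zeta>''" by auto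
  have "\<zeta>'' = \<zeta>'" using DERIV_unique[OF \<zeta>''(1) assms(2)] by blast
  with \<zeta>''(2) show "continuous_on UNIV \<zeta>'" by simp
  obtain L where L: "\<And>t. L < \<bar>t\<bar> \<Longrightarrow> \<zeta> t = 0" using assms(1) by (auto simp: test_line_def)
  have "\<zeta>' t = 0" if "L < \<bar>t\<bar>" for t
    by (rule derivative_eq_0_outside[OF assms(2) L that])
  with L show "\<exists>L. \<forall>t. L < \<bar>t\<bar> \<longrightarrow> \<zeta> t = 0 \<and> \<zeta>' t = 0" by blast
qed

section \<open>Radial test functions\<close>

lemma grad_eqI: "(f has_derivative (\<lambda>h. D \<bullet> h)) (at x) \<Longrightarrow> grad f x = D"
proof -
  assume d: "(f has_derivative (\<lambda>h. D \<bullet> h)) (at x)"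
  have "E = D" if "GDERIV f x :> E" for E
  proof -
    have "(f has_derivative (\<lambda>h. h \<bullet> E)) (at x)" using that by (simp add: gderiv_def)
    then have "(\<lambda>h. h \<bullet> E) = (\<lambda>h. D \<bullet> h)" using d by (rule has_derivative_unique)
    then have "h \<bullet> E = h \<bullet> D" for h by (metis inner_commute)
    then show ?thesis by (metis vector_eq_ldot)
  qed
  moreover have "GDERIV f x :> D" using d by (simp add: gderiv_def inner_commute)
  ultimately show ?thesis unfolding grad_def by blast
qed

lemma has_derivative_grad:
  fixes f :: "real ^ 'n \<Rightarrow> real"
  assumes "f differentiable (at x)"
  shows "(f has_derivative (\<lambda>h. grad f x \<bullet> h)) (at x)"
proof -
  obtain f' where f': "(f has_derivative f') (at x)" using assms by (auto simp: differentiable_def)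
  then have lin: "linear f'" by (rule has_derivative_linear)
  \<comment> \<open>the Riesz representative of the functional \<open>f'\<close>\<close>
  define D where "D = adjoint f' 1"
  have "f' = (\<lambda>h. D \<bullet> h)"
  proof
    show "f' h = D \<bullet> h" for h
      using adjoint_works[OF lin, of h 1] by (simp add: D_def inner_commute)
  qed
  with f' have d: "(f has_derivative (\<lambda>h. D \<bullet> h)) (at x)" by simp
  show ?thesis using d unfolding grad_eqI[OF d] .
qed

lemma C_k_SucI:
  assumes "\<And>x. (f has_derivative (\<lambda>h. D x \<bullet> h)) (at x)" "\<And>i. C_k k (\<lambda>x. D x $ i)"
  shows "C_k (Suc k) f"
proof -
  have "grad f = D" using grad_eqI[OF assms(1)] by blast
  then show ?thesis using assms by (auto simp: differentiable_def)
qed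

lemma C_k_SucD: "C_k (Suc k) f \<Longrightarrow> C_k k f"
proof (induction k arbitrary: f)
  case 0
  then show ?case
    by (auto intro!: continuous_at_imp_continuous_on differentiable_imp_continuous_within)
qed auto

lemma C_k_const: "C_k k (\<lambda>x. c)"
proof (induction k arbitrary: c)
  case (Suc k)
  show ?case by (rule C_k_SucI[where D = "\<lambda>x. 0"]) (auto intro: Suc)
qed simp

lemma C_k_coordinate: "C_k k (\<lambda>x. x $ i)"
proof (cases k)
  case (Suc k')
  have "C_k (Suc k') (\<lambda>x::real^'a. x $ i)"
  proof (rule C_k_SucI[where D = "\<lambda>x. axis i 1"])
    show "((\<lambda>x::real^'a. x $ i) has_derivative (\<lambda>h. axis i 1 \<bullet> h)) (at x)" for x
      by (simp add: inner_axis' bounded_linear_imp_has_derivative bounded_linear_vec_nth)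
  qed (rule C_k_const)
  then show ?thesis using Suc by simp
qed (simp add: continuous_intros)

lemma C_k_add: "C_k k f \<Longrightarrow> C_k k g \<Longrightarrow> C_k k (\<lambda>x. f x + g x)"
proof (induction k arbitrary: f g)
  case (Suc k)
  show ?case
  proof (rule C_k_SucI[where D = "\<lambda>x. grad f x + grad g x"])
    show "((\<lambda>x. f x + g x) has_derivative (\<lambda>h. (grad f x + grad g x) \<bullet> h)) (at x)" for x
      using Suc.prems has_derivative_add[OF has_derivative_grad[of f x] has_derivative_grad[of g x]]
      by (simp add: inner_add_left)
    show "C_k k (\<lambda>x. (grad f x + grad g x) $ i)" for i
      using Suc by simp
  qed
qed (auto intro: continuous_intros)

lemma C_k_mult: "C_k k f \<Longrightarrow> C_k k g \<Longrightarrow> C_k k (\<lambda>x. f x * g x)"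
proof (induction k arbitrary: f g)
  case (Suc k)
  show ?case
  proof (rule C_k_SucI[where D = "\<lambda>x. f x *\<^sub>R grad g x + g x *\<^sub>R grad f x"])
    show "((\<lambda>x. f x * g x) has_derivative (\<lambda>h. (f x *\<^sub>R grad g x + g x *\<^sub>R grad f x) \<bullet> h)) (at x)" for x
      using Suc.prems has_derivative_mult[OF has_derivative_grad[of f x] has_derivative_grad[of g x]]
      by (simp add: inner_add_left mult.commute)
    show "C_k k (\<lambda>x. (f x *\<^sub>R grad g x + g x *\<^sub>R grad f x) $ i)" for i
    proof -
      have "C_k k f" "C_k k g" using Suc.prems C_k_SucD by blast+
      moreover have "C_k k (\<lambda>x. grad f x $ i)" "C_k k (\<lambda>x. grad g x $ i)" using Suc.prems by auto
      ultimately have "C_k k (\<lambda>x. f x * grad g x $ i + g x * grad f x $ i)"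
        by (intro C_k_add Suc.IH)
      then show ?thesis by simp
    qed
  qed
qed (auto intro: continuous_intros)

lemma test_function_gradient:
  assumes "test_function \<phi>"
  shows "(\<phi> has_derivative (\<lambda>h. grad \<phi> x \<bullet> h)) (at x)" "continuous_on UNIV (grad \<phi>)" "continuous_on UNIV \<phi>"
proof -
  have "C_k (Suc 0) \<phi>" "C_k 0 \<phi>" using assms unfolding test_function_def by blast+
  then have d: "\<phi> differentiable (at x)" and c: "\<And>i. continuous_on UNIV (\<lambda>x. grad \<phi> x $ i)"
    and "continuous_on UNIV \<phi>" for x by auto
  then show "(\<phi> has_derivative (\<lambda>h. grad \<phi> x \<bullet> h)) (at x)" "continuous_on UNIV \<phi>"
    by (auto intro: has_derivative_grad)
  show "continuous_on UNIV (grad \<phi>)"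
    using continuous_on_vec_lambda[of UNIV "\<lambda>i x. grad \<phi> x $ i"] c by simp
qed

text \<open>The origin is excluded because \<open>ln 0 = 0\<close>, while the lift of a test function of the line has to
  vanish near the origin.\<close>

definition radial_lift :: "(real \<Rightarrow> real) \<Rightarrow> 'a::euclidean_space \<Rightarrow> real" where
  "radial_lift \<zeta> x = (if x = 0 then 0 else \<zeta> (ln (norm x)))"

lemma has_derivative_ln_norm:
  fixes x :: "'a::euclidean_space"
  assumes "x \<noteq> 0" "(f has_real_derivative f') (at (ln (norm x)))"
  shows "((\<lambda>x. f (ln (norm x))) has_derivative (\<lambda>h. ((f' / norm x ^ 2) *\<^sub>R x) \<bullet> h)) (at x)"
proof -
  have "((\<lambda>x. norm x) has_derivative (\<lambda>h. h \<bullet> sgn x)) (at x)"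
    using assms(1) by (rule has_derivative_norm)
  from DERIV_compose_FDERIV[OF DERIV_ln_divide this]
  have "((\<lambda>x. ln (norm x)) has_derivative (\<lambda>h. (h \<bullet> sgn x) * (1 / norm x))) (at x)"
    using assms(1) by simp
  from DERIV_compose_FDERIV[OF assms(2) this]
  show ?thesis
    by (simp add: sgn_div_norm inner_commute power2_eq_square field_simps)
qed

lemma radial_lift_near_0:
  fixes y :: "'a::euclidean_space"
  assumes "\<And>t. L < \<bar>t\<bar> \<Longrightarrow> \<zeta> t = 0" "y \<in> ball 0 (exp (- (\<bar>L\<bar> + 1)))"
  shows "radial_lift \<zeta> y = 0"
proof (cases "y = 0")
  case False
  then have "ln (norm y) < ln (exp (- (\<bar>L\<bar> + 1)))" using assms(2) by (subst ln_less_cancel_iff) auto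
  then have "L < \<bar>ln (norm y)\<bar>" by simp
  then show ?thesis by (simp add: radial_lift_def assms(1))
qed (simp add: radial_lift_def)

text \<open>The radial factor of the gradient is again a lift, of \<open>exp (- 2 * t) * \<zeta>' t\<close>; this is what
  the induction for higher derivatives needs.\<close>

lemma has_derivative_radial_lift:
  fixes x :: "'a::euclidean_space"
  assumes d: "\<And>t. (\<zeta> has_real_derivative \<zeta>' t) (at t)" and L: "\<And>t. L < \<bar>t\<bar> \<Longrightarrow> \<zeta> t = 0"
  shows "(radial_lift \<zeta> has_derivative (\<lambda>h. (radial_lift (\<lambda>t. exp (- 2 * t) * \<zeta>' t) x *\<^sub>R x) \<bullet> h)) (at x)"
proof (cases "x = 0")
  case True
  have "(radial_lift \<zeta> has_derivative (\<lambda>h. 0)) (at x)"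
    by (rule has_derivative_transform_within_open[OF has_derivative_const[of 0] open_ball[of 0 "exp (- (\<bar>L\<bar> + 1))"]])
       (use True radial_lift_near_0[where \<zeta> = \<zeta>, OF L] in auto)
  then show ?thesis using True by simp
next
  case False
  have e: "exp (- 2 * ln (norm x)) = 1 / norm x ^ 2"
    using False by (simp add: exp_minus exp_of_nat_mult[of 2, simplified] divide_inverse)
  have "((\<lambda>x. \<zeta> (ln (norm x))) has_derivative (\<lambda>h. ((\<zeta>' (ln (norm x)) / norm x ^ 2) *\<^sub>R x) \<bullet> h)) (at x)"
    using False d by (rule has_derivative_ln_norm)
  then have "(radial_lift \<zeta> has_derivative (\<lambda>h. ((\<zeta>' (ln (norm x)) / norm x ^ 2) *\<^sub>R x) \<bullet> h)) (at x)"
    by (rule has_derivative_transform_within_open[of _ _ _ _ "- {0}"])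
       (use False in \<open>auto simp: radial_lift_def\<close>)
  moreover have "radial_lift (\<lambda>t. exp (- 2 * t) * \<zeta>' t) x = \<zeta>' (ln (norm x)) / norm x ^ 2"
    using False by (simp only: radial_lift_def e if_False) simp
  ultimately show ?thesis by (simp only:)
qed

lemma C_k_radial_lift:
  assumes "Ck_line k \<zeta>" "\<And>t. L < \<bar>t\<bar> \<Longrightarrow> \<zeta> t = 0"
  shows "C_k k (radial_lift \<zeta> :: real ^ 'n \<Rightarrow> real)"
  using assms
proof (induction k arbitrary: \<zeta>)
  case 0
  have "isCont (radial_lift \<zeta>) x" for x :: "real ^ 'n"
  proof (cases "x = 0")
    case True
    have "eventually (\<lambda>y. y \<in> ball 0 (exp (- (\<bar>L\<bar> + 1)))) (at x)"
      using True eventually_nhds_in_open[of "ball 0 (exp (- (\<bar>L\<bar> + 1)))" x] by (simp add: eventually_at_filter eventually_mono)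
    then have "eventually (\<lambda>y. 0 = radial_lift \<zeta> y) (at x)"
      by eventually_elim (simp add: radial_lift_near_0[where \<zeta> = \<zeta>, OF 0(2)])
    then have "(radial_lift \<zeta> \<longlongrightarrow> 0) (at x)" by (rule Lim_transform_eventually[OF tendsto_const])
    then show ?thesis using True by (simp add: isCont_def radial_lift_def)
  next
    case False
    have "isCont \<zeta> (ln (norm x))" using 0 by (simp add: continuous_on_eq_continuous_at)
    moreover have "isCont (\<lambda>x. ln (norm x)) x" using False by (intro continuous_intros) auto
    ultimately have c: "isCont (\<lambda>x. \<zeta> (ln (norm x))) x"
      using isCont_o2 by blast
    have "eventually (\<lambda>y. \<zeta> (ln (norm y)) = radial_lift \<zeta> y) (nhds x)"
    proof -
      have "eventually (\<lambda>y. y \<in> - {0}) (nhds x)"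
        using False by (intro eventually_nhds_in_open) auto
      then show ?thesis by eventually_elim (simp add: radial_lift_def)
    qed
    from isCont_cong[OF this] c show ?thesis by blast
  qed
  then show ?case by (simp add: continuous_at_imp_continuous_on)
next
  case (Suc k)
  then obtain \<zeta>' where d: "\<And>t. (\<zeta> has_real_derivative \<zeta>' t) (at t)" "Ck_line k \<zeta>'" by auto
  have L': "\<zeta>' t = 0" if "L < \<bar>t\<bar>" for t
    by (rule derivative_eq_0_outside[OF d(1) Suc.prems(2) that])
  have IH: "C_k k (radial_lift (\<lambda>t. exp (- 2 * t) * \<zeta>' t) :: real ^ 'n \<Rightarrow> real)"
    by (intro Suc.IH Ck_line_mult Ck_line_exp d) (simp add: L')
  show ?case
  proof (rule C_k_SucI[OF has_derivative_radial_lift[OF d(1) Suc.prems(2)]])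
    show "C_k k (\<lambda>x::real ^ 'n. (radial_lift (\<lambda>t. exp (- 2 * t) * \<zeta>' t) x *\<^sub>R x) $ i)" for i
      using C_k_mult[OF IH C_k_coordinate[of k i]] by simp
  qed
qed

lemma test_function_radial_lift:
  assumes "test_line \<zeta>"
  shows "test_function (radial_lift \<zeta> :: real ^ 'n \<Rightarrow> real)"
proof -
  obtain L where L: "\<And>t. L < \<bar>t\<bar> \<Longrightarrow> \<zeta> t = 0" and d: "\<And>k. Ck_line k \<zeta>"
    using assms by (auto simp: test_line_def)
  have "{x. radial_lift \<zeta> x \<noteq> 0} \<subseteq> cball (0 :: real ^ 'n) (exp L)"
  proof
    fix x :: "real ^ 'n" assume "x \<in> {x. radial_lift \<zeta> x \<noteq> 0}"
    then have "x \<noteq> 0" "\<zeta> (ln (norm x)) \<noteq> 0" by (auto simp: radial_lift_def split: if_splits)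
    then have "ln (norm x) \<le> L" using L[of "ln (norm x)"] by fastforce
    then have "exp (ln (norm x)) \<le> exp L" by simp
    then show "x \<in> cball 0 (exp L)" using \<open>x \<noteq> 0\<close> by simp
  qed
  then have "bounded {x :: real ^ 'n. radial_lift \<zeta> x \<noteq> 0}" using bounded_subset bounded_cball by blast
  then show ?thesis
    unfolding test_function_def using C_k_radial_lift[where L = L, OF d L] by (auto simp: compact_closure)
qed

lemma test_function_support:
  fixes \<phi> :: "real ^ 'n \<Rightarrow> real"
  assumes "test_function \<phi>"
  shows "bounded (closure {x. \<phi> x \<noteq> 0})"
    and "x \<notin> closure {x. \<phi> x \<noteq> 0} \<Longrightarrow> \<phi> x = 0"
    and "x \<notin> closure {x. \<phi> x \<noteq> 0} \<Longrightarrow> grad \<phi> x = 0"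
proof -
  show "bounded (closure {x. \<phi> x \<noteq> 0})"
    using assms by (auto simp: test_function_def intro: compact_imp_bounded)
  show "\<phi> x = 0" if "x \<notin> closure {x. \<phi> x \<noteq> 0}"
    using that closure_subset[of "{x. \<phi> x \<noteq> 0}"] by auto
  show "grad \<phi> x = 0" if "x \<notin> closure {x. \<phi> x \<noteq> 0}"
  proof (rule grad_eqI)
    have "(\<phi> has_derivative (\<lambda>h. 0)) (at x)"
      by (rule has_derivative_transform_within_open[OF has_derivative_const[of 0], of "- closure {x. \<phi> x \<noteq> 0}"])
         (use that closure_subset[of "{x. \<phi> x \<noteq> 0}"] in auto)
    then show "(\<phi> has_derivative (\<lambda>h. 0 \<bullet> h)) (at x)" by simp
  qed
qed

section \<open>The profile of a radial function with gradient in a Lebesgue space\<close>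

text \<open>On a ball, Hoelder's inequality is replaced by the pointwise bound
  \<open>w \<le> \<epsilon> + \<epsilon> powr (1 - r) * w powr r\<close>.\<close>

lemma local_L1_of_Lr:
  fixes w :: "nat \<Rightarrow> 'a::euclidean_space \<Rightarrow> real"
  assumes r: "1 < r" and [measurable]: "\<And>k. w k \<in> borel_measurable borel" and nonneg: "\<And>k x. 0 \<le> w k x"
    and lim: "(\<lambda>k. \<integral>\<^sup>+x. ennreal (w k x powr r) \<partial>lborel) \<longlonglongrightarrow> 0"
  shows "(\<lambda>k. \<integral>\<^sup>+x\<in>ball 0 R. ennreal (w k x) \<partial>lborel) \<longlonglongrightarrow> 0"
proof (rule order_tendstoI)
  fix a :: ennreal assume a: "0 < a"
  obtain e where e: "0 < e" "ennreal e \<le> a"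
  proof (cases a)
    case (real e)
    then show ?thesis using a that[of e] by auto
  next
    case top
    then show ?thesis using that[of 1] by simp
  qed
  define m where "m = measure lborel (ball (0::'a) R)"
  have m: "emeasure lborel (ball (0::'a) R) = ennreal m"
    unfolding m_def by (intro emeasure_eq_ennreal_measure) (use emeasure_bounded_finite[of "ball (0::'a) R"] in auto)
  have m0: "0 \<le> m" by (simp add: m_def)
  \<comment> \<open>with this \<open>\<epsilon>\<close> the constant term contributes less than \<open>e / 2\<close>, also when \<open>m = 0\<close>\<close>
  define \<epsilon> where "\<epsilon> = e / (2 * (m + 1))"
  have \<epsilon>: "0 < \<epsilon>" using e m0 by (simp add: \<epsilon>_def)
  have \<epsilon>m: "\<epsilon> * m < e"
  proof -
    have "\<epsilon> * m \<le> \<epsilon> * (m + 1)" using \<epsilon> by simp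
    also have "\<dots> = e / 2" using m0 by (simp add: \<epsilon>_def field_simps)
    also have "\<dots> < e" using e by simp
    finally show ?thesis .
  qed
  define J where "J k = (\<integral>\<^sup>+x. ennreal (w k x powr r) \<partial>lborel)" for k
  have pointwise: "w k x \<le> \<epsilon> + \<epsilon> powr (1 - r) * w k x powr r" for k x
  proof (cases "w k x \<le> \<epsilon>")
    case True
    then show ?thesis by (simp add: add_increasing2)
  next
    case False
    then have "w k x > 0" using \<epsilon> by linarith
    then have "w k x = w k x powr (1 - r) * w k x powr r"
      by (simp add: powr_add[symmetric])
    also have "\<dots> \<le> \<epsilon> powr (1 - r) * w k x powr r"
      using False \<epsilon> r by (intro mult_right_mono powr_mono2') auto
    finally show ?thesis using \<epsilon> by linarith
  qed
  have bound: "(\<integral>\<^sup>+x\<in>ball 0 R. ennreal (w k x) \<partial>lborel) \<le> ennreal \<epsilon> * ennreal m + ennreal (\<epsilon> powr (1 - r)) * J k" for k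
  proof -
    have "(\<integral>\<^sup>+x\<in>ball 0 R. ennreal (w k x) \<partial>lborel)
        \<le> (\<integral>\<^sup>+x. ennreal \<epsilon> * indicator (ball 0 R) x + ennreal (\<epsilon> powr (1 - r)) * ennreal (w k x powr r) \<partial>lborel)"
    proof (rule nn_integral_mono)
      fix x
      have "ennreal (w k x) \<le> ennreal \<epsilon> + ennreal (\<epsilon> powr (1 - r)) * ennreal (w k x powr r)"
        using ennreal_leI[OF pointwise[of k x]] \<epsilon> by (simp add: ennreal_mult)
      then show "ennreal (w k x) * indicator (ball 0 R) x
          \<le> ennreal \<epsilon> * indicator (ball 0 R) x + ennreal (\<epsilon> powr (1 - r)) * ennreal (w k x powr r)"
        by (cases "x \<in> ball 0 R") simp_all
    qed
    also have "\<dots> = ennreal \<epsilon> * ennreal m + ennreal (\<epsilon> powr (1 - r)) * J k"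
      by (subst nn_integral_add) (auto simp: nn_integral_cmult nn_integral_cmult_indicator m J_def)
    finally show ?thesis .
  qed
  have "(\<lambda>k. ennreal \<epsilon> * ennreal m + ennreal (\<epsilon> powr (1 - r)) * J k)
      \<longlonglongrightarrow> ennreal \<epsilon> * ennreal m + ennreal (\<epsilon> powr (1 - r)) * 0"
    unfolding J_def by (intro tendsto_add tendsto_const ennreal_tendsto_cmult lim) simp
  moreover have "ennreal \<epsilon> * ennreal m + ennreal (\<epsilon> powr (1 - r)) * 0 < a"
    using e \<epsilon>m \<epsilon> m0 by (simp add: ennreal_mult[symmetric] order_less_le_trans[OF ennreal_lessI])
  ultimately have "\<forall>\<^sub>F k in sequentially. ennreal \<epsilon> * ennreal m + ennreal (\<epsilon> powr (1 - r)) * J k < a"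
    by (rule order_tendstoD(2))
  then show "\<forall>\<^sub>F k in sequentially. (\<integral>\<^sup>+x\<in>ball 0 R. ennreal (w k x) \<partial>lborel) < a"
    by eventually_elim (rule order_le_less_trans[OF bound])
qed simp

lemma nn_integral_powr_bounded_support:
  fixes f :: "'a::euclidean_space \<Rightarrow> real"
  assumes "continuous_on UNIV f" "\<And>x. x \<notin> K \<Longrightarrow> f x = 0" "bounded K" "0 < r"
  shows "(\<integral>\<^sup>+x. ennreal (\<bar>f x\<bar> powr r) \<partial>lborel) < \<infinity>"
proof -
  obtain R where R: "K \<subseteq> cball 0 R" using assms(3) unfolding bounded_iff by (metis mem_cball_0 subsetI)
  have "bounded (f ` cball 0 R)"
    by (intro compact_imp_bounded compact_continuous_image continuous_on_subset[OF assms(1)]) auto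
  then obtain B where B: "\<forall>y \<in> f ` cball 0 R. norm y \<le> B" unfolding bounded_iff by blast
  have "(\<integral>\<^sup>+x. ennreal (\<bar>f x\<bar> powr r) \<partial>lborel) \<le> (\<integral>\<^sup>+x. ennreal (B powr r) * indicator (cball (0::'a) R) x \<partial>lborel)"
  proof (rule nn_integral_mono)
    fix x
    show "ennreal (\<bar>f x\<bar> powr r) \<le> ennreal (B powr r) * indicator (cball 0 R) x"
    proof (cases "x \<in> cball 0 R")
      case True
      then have "\<bar>f x\<bar> \<le> B" using B by auto
      then show ?thesis using True assms(4) by (simp add: ennreal_leI powr_mono2)
    next
      case False
      then have "x \<notin> K" using R by blast
      then show ?thesis using False assms(2)[of x] by simp
    qed
  qed
  also have "\<dots> < \<infinity>" using emeasure_bounded_finite[of "cball (0::'a) R"] by (simp add: nn_integral_cmult_indicator ennreal_mult_less_top)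
  finally show ?thesis .
qed

lemma powr_add_le:
  fixes a b r :: real
  assumes "0 \<le> a" "0 \<le> b" "0 < r"
  shows "(a + b) powr r \<le> 2 powr r * (a powr r + b powr r)"
proof -
  have "(a + b) powr r \<le> (2 * max a b) powr r"
    using assms by (intro powr_mono2) auto
  also have "\<dots> = 2 powr r * (max a b) powr r" using assms by (simp add: powr_mult)
  also have "\<dots> \<le> 2 powr r * (a powr r + b powr r)"
    by (intro mult_left_mono) (auto simp: max_def)
  finally show ?thesis .
qed

lemma nn_integral_powr_finite_of_approx:
  fixes a b c :: "'a::euclidean_space \<Rightarrow> real"
  assumes r: "0 < r" and [measurable]: "a \<in> borel_measurable borel" "b \<in> borel_measurable borel"
    and fin: "(\<integral>\<^sup>+x. ennreal (a x powr r) \<partial>lborel) < \<infinity>" "(\<integral>\<^sup>+x. ennreal (b x powr r) \<partial>lborel) < \<infinity>"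
    and nonneg: "\<And>x. 0 \<le> a x" "\<And>x. 0 \<le> b x" "\<And>x. 0 \<le> c x" and le: "\<And>x. c x \<le> a x + b x"
  shows "(\<integral>\<^sup>+x. ennreal (c x powr r) \<partial>lborel) < \<infinity>"
proof -
  have "(\<integral>\<^sup>+x. ennreal (c x powr r) \<partial>lborel)
      \<le> (\<integral>\<^sup>+x. ennreal (2 powr r) * (ennreal (a x powr r) + ennreal (b x powr r)) \<partial>lborel)"
  proof (rule nn_integral_mono)
    fix x
    have "c x powr r \<le> (a x + b x) powr r" using nonneg le r by (intro powr_mono2) auto
    also have "\<dots> \<le> 2 powr r * (a x powr r + b x powr r)" by (rule powr_add_le[OF nonneg(1,2) r])
    finally have "ennreal (c x powr r) \<le> ennreal (2 powr r * (a x powr r + b x powr r))" by (rule ennreal_leI)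
    then show "ennreal (c x powr r) \<le> ennreal (2 powr r) * (ennreal (a x powr r) + ennreal (b x powr r))"
      by (simp add: ennreal_mult)
  qed
  also have "\<dots> = ennreal (2 powr r) * ((\<integral>\<^sup>+x. ennreal (a x powr r) \<partial>lborel) + (\<integral>\<^sup>+x. ennreal (b x powr r) \<partial>lborel))"
    by (simp add: nn_integral_cmult nn_integral_add)
  also have "\<dots> < \<infinity>" using fin by (simp add: ennreal_mult_less_top)
  finally show ?thesis .
qed

lemma Lr_finite_of_limit:
  fixes \<Phi> :: "nat \<Rightarrow> 'a::euclidean_space \<Rightarrow> 'b::euclidean_space"
  assumes r: "0 < r" and [measurable]: "\<And>k. \<Phi> k \<in> borel_measurable borel" "G \<in> borel_measurable borel"
    and fin: "\<And>k. (\<integral>\<^sup>+x. ennreal (norm (\<Phi> k x) powr r) \<partial>lborel) < \<infinity>"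
    and lim: "(\<lambda>k. \<integral>\<^sup>+x. ennreal (norm (\<Phi> k x - G x) powr r) \<partial>lborel) \<longlonglongrightarrow> 0"
  shows "(\<integral>\<^sup>+x. ennreal (norm (G x) powr r) \<partial>lborel) < \<infinity>"
proof -
  define I where "I k = (\<integral>\<^sup>+x. ennreal (norm (\<Phi> k x - G x) powr r) \<partial>lborel)" for k
  have "\<forall>\<^sub>F k in sequentially. I k < 1"
    unfolding I_def by (rule order_tendstoD(2)[OF lim]) simp
  then have "\<exists>k. I k < 1" by (rule eventually_happens'[OF sequentially_bot])
  then obtain k where "I k < 1" ..
  then have k: "I k < \<infinity>" by (rule order_less_trans) simp
  show ?thesis
  proof (rule nn_integral_powr_finite_of_approx[where a = "\<lambda>x. norm (\<Phi> k x)" and b = "\<lambda>x. norm (\<Phi> k x - G x)"])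
    show "(\<integral>\<^sup>+x. ennreal (norm (\<Phi> k x - G x) powr r) \<partial>lborel) < \<infinity>"
      using k by (simp add: I_def)
    show "norm (G x) \<le> norm (\<Phi> k x) + norm (\<Phi> k x - G x)" for x
      using norm_triangle_sub[of "G x" "\<Phi> k x"] by (simp add: norm_minus_commute)
  qed (use r fin in auto)
qed

lemma borel_version:
  fixes g :: "'a::euclidean_space \<Rightarrow> 'b::euclidean_space"
  assumes [measurable]: "g \<in> borel_measurable lebesgue"
  obtains g0 where "g0 \<in> borel_measurable borel" "AE x in lborel. g x = g0 x"
proof -
  have "\<exists>f. f \<in> borel_measurable lborel \<and> (AE x in lborel. g x \<bullet> i = f x)" for i
    using completion_ex_borel_measurable_real[of "\<lambda>x. g x \<bullet> i" lborel] by (auto simp: Bex_def)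
  then obtain f where f: "\<And>i. f i \<in> borel_measurable lborel" "\<And>i. AE x in lborel. g x \<bullet> i = f i x"
    by metis
  define g0 where "g0 x = (\<Sum>i\<in>Basis. f i x *\<^sub>R i)" for x
  have [measurable]: "f i \<in> borel_measurable borel" for i using f(1) by simp
  have "g0 \<in> borel_measurable borel" unfolding g0_def by measurable
  moreover have "AE x in lborel. \<forall>i\<in>Basis. g x \<bullet> i = f i x"
    using f(2) by (intro AE_finite_allI) auto
  then have "AE x in lborel. g x = g0 x"
  proof eventually_elim
    case (elim x)
    have "g x = (\<Sum>i\<in>Basis. (g x \<bullet> i) *\<^sub>R i)" by (simp add: euclidean_representation)
    also have "\<dots> = g0 x" unfolding g0_def using elim by (intro sum.cong) auto
    finally show ?case .
  qed
  ultimately show thesis by (rule that)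
qed

text \<open>The approximating test functions converge locally in \<open>L\<^sup>1\<close>, so \<open>radial_gradient\<close> applies to Borel
  versions of \<open>u\<close> and \<open>g\<close>. The last two claims are \<open>u \<in> L\<^sup>q\<close> for the Sobolev exponent \<open>q\<close>
  and \<open>g \<in> L\<^sup>p\<close>, in the variable \<open>ln |x|\<close>.\<close>

theorem radial_profile:
  fixes u :: "real ^ 'n \<Rightarrow> real" and g :: "real ^ 'n \<Rightarrow> real ^ 'n"
  defines "N \<equiv> real CARD('n)"
  assumes p: "1 < p" "p < N" and D: "D1p_with_gradient p u g" and rad: "radial u"
  obtains F h where "continuous_on UNIV F" "h \<in> borel_measurable borel"
    "\<And>a b. set_integrable lborel {a..b} h"
    "\<And>a b. a \<le> b \<Longrightarrow> F b - F a = (LINT t:{a..b}|lborel. h t)"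
    "AE x in lborel. u x = F (ln (norm x))"
    "AE x in lborel. g x = (h (ln (norm x)) / norm x ^ 2) *\<^sub>R x"
    "(\<integral>\<^sup>+t. ennreal (exp (N * t) * \<bar>F t\<bar> powr crit_exp N p 0) \<partial>lborel) < \<infinity>"
    "(\<integral>\<^sup>+t. ennreal (exp ((N - p) * t) * \<bar>h t\<bar> powr p) \<partial>lborel) < \<infinity>"
proof -
  define q0 where "q0 = crit_exp N p 0"
  have q0: "1 < q0"
  proof -
    have "N < N * p" using p by simp
    then have "N - p < N * p" using p by linarith
    then show ?thesis using p by (simp add: q0_def crit_exp_def field_simps)
  qed
  from D obtain \<phi> where um: "u \<in> borel_measurable lebesgue" and gm: "g \<in> borel_measurable lebesgue"
    and \<phi>: "\<And>k::nat. test_function (\<phi> k)"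
    and lim_g: "(\<lambda>k. \<integral>\<^sup>+ x. ennreal (norm (grad (\<phi> k) x - g x) powr p) \<partial>lebesgue) \<longlonglongrightarrow> 0"
    and lim_u: "(\<lambda>k. \<integral>\<^sup>+ x. ennreal (\<bar>\<phi> k x - u x\<bar> powr q0) \<partial>lebesgue) \<longlonglongrightarrow> 0"
    unfolding D1p_with_gradient_def q0_def N_def by blast
  obtain u0 where u0[measurable]: "u0 \<in> borel_measurable borel" and uu0: "AE x in lborel. u x = u0 x"
    using borel_version[OF um] by blast
  obtain g0 where g0[measurable]: "g0 \<in> borel_measurable borel" and gg0: "AE x in lborel. g x = g0 x"
    using borel_version[OF gm] by blast
  have cont: "continuous_on UNIV (\<phi> k)" "continuous_on UNIV (grad (\<phi> k))"
    and d\<phi>: "(\<phi> k has_derivative (\<lambda>h. grad (\<phi> k) x \<bullet> h)) (at x)" for k x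
    using test_function_gradient[OF \<phi>] by auto
  have [measurable]: "\<phi> k \<in> borel_measurable borel" "grad (\<phi> k) \<in> borel_measurable borel" for k
    using cont by (auto intro: borel_measurable_continuous_onI)
  have lim_u0: "(\<lambda>k. \<integral>\<^sup>+ x. ennreal (\<bar>\<phi> k x - u0 x\<bar> powr q0) \<partial>lborel) \<longlonglongrightarrow> 0"
  proof -
    have "(\<integral>\<^sup>+ x. ennreal (\<bar>\<phi> k x - u x\<bar> powr q0) \<partial>lebesgue) = (\<integral>\<^sup>+ x. ennreal (\<bar>\<phi> k x - u0 x\<bar> powr q0) \<partial>lborel)" for k
      unfolding nn_integral_completion
      by (rule nn_integral_cong_AE) (use uu0 in eventually_elim, simp)
    with lim_u show ?thesis by simp
  qed
  have lim_g0: "(\<lambda>k. \<integral>\<^sup>+ x. ennreal (norm (grad (\<phi> k) x - g0 x) powr p) \<partial>lborel) \<longlonglongrightarrow> 0"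
  proof -
    have "(\<integral>\<^sup>+ x. ennreal (norm (grad (\<phi> k) x - g x) powr p) \<partial>lebesgue) = (\<integral>\<^sup>+ x. ennreal (norm (grad (\<phi> k) x - g0 x) powr p) \<partial>lborel)" for k
      unfolding nn_integral_completion
      by (rule nn_integral_cong_AE) (use gg0 in eventually_elim, simp)
    with lim_g show ?thesis by simp
  qed
  obtain f where "AE x in lebesgue. u x = f (norm x)" using rad by (auto simp: radial_def)
  then have "AE x in lborel. u x = f (norm x)" by (simp add: AE_completion_iff)
  with uu0 have rad0: "AE x in lborel. u0 x = f (norm x)" by eventually_elim simp
  have loc_u: "(\<lambda>k. \<integral>\<^sup>+x\<in>ball 0 R. ennreal \<bar>\<phi> k x - u0 x\<bar> \<partial>lborel) \<longlonglongrightarrow> 0" for R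
    by (rule local_L1_of_Lr[OF q0 _ _ lim_u0]) auto
  have loc_g: "(\<lambda>k. \<integral>\<^sup>+x\<in>ball 0 R. ennreal (norm (grad (\<phi> k) x - g0 x)) \<partial>lborel) \<longlonglongrightarrow> 0" for R
    by (rule local_L1_of_Lr[OF p(1) _ _ lim_g0]) auto
  obtain F h where F: "continuous_on UNIV F" and h[measurable]: "h \<in> borel_measurable borel"
    and int: "\<And>a b. set_integrable lborel {a..b} h"
    and diff: "\<And>a b. a \<le> b \<Longrightarrow> F b - F a = (LINT t:{a..b}|lborel. h t)"
    and uF: "AE x in lborel. u0 x = F (ln (norm x))"
    and gh: "AE x in lborel. g0 x = (h (ln (norm x)) / norm x ^ 2) *\<^sub>R x"
    using radial_gradient[OF u0 g0 d\<phi> cont(2) loc_u loc_g rad0] by blast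
  have [measurable]: "F \<in> borel_measurable borel" using F by (rule borel_measurable_continuous_onI)
  have C: "N * unit_ball_vol N > 0" using p by (simp add: N_def)
  have ne0: "AE x in lborel. x \<noteq> (0::real^'n)" by (rule AE_lborel_singleton)
  have ln_norm: "(\<integral>\<^sup>+x. ennreal (K (ln (norm (x::real^'n)))) \<partial>lborel)
      = ennreal (N * unit_ball_vol N) * (\<integral>\<^sup>+t. ennreal (exp (N * t) * K t) \<partial>lborel)"
    if [measurable]: "K \<in> borel_measurable borel" for K
  proof -
    have "(\<integral>\<^sup>+x. ennreal (K (ln (norm (x::real^'n)))) \<partial>lborel)
        = (\<integral>\<^sup>+t. ennreal (N * unit_ball_vol N * exp (N * t)) * ennreal (K t) \<partial>lborel)"
      using nn_integral_ln_norm[where 'a = "real^'n", of "\<lambda>t. ennreal (K t)"] by (simp add: N_def)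
    also have "\<dots> = (\<integral>\<^sup>+t. ennreal (N * unit_ball_vol N) * ennreal (exp (N * t) * K t) \<partial>lborel)"
    proof (rule nn_integral_cong)
      fix t
      have "ennreal (N * unit_ball_vol N * exp (N * t)) * ennreal (K t) = ennreal (N * unit_ball_vol N * exp (N * t) * K t)"
        using C by (intro ennreal_mult'[symmetric]) simp
      also have "\<dots> = ennreal (N * unit_ball_vol N) * ennreal (exp (N * t) * K t)"
        using C by (subst mult.assoc, intro ennreal_mult') simp
      finally show "ennreal (N * unit_ball_vol N * exp (N * t)) * ennreal (K t)
          = ennreal (N * unit_ball_vol N) * ennreal (exp (N * t) * K t)" .
    qed
    finally show ?thesis by (simp add: nn_integral_cmult)
  qed
  have finite_of: "X < \<infinity>" if "ennreal (N * unit_ball_vol N) * X < \<infinity>" for X :: ennreal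
    using that C by (auto simp: ennreal_mult_less_top ennreal_eq_0_iff)
  have "(\<integral>\<^sup>+t. ennreal (exp (N * t) * \<bar>F t\<bar> powr q0) \<partial>lborel) < \<infinity>"
  proof (rule finite_of)
    have "(\<integral>\<^sup>+ x. ennreal (\<bar>\<phi> k x\<bar> powr q0) \<partial>lborel) < \<infinity>" for k
    proof (rule nn_integral_powr_bounded_support[OF cont(1) _ test_function_support(1)[OF \<phi>[of k]]])
      show "\<phi> k x = 0" if "x \<notin> closure {x. \<phi> k x \<noteq> 0}" for x
        by (rule test_function_support(2)[OF \<phi> that])
    qed (use q0 in simp)
    then have "(\<integral>\<^sup>+ x. ennreal (\<bar>u0 x\<bar> powr q0) \<partial>lborel) < \<infinity>"
      by (intro Lr_finite_of_limit[of q0 \<phi> u0, unfolded real_norm_def]) (use lim_u0 q0 in simp_all)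
    also have "(\<integral>\<^sup>+ x. ennreal (\<bar>u0 x\<bar> powr q0) \<partial>lborel) = (\<integral>\<^sup>+ x. ennreal (\<bar>F (ln (norm (x::real^'n)))\<bar> powr q0) \<partial>lborel)"
      by (rule nn_integral_cong_AE) (use uF in eventually_elim, simp)
    also have "\<dots> = ennreal (N * unit_ball_vol N) * (\<integral>\<^sup>+t. ennreal (exp (N * t) * \<bar>F t\<bar> powr q0) \<partial>lborel)"
      by (rule ln_norm) simp
    finally show "ennreal (N * unit_ball_vol N) * (\<integral>\<^sup>+t. ennreal (exp (N * t) * \<bar>F t\<bar> powr q0) \<partial>lborel) < \<infinity>" .
  qed
  moreover have "(\<integral>\<^sup>+t. ennreal (exp ((N - p) * t) * \<bar>h t\<bar> powr p) \<partial>lborel) < \<infinity>"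
  proof (rule finite_of)
    have "(\<integral>\<^sup>+ x. ennreal (\<bar>norm (grad (\<phi> k) x)\<bar> powr p) \<partial>lborel) < \<infinity>" for k
    proof (rule nn_integral_powr_bounded_support[OF continuous_on_norm[OF cont(2)] _ test_function_support(1)[OF \<phi>[of k]]])
      show "norm (grad (\<phi> k) x) = 0" if "x \<notin> closure {x. \<phi> k x \<noteq> 0}" for x
        using test_function_support(3)[OF \<phi> that] by simp
    qed (use p in simp)
    then have "(\<integral>\<^sup>+ x. ennreal (norm (g0 x) powr p) \<partial>lborel) < \<infinity>"
      by (intro Lr_finite_of_limit[of p "\<lambda>k. grad (\<phi> k)" g0]) (use lim_g0 p in simp_all)
    also have "(\<integral>\<^sup>+ x. ennreal (norm (g0 x) powr p) \<partial>lborel)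
        = (\<integral>\<^sup>+ x. ennreal (exp (- p * ln (norm x)) * \<bar>h (ln (norm (x::real^'n)))\<bar> powr p) \<partial>lborel)"
    proof (rule nn_integral_cong_AE)
      show "AE x in lborel. ennreal (norm (g0 x) powr p)
          = ennreal (exp (- p * ln (norm x)) * \<bar>h (ln (norm x))\<bar> powr p)"
        using gh ne0
      proof eventually_elim
        case (elim x)
        have "norm (g0 x) = exp (- ln (norm x)) * \<bar>h (ln (norm x))\<bar>"
          using elim by (simp add: power2_eq_square exp_minus field_simps)
        also have "\<dots> powr p = exp (- p * ln (norm x)) * \<bar>h (ln (norm x))\<bar> powr p"
          by (simp add: powr_mult exp_powr_real mult.commute)
        finally show ?case by simp
      qed
    qed
    also have "\<dots> = ennreal (N * unit_ball_vol N) * (\<integral>\<^sup>+t. ennreal (exp (N * t) * (exp (- p * t) * \<bar>h t\<bar> powr p)) \<partial>lborel)"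
      by (rule ln_norm) simp
    also have "(\<lambda>t. exp (N * t) * (exp (- p * t) * \<bar>h t\<bar> powr p)) = (\<lambda>t. exp ((N - p) * t) * \<bar>h t\<bar> powr p)"
      by (simp add: fun_eq_iff mult.assoc[symmetric] exp_add[symmetric] algebra_simps)
    finally show "ennreal (N * unit_ball_vol N) * (\<integral>\<^sup>+t. ennreal (exp ((N - p) * t) * \<bar>h t\<bar> powr p) \<partial>lborel) < \<infinity>" .
  qed
  moreover have "AE x in lborel. u x = F (ln (norm x))"
    using uu0 uF by eventually_elim simp
  moreover have "AE x in lborel. g x = (h (ln (norm x)) / norm x ^ 2) *\<^sub>R x"
    using gg0 gh by eventually_elim simp
  ultimately show thesis
    using F h int diff unfolding q0_def by (intro that[of F h]) auto
qed

section \<open>The ordinary differential equation of a radial solution\<close>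

text \<open>The weak equation tested with the radial lift of \<open>\<zeta>\<close>. All integrands are functions of \<open>ln |x|\<close>,
  and integration in polar coordinates contributes the factor \<open>exp (N * t)\<close>.\<close>

lemma profile_weak_form:
  fixes u :: "real ^ 'n \<Rightarrow> real" and g :: "real ^ 'n \<Rightarrow> real ^ 'n"
  defines "N \<equiv> real CARD('n)"
  assumes p: "1 < p" "p < N" "1 < q"
    and weak: "\<And>\<phi> :: real ^ 'n \<Rightarrow> real. test_function \<phi> \<Longrightarrow>
           (\<integral>x. (norm (g x) powr (p - 2) * (g x \<bullet> grad \<phi> x)
                  - \<mu> / norm x powr p * (\<bar>u x\<bar> powr (p - 2) * u x) * \<phi> x) \<partial>lebesgue)
           = (\<integral>x. \<bar>u x\<bar> powr (q - 2) * u x / norm x powr s * \<phi> x \<partial>lebesgue)"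
    and F: "continuous_on UNIV F" and h[measurable]: "h \<in> borel_measurable borel"
    and uF: "AE x in lborel. u x = F (ln (norm x))"
    and gh: "AE x in lborel. g x = (h (ln (norm x)) / norm x ^ 2) *\<^sub>R x"
    and Y: "\<And>a b. set_integrable lborel {a..b} (\<lambda>t. exp ((N - p) * t) * spow p (h t))"
    and \<zeta>: "test_line \<zeta>" "\<And>t. (\<zeta> has_real_derivative \<zeta>' t) (at t)"
  shows "(LINT t|lborel. exp ((N - p) * t) * spow p (h t) * \<zeta>' t)
       = (LINT t|lborel. (\<mu> * exp ((N - p) * t) * spow p (F t) + exp ((N - s) * t) * spow q (F t)) * \<zeta> t)"
proof -
  obtain L where L: "\<And>t. L < \<bar>t\<bar> \<Longrightarrow> \<zeta> t = 0" "\<And>t. L < \<bar>t\<bar> \<Longrightarrow> \<zeta>' t = 0"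
    and cont': "continuous_on UNIV \<zeta>'"
    using test_line_derivative[OF \<zeta>] by blast
  note cont = test_line_continuous[OF \<zeta>(1)]
  have cF: "continuous_on UNIV (\<lambda>t. spow p (F t))" "continuous_on UNIV (\<lambda>t. spow q (F t))"
    using F p by (auto intro: continuous_on_spow)
  have "continuous_on UNIV (spow p)" using p by (intro continuous_on_spow continuous_on_id)
  then have [measurable]: "spow p \<in> borel_measurable borel" by (rule borel_measurable_continuous_onI)
  have [measurable]: "\<zeta> \<in> borel_measurable borel" "\<zeta>' \<in> borel_measurable borel"
    "(\<lambda>t. spow p (F t)) \<in> borel_measurable borel" "(\<lambda>t. spow q (F t)) \<in> borel_measurable borel"
    using cont cont' cF by (auto intro: borel_measurable_continuous_onI)
  have spow_h[measurable]: "(\<lambda>t. spow p (h t)) \<in> borel_measurable borel" by measurable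
  define \<phi> :: "real ^ 'n \<Rightarrow> real" where "\<phi> = radial_lift \<zeta>"
  have \<phi>: "test_function \<phi>" unfolding \<phi>_def by (rule test_function_radial_lift[OF \<zeta>(1)])
  have grad: "grad \<phi> x = radial_lift (\<lambda>t. exp (- 2 * t) * \<zeta>' t) x *\<^sub>R x" for x
    unfolding \<phi>_def by (rule grad_eqI[OF has_derivative_radial_lift[OF \<zeta>(2) L(1)]])
  define K where "K t = exp (- p * t) * (spow p (h t) * \<zeta>' t - \<mu> * spow p (F t) * \<zeta> t)" for t
  define M where "M t = exp (- s * t) * spow q (F t) * \<zeta> t" for t
  have [measurable]: "K \<in> borel_measurable borel" "M \<in> borel_measurable borel"
    unfolding K_def M_def by measurable
  have ne0: "AE x in lborel. x \<noteq> (0::real^'n)" by (rule AE_lborel_singleton)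
  have powr_exp: "norm x powr a = exp (a * ln (norm x))" if "x \<noteq> 0" for x :: "real^'n" and a
    using that by (simp add: powr_def)
  have AE1: "AE x in lborel. norm (g x) powr (p - 2) * (g x \<bullet> grad \<phi> x)
                  - \<mu> / norm x powr p * (\<bar>u x\<bar> powr (p - 2) * u x) * \<phi> x = K (ln (norm x))"
    using uF gh ne0
  proof eventually_elim
    case (elim x)
    define t where "t = ln (norm x)"
    have e2: "exp t ^ 2 = exp (2 * t)" by (simp add: power2_eq_square exp_add[symmetric])
    have nx: "norm x = exp t" using elim(3) by (simp add: t_def)
    have g: "g x = (exp (- 2 * t) * h t) *\<^sub>R x"
      using elim(2) by (simp add: t_def[symmetric] nx e2 exp_minus divide_inverse mult.commute)
    have ng: "norm (g x) = exp (- t) * \<bar>h t\<bar>"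
      by (simp add: g abs_mult nx mult.commute mult.left_commute exp_add[symmetric])
    have xx: "x \<bullet> x = exp (2 * t)"
      using power2_norm_eq_inner[of x] by (simp add: nx e2)
    have "g x \<bullet> grad \<phi> x = exp (- 2 * t) * (h t * \<zeta>' t)"
      using elim(3) by (simp add: g grad radial_lift_def t_def[symmetric] xx exp_add[symmetric])
    then have "norm (g x) powr (p - 2) * (g x \<bullet> grad \<phi> x)
        = (exp (- t * (p - 2)) * exp (- 2 * t)) * (\<bar>h t\<bar> powr (p - 2) * h t * \<zeta>' t)"
      by (simp add: ng powr_mult exp_powr_real)
    also have "exp (- t * (p - 2)) * exp (- 2 * t) = exp (- p * t)"
      by (simp add: exp_add[symmetric] algebra_simps)
    finally have 1: "norm (g x) powr (p - 2) * (g x \<bullet> grad \<phi> x) = exp (- p * t) * (spow p (h t) * \<zeta>' t)"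
      by (simp add: spow_def)
    have 2: "\<mu> / norm x powr p * (\<bar>u x\<bar> powr (p - 2) * u x) * \<phi> x = exp (- p * t) * (\<mu> * spow p (F t) * \<zeta> t)"
      using elim(1,3) by (simp add: powr_exp t_def[symmetric] exp_minus spow_def \<phi>_def radial_lift_def divide_inverse)
    show ?case unfolding 1 2 by (simp add: K_def t_def[symmetric] right_diff_distrib)
  qed
  have AE2: "AE x in lborel. \<bar>u x\<bar> powr (q - 2) * u x / norm x powr s * \<phi> x = M (ln (norm x))"
    using uF ne0
  proof eventually_elim
    case (elim x)
    then show ?case
      by (simp add: powr_exp M_def exp_minus spow_def \<phi>_def radial_lift_def divide_inverse)
  qed
  have lift: "(\<integral>x. f x \<partial>lebesgue) = N * unit_ball_vol N * (LINT t|lborel. exp (N * t) * H t)"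
    if "AE x in lborel. f x = H (ln (norm x))" and [measurable]: "H \<in> borel_measurable borel"
    for f :: "real^'n \<Rightarrow> real" and H
  proof -
    have Hm: "(\<lambda>x::real^'n. H (ln (norm x))) \<in> borel_measurable lborel" by measurable
    have AE: "AE x in lebesgue. f x = H (ln (norm x))" using that(1) by (rule AE_completion)
    have Hm': "(\<lambda>x::real^'n. H (ln (norm x))) \<in> borel_measurable lebesgue"
      using Hm by (rule measurable_completion)
    have fm: "f \<in> borel_measurable lebesgue"
      by (rule borel_measurable_AE[OF Hm']) (use AE in eventually_elim, simp)
    have "(\<integral>x. f x \<partial>lebesgue) = (\<integral>x. H (ln (norm (x::real^'n))) \<partial>lebesgue)"
      by (rule integral_cong_AE[OF fm Hm' AE])
    also have "\<dots> = (LINT x|lborel. H (ln (norm (x::real^'n))))"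
      by (rule integral_completion[OF Hm])
    also have "\<dots> = N * unit_ball_vol N * (LINT t|lborel. exp (N * t) * H t)"
      using integral_ln_norm[where 'a = "real^'n", of H] by (simp add: N_def)
    finally show ?thesis .
  qed
  have C: "N * unit_ball_vol N \<noteq> 0"
    using p unit_ball_vol_pos[of N] by (simp add: N_def less_imp_neq[symmetric])
  have "N * unit_ball_vol N * (LINT t|lborel. exp (N * t) * K t) = N * unit_ball_vol N * (LINT t|lborel. exp (N * t) * M t)"
    using weak[OF \<phi>] lift[OF AE1] lift[OF AE2] by simp
  then have eq: "(LINT t|lborel. exp (N * t) * K t) = (LINT t|lborel. exp (N * t) * M t)"
    using C by simp
  have e: "exp (N * t) * exp (- a * t) = exp ((N - a) * t)" for a t
    by (simp add: exp_add[symmetric] algebra_simps)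
  have K: "exp (N * t) * K t = exp ((N - p) * t) * spow p (h t) * \<zeta>' t - \<mu> * exp ((N - p) * t) * spow p (F t) * \<zeta> t" for t
    unfolding K_def e[symmetric] by (simp add: algebra_simps)
  have M: "exp (N * t) * M t = exp ((N - s) * t) * spow q (F t) * \<zeta> t" for t
    unfolding M_def e[symmetric] by (simp add: algebra_simps)
  have i1: "integrable lborel (\<lambda>t. exp ((N - p) * t) * spow p (h t) * \<zeta>' t)"
    by (rule integrable_test_line[OF _ Y cont' L(2)]) simp_all
  have c2: "continuous_on UNIV (\<lambda>t. \<mu> * exp ((N - p) * t) * spow p (F t))"
    "continuous_on UNIV (\<lambda>t. exp ((N - s) * t) * spow q (F t))"
    using cF by (auto intro!: continuous_intros)
  have i2: "integrable lborel (\<lambda>t. \<mu> * exp ((N - p) * t) * spow p (F t) * \<zeta> t)"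
    by (rule integrable_test_line[OF _ set_integrable_continuous[OF c2(1)] cont L(1)]) simp_all
  have i3: "integrable lborel (\<lambda>t. exp ((N - s) * t) * spow q (F t) * \<zeta> t)"
    by (rule integrable_test_line[OF _ set_integrable_continuous[OF c2(2)] cont L(1)]) simp_all
  from eq have "(LINT t|lborel. exp ((N - p) * t) * spow p (h t) * \<zeta>' t)
      = (LINT t|lborel. \<mu> * exp ((N - p) * t) * spow p (F t) * \<zeta> t) + (LINT t|lborel. exp ((N - s) * t) * spow q (F t) * \<zeta> t)"
    unfolding K M using i1 i2 by simp
  also have "\<dots> = (LINT t|lborel. (\<mu> * exp ((N - p) * t) * spow p (F t) + exp ((N - s) * t) * spow q (F t)) * \<zeta> t)"
    using i2 i3 by (simp add: distrib_right)
  finally show ?thesis .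
qed

text \<open>By the lemma of du Bois-Reymond the flux \<open>Y\<close> agrees almost everywhere with a continuously
  differentiable function \<open>Z\<close>. Inverting the duality map gives a continuous version \<open>H\<close> of
  \<open>F'\<close>, so \<open>F\<close> is continuously differentiable as well. The powers of \<open>e\<^sup>t\<close> cancel in the
  rescaled system because \<open>\<kappa> p = N - p\<close> and \<open>\<kappa> q = N - s\<close>.\<close>

lemma solution_emden_fowler:
  fixes u :: "real ^ 'n \<Rightarrow> real" and p s \<mu> :: real
  defines "N \<equiv> real CARD('n)"
  defines "\<kappa> \<equiv> (N - p) / p" and "q \<equiv> crit_exp N p s"
  assumes p: "1 < p" "p < N" and s: "s < p" and sol: "pos_radial_solution p \<mu> s u"
  obtains V y where "emden_fowler p q \<kappa> \<mu> V y"
    "AE x in lebesgue. u x = exp (- \<kappa> * ln (norm x)) * V (ln (norm x))"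
proof -
  have \<kappa>: "0 < \<kappa>" "\<kappa> * p = N - p" using p by (simp_all add: \<kappa>_def)
  have qeq: "\<kappa> * q = N - s" using p by (simp add: \<kappa>_def q_def crit_exp_def)
  have pq: "p < q" using p s by (simp add: q_def crit_exp_def pos_less_divide_eq)
  have q: "1 < q" using p pq by simp
  from sol obtain g where D: "D1p_with_gradient p u g" and rad: "radial u"
    and pos: "AE x in lebesgue. 0 < u x"
    and weak: "\<And>\<phi>. test_function \<phi> \<Longrightarrow>
           (\<integral>x. (norm (g x) powr (p - 2) * (g x \<bullet> grad \<phi> x)
                  - \<mu> / norm x powr p * (\<bar>u x\<bar> powr (p - 2) * u x) * \<phi> x) \<partial>lebesgue)
           = (\<integral>x. \<bar>u x\<bar> powr (q - 2) * u x / norm x powr s * \<phi> x \<partial>lebesgue)"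
    unfolding pos_radial_solution_def weak_solution_def q_def N_def by blast
  obtain F h where F: "continuous_on UNIV F" and h[measurable]: "h \<in> borel_measurable borel"
    and int_h: "\<And>a b. set_integrable lborel {a..b} h"
    and F_diff: "\<And>a b. a \<le> b \<Longrightarrow> F b - F a = (LINT t:{a..b}|lborel. h t)"
    and uF: "AE x in lborel. u x = F (ln (norm x))"
    and gh: "AE x in lborel. g x = (h (ln (norm x)) / norm x ^ 2) *\<^sub>R x"
    and finF: "(\<integral>\<^sup>+t. ennreal (exp (N * t) * \<bar>F t\<bar> powr crit_exp N p 0) \<partial>lborel) < \<infinity>"
    and finh: "(\<integral>\<^sup>+t. ennreal (exp ((N - p) * t) * \<bar>h t\<bar> powr p) \<partial>lborel) < \<infinity>"
    using radial_profile[OF p(1) p(2)[unfolded N_def] D rad] unfolding N_def by blast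
  have Fm[measurable]: "F \<in> borel_measurable borel" using F by (rule borel_measurable_continuous_onI)
  have "continuous_on UNIV (spow p)" using p by (intro continuous_on_spow continuous_on_id)
  then have spm[measurable]: "spow p \<in> borel_measurable borel" by (rule borel_measurable_continuous_onI)
  define Y where "Y t = exp ((N - p) * t) * spow p (h t)" for t
  have Ym[measurable]: "Y \<in> borel_measurable borel" unfolding Y_def by measurable
  have Yint: "set_integrable lborel {a..b} Y" for a b
    unfolding set_integrable_def
  proof (rule Bochner_Integration.integrable_bound)
    define E where "E t = exp ((N - p) * t) * \<bar>h t\<bar> powr p" for t
    have "integrable lborel E"
      using finh unfolding E_def by (intro integrableI_nonneg) auto
    moreover have "integrable lborel (\<lambda>t. indicator {a..b} t *\<^sub>R exp ((N - p) * t))"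
      using set_integrable_continuous[of "\<lambda>t. exp ((N - p) * t)" a b]
      by (simp add: set_integrable_def continuous_intros)
    ultimately show "integrable lborel (\<lambda>t. indicator {a..b} t *\<^sub>R exp ((N - p) * t) + E t)"
      by (intro Bochner_Integration.integrable_add)
    show "AE t in lborel. norm (indicator {a..b} t *\<^sub>R Y t) \<le> norm (indicator {a..b} t *\<^sub>R exp ((N - p) * t) + E t)"
    proof (rule AE_I2)
      fix t
      have "\<bar>h t\<bar> powr (p - 1) \<le> 1 + \<bar>h t\<bar> powr p"
      proof (cases "\<bar>h t\<bar> \<le> 1")
        case True
        then have "\<bar>h t\<bar> powr (p - 1) \<le> 1" using p by (intro powr_le1) auto
        then show ?thesis by (simp add: add_increasing2)
      next
        case False
        then have "\<bar>h t\<bar> powr (p - 1) \<le> \<bar>h t\<bar> powr p" by (intro powr_mono) auto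
        then show ?thesis by simp
      qed
      then have "exp ((N - p) * t) * \<bar>h t\<bar> powr (p - 1) \<le> exp ((N - p) * t) * (1 + \<bar>h t\<bar> powr p)"
        by (intro mult_left_mono) auto
      then have "\<bar>Y t\<bar> \<le> exp ((N - p) * t) + E t"
        by (simp add: Y_def E_def abs_mult abs_spow distrib_left)
      moreover have "0 \<le> E t" by (simp add: E_def)
      ultimately show "norm (indicator {a..b} t *\<^sub>R Y t) \<le> norm (indicator {a..b} t *\<^sub>R exp ((N - p) * t) + E t)"
        by (cases "t \<in> {a..b}") auto
    qed
  qed measurable
  define S where "S t = \<mu> * exp ((N - p) * t) * spow p (F t) + exp ((N - s) * t) * spow q (F t)" for t
  have S: "continuous_on UNIV S"
    unfolding S_def using F p q by (intro continuous_intros continuous_on_spow) auto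
  obtain Z where dZ: "\<And>t. (Z has_real_derivative - S t) (at t)" and YZ: "AE t in lborel. Y t = Z t"
  proof (rule du_Bois_Reymond[OF Ym Yint S])
    fix \<zeta> \<zeta>' assume \<zeta>: "test_line \<zeta>" "\<And>t. (\<zeta> has_real_derivative \<zeta>' t) (at t)"
    show "(LINT t|lborel. Y t * \<zeta>' t) = (LINT t|lborel. S t * \<zeta> t)"
      unfolding Y_def S_def N_def
      by (rule profile_weak_form[OF p(1) p(2)[unfolded N_def] q weak F h uF gh Yint[unfolded Y_def N_def] \<zeta>])
  qed blast
  define H where "H t = spow (p / (p - 1)) (exp (- (N - p) * t) * Z t)" for t
  have p': "1 < p / (p - 1)" "(p - 1) * (p / (p - 1) - 1) = 1" using p by (auto simp: field_simps)
  have contZ: "continuous_on UNIV Z"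
    using dZ by (auto intro!: continuous_at_imp_continuous_on dest: DERIV_isCont)
  have contH: "continuous_on UNIV H"
    unfolding H_def by (intro continuous_on_spow continuous_intros contZ p')
  have hH: "AE t in lborel. h t = H t"
    using YZ
  proof eventually_elim
    case (elim t)
    have "exp (- (N - p) * t) * Z t = spow p (h t)"
      unfolding elim[symmetric] Y_def by (simp add: mult.assoc[symmetric] exp_add[symmetric] left_diff_distrib)
    then show ?case unfolding H_def using spow_inverse[OF p'(2)] by simp
  qed
  have [measurable]: "H \<in> borel_measurable borel" using contH by (rule borel_measurable_continuous_onI)
  have F_eq: "F t = F 0 + (LBINT s=0..ereal t. H s)" for t
  proof -
    have set_eq: "(LINT t:{a..b}|lborel. h t) = (LINT t:{a..b}|lborel. H t)" for a b
      by (rule set_lebesgue_integral_cong_AE) (use hH in auto)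
    note intH = set_integrable_continuous[OF contH]
    have z: "(LBINT s=0..ereal 0. H s) = 0"
      unfolding zero_ereal_def by (rule interval_integral_endpoints_same)
    show ?thesis
    proof (cases "0 \<le> t")
      case True
      then show ?thesis using F_diff[OF True] primitive_diff[OF intH True] set_eq z by simp
    next
      case False
      then have "t \<le> 0" by simp
      then show ?thesis using F_diff[of t 0] primitive_diff[OF intH, of t 0] set_eq z by simp
    qed
  qed
  have dF: "(F has_real_derivative H t) (at t)" for t
    using DERIV_add[OF DERIV_const[of "F 0"] has_real_derivative_primitive[OF contH, of t]]
    by (simp add: F_eq[symmetric])
  have "AE x in lborel. 0 < F (ln (norm (x::real^'n)))"
    using pos[unfolded AE_completion_iff] uF by eventually_elim simp
  then have Fpos: "AE t in lborel. 0 < F t"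
    by (intro AE_of_AE_ln_norm[where 'a = "real^'n"]) auto
  have F0: "0 \<le> F t" for t
  proof -
    have "closed {t. 0 \<le> F t}" by (intro closed_Collect_le continuous_on_const F)
    moreover have "AE t in lebesgue. t \<in> {t. 0 \<le> F t}"
      using AE_completion[OF Fpos] by eventually_elim simp
    ultimately show ?thesis using mem_closed_if_AE_lebesgue by blast
  qed
  have "\<exists>t. 0 < F t"
    by (rule eventually_happens'[OF _ Fpos]) (simp add: ae_filter_eq_bot_iff)
  define V where "V t = exp (\<kappa> * t) * F t" for t
  define y where "y t = exp (- \<kappa> * t) * Z t" for t
  have powr_V: "V t powr a = exp (\<kappa> * a * t) * F t powr a" for a t
  proof -
    have "V t powr a = exp (\<kappa> * t) powr a * F t powr a"
      using F0 by (simp add: V_def powr_mult)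
    also have "exp (\<kappa> * t) powr a = exp (\<kappa> * a * t)"
      by (simp add: exp_powr_real ac_simps)
    finally show ?thesis .
  qed
  have z: "spow (p / (p - 1)) (y t) = exp (\<kappa> * t) * H t" for t
  proof -
    have "exp (- \<kappa> * t) = exp (\<kappa> * (p - 1) * t) * exp (- (N - p) * t)"
      unfolding \<kappa>(2)[symmetric] exp_add[symmetric] by (simp add: algebra_simps)
    then have "y t = exp (\<kappa> * (p - 1) * t) * (exp (- (N - p) * t) * Z t)"
      by (simp only: y_def mult.assoc)
    then have "spow (p / (p - 1)) (y t) = exp (\<kappa> * (p - 1) * t) powr (p / (p - 1) - 1) * H t"
      by (simp only: H_def) (rule spow_mult, simp)
    also have "exp (\<kappa> * (p - 1) * t) powr (p / (p - 1) - 1) = exp (\<kappa> * t * ((p - 1) * (p / (p - 1) - 1)))"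
      unfolding exp_powr_real by (simp add: ac_simps)
    finally show ?thesis by (simp only: p'(2) mult_1_right)
  qed
  have ef: "emden_fowler p q \<kappa> \<mu> V y"
  proof
    show "1 < p" "p < q" "0 < \<kappa>" using p pq \<kappa> by auto
    show "0 \<le> V t" for t using F0 by (simp add: V_def)
    show "\<exists>t. 0 < V t" using \<open>\<exists>t. 0 < F t\<close> unfolding V_def by (meson exp_gt_zero mult_pos_pos)
    show "(V has_real_derivative \<kappa> * V t + spow (p / (p - 1)) (y t)) (at t)" for t
    proof -
      have "(V has_real_derivative exp (\<kappa> * t) * \<kappa> * F t + H t * exp (\<kappa> * t)) (at t)"
        unfolding V_def by (rule DERIV_mult[OF _ dF]) (auto intro!: derivative_eq_intros)
      then show ?thesis unfolding z by (simp add: V_def mult.commute mult.left_commute)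
    qed
    show "(y has_real_derivative - \<kappa> * y t - \<mu> * V t powr (p - 1) - V t powr (q - 1)) (at t)" for t
    proof -
      have "(y has_real_derivative exp (- \<kappa> * t) * - \<kappa> * Z t + - S t * exp (- \<kappa> * t)) (at t)"
        unfolding y_def by (rule DERIV_mult[OF _ dZ]) (auto intro!: derivative_eq_intros)
      also have "exp (- \<kappa> * t) * - \<kappa> * Z t + - S t * exp (- \<kappa> * t)
          = - \<kappa> * y t - (exp (- \<kappa> * t) * S t)"
        by (simp add: y_def)
      also have "exp (- \<kappa> * t) * S t = \<mu> * (exp (- \<kappa> * t) * exp ((N - p) * t)) * spow p (F t)
          + (exp (- \<kappa> * t) * exp ((N - s) * t)) * spow q (F t)"
        by (simp add: S_def distrib_left)
      also have "exp (- \<kappa> * t) * exp ((N - p) * t) = exp (\<kappa> * (p - 1) * t)"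
        unfolding \<kappa>(2)[symmetric] exp_add[symmetric] by (simp add: algebra_simps)
      also have "exp (- \<kappa> * t) * exp ((N - s) * t) = exp (\<kappa> * (q - 1) * t)"
        unfolding qeq[symmetric] exp_add[symmetric] by (simp add: algebra_simps)
      also have "- \<kappa> * y t - (\<mu> * exp (\<kappa> * (p - 1) * t) * spow p (F t) + exp (\<kappa> * (q - 1) * t) * spow q (F t))
          = - \<kappa> * y t - \<mu> * V t powr (p - 1) - V t powr (q - 1)"
        by (simp add: powr_V spow_nonneg[OF F0])
      finally show ?thesis .
    qed
    show "\<exists>t. V t < \<epsilon> \<and> \<bar>y t\<bar> < \<epsilon>" if "0 < \<epsilon>" for \<epsilon>
    proof (rule ccontr)
      assume "\<nexists>t. V t < \<epsilon> \<and> \<bar>y t\<bar> < \<epsilon>"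
      then have large: "\<epsilon> \<le> V t \<or> \<epsilon> \<le> \<bar>y t\<bar>" for t by (meson not_le)
      define q0 where "q0 = crit_exp N p 0"
      have q0: "\<kappa> * q0 = N" "0 < q0" using p by (simp_all add: q0_def crit_exp_def \<kappa>_def)
      \<comment> \<open>otherwise the integrand \<open>V powr q0 + \<bar>y\<bar> powr p'\<close> is at least \<open>\<delta>\<close> on the whole line\<close>
      define \<delta> where "\<delta> = min (\<epsilon> powr q0) (\<epsilon> powr (p / (p - 1)))"
      have \<delta>: "0 < \<delta>" using that by (simp add: \<delta>_def)
      have A: "exp (N * t) * \<bar>F t\<bar> powr q0 = V t powr q0" for t
        using F0 by (simp add: powr_V q0)
      have B: "exp ((N - p) * t) * \<bar>H t\<bar> powr p = \<bar>y t\<bar> powr (p / (p - 1))" for t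
      proof -
        have "\<bar>y t\<bar> powr (p / (p - 1)) = (\<bar>y t\<bar> powr (p / (p - 1) - 1)) powr p"
          using p by (simp add: powr_powr field_simps)
        also have "\<bar>y t\<bar> powr (p / (p - 1) - 1) = exp (\<kappa> * t) * \<bar>H t\<bar>"
          using z[of t] abs_spow[of "p / (p - 1)" "y t"] by (simp add: abs_mult)
        also have "(exp (\<kappa> * t) * \<bar>H t\<bar>) powr p = exp (\<kappa> * p * t) * \<bar>H t\<bar> powr p"
          by (simp add: powr_mult exp_powr_real mult.commute mult.left_commute)
        finally show ?thesis by (simp add: \<kappa>(2))
      qed
      have "\<delta> \<le> V t powr q0 + \<bar>y t\<bar> powr (p / (p - 1))" for t
      proof -
        have "\<epsilon> powr q0 \<le> V t powr q0 \<or> \<epsilon> powr (p / (p - 1)) \<le> \<bar>y t\<bar> powr (p / (p - 1))"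
          using large[of t] that q0 p by (auto intro!: powr_mono2)
        moreover have "0 \<le> V t powr q0" "0 \<le> \<bar>y t\<bar> powr (p / (p - 1))" by auto
        ultimately show ?thesis unfolding \<delta>_def by linarith
      qed
      then have "(\<integral>\<^sup>+t. ennreal \<delta> \<partial>(lborel :: real measure))
          \<le> (\<integral>\<^sup>+t. ennreal (exp (N * t) * \<bar>F t\<bar> powr q0) + ennreal (exp ((N - p) * t) * \<bar>H t\<bar> powr p) \<partial>lborel)"
        unfolding A B by (intro nn_integral_mono) (simp add: ennreal_leI flip: ennreal_plus)
      also have "\<dots> = (\<integral>\<^sup>+t. ennreal (exp (N * t) * \<bar>F t\<bar> powr q0) \<partial>lborel)
          + (\<integral>\<^sup>+t. ennreal (exp ((N - p) * t) * \<bar>H t\<bar> powr p) \<partial>lborel)"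
        by (rule nn_integral_add) simp_all
      also have "(\<integral>\<^sup>+t. ennreal (exp ((N - p) * t) * \<bar>H t\<bar> powr p) \<partial>lborel)
          = (\<integral>\<^sup>+t. ennreal (exp ((N - p) * t) * \<bar>h t\<bar> powr p) \<partial>lborel)"
        by (rule nn_integral_cong_AE) (use hH in eventually_elim, simp)
      also have "(\<integral>\<^sup>+t. ennreal (exp (N * t) * \<bar>F t\<bar> powr q0) \<partial>lborel) + \<dots> < \<infinity>"
        using finF finh by (simp add: q0_def)
      finally show False using \<delta> by (simp add: ennreal_mult_less_top)
    qed
  qed
  have "AE x in lborel. u x = exp (- \<kappa> * ln (norm x)) * V (ln (norm x))"
    using uF by eventually_elim (simp add: V_def mult.assoc[symmetric] exp_add[symmetric])
  then have "AE x in lebesgue. u x = exp (- \<kappa> * ln (norm x)) * V (ln (norm x))"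
    by (rule AE_completion)
  with ef show thesis by (rule that)
qed

section \<open>Uniqueness and asymptotics\<close>

lemma AE_lebesgue_scaleR:
  fixes Q :: "'a::euclidean_space \<Rightarrow> bool"
  assumes "AE x in lebesgue. Q x" "0 < \<tau>"
  shows "AE x in lebesgue. Q (\<tau> *\<^sub>R x)"
proof -
  interpret D: measurable_flow "\<lambda>t (x::'a). exp t *\<^sub>R x" "\<lambda>x. x" "\<lambda>t. exp (- real DIM('a) * t)"
    by (rule measurable_flow_dilation)
  have "AE x in lborel. Q x" using assms(1) by (simp add: AE_completion_iff)
  then obtain Z where Z: "Z \<in> null_sets lborel" "{x. \<not> Q x} \<subseteq> Z"
    by (auto elim!: AE_E simp: null_sets_def)
  then have [measurable]: "Z \<in> sets borel" by auto
  have "(\<integral>\<^sup>+x. indicator Z (exp (ln \<tau>) *\<^sub>R x) \<partial>lborel) = 0"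
    using D.nn_integral_flow[of "indicator Z" "ln \<tau>"] Z(1) by (simp add: null_sets_def)
  then have "AE x in lborel. indicator Z (exp (ln \<tau>) *\<^sub>R x) = (0::ennreal)"
    by (subst (asm) nn_integral_0_iff_AE) auto
  then have "AE x in lborel. Q (\<tau> *\<^sub>R x)"
    by eventually_elim (use Z(2) assms(2) in \<open>auto simp: indicator_def split: if_splits\<close>)
  then show ?thesis by (rule AE_completion)
qed

text \<open>For \<open>\<gamma> \<le> 0\<close> both \<open>\<bar>\<gamma>\<bar> powr p\<close> and \<open>- spow p \<gamma>\<close> decrease strictly, so \<open>\<Gamma>\<^sub>\<mu>\<close>
  has at most one root there.\<close>

lemma larger_root_pos:
  assumes "1 < p" "p < N" "\<gamma>\<^sub>1 < \<gamma>\<^sub>2" "Gamma_mu N p \<mu> \<gamma>\<^sub>1 = 0" "Gamma_mu N p \<mu> \<gamma>\<^sub>2 = 0"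
  shows "0 < \<gamma>\<^sub>2"
proof (rule ccontr)
  assume "\<not> 0 < \<gamma>\<^sub>2"
  then have ab: "\<bar>\<gamma>\<^sub>2\<bar> < \<bar>\<gamma>\<^sub>1\<bar>" using assms by auto
  have "\<bar>\<gamma>\<^sub>2\<bar> powr p < \<bar>\<gamma>\<^sub>1\<bar> powr p" using ab assms by (intro powr_less_mono2) auto
  then have 1: "(p - 1) * \<bar>\<gamma>\<^sub>2\<bar> powr p < (p - 1) * \<bar>\<gamma>\<^sub>1\<bar> powr p" using assms by simp
  have "spow p \<gamma>\<^sub>1 < spow p \<gamma>\<^sub>2" using assms by (simp add: spow_less_iff)
  then have 2: "(N - p) * spow p \<gamma>\<^sub>1 < (N - p) * spow p \<gamma>\<^sub>2" using assms by simp
  show False using 1 2 assms(4,5) unfolding Gamma_mu_def spow_def[symmetric] by linarith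
qed

lemma asymptotic_estimates_cong_AE:
  assumes "asymptotic_estimates a b C\<^sub>1 C\<^sub>2 u" "AE x in lebesgue. u x = v x"
  shows "asymptotic_estimates a b C\<^sub>1 C\<^sub>2 v"
proof -
  obtain w where w: "AE x in lebesgue. w x = u x"
    "(\<forall>x. x \<noteq> 0 \<longrightarrow> w differentiable (at x)) \<and>
        ((\<lambda>x. w x * norm x powr a) \<longlongrightarrow> C\<^sub>1) (at 0) \<and>
        ((\<lambda>x. w x * norm x powr b) \<longlongrightarrow> C\<^sub>2) at_infinity \<and>
        ((\<lambda>x. norm (grad w x) * norm x powr (a + 1)) \<longlongrightarrow> \<bar>a\<bar> * C\<^sub>1) (at 0) \<and>
        ((\<lambda>x. norm (grad w x) * norm x powr (b + 1)) \<longlongrightarrow> b * C\<^sub>2) at_infinity"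
    using assms(1) unfolding asymptotic_estimates_def by blast
  have "AE x in lebesgue. w x = v x" using w(1) assms(2) by eventually_elim simp
  with w(2) show ?thesis unfolding asymptotic_estimates_def by blast
qed

context
  fixes p s \<mu> :: real
  assumes pN: "1 < p" "p < real CARD('n::finite)" and s: "s < p"
begin

text \<open>A translation by \<open>\<sigma>\<close> of the rescaled profile is a dilation by \<open>exp \<sigma>\<close>.\<close>

lemma unique_up_to_dilation:
  fixes u v :: "real ^ 'n \<Rightarrow> real"
  assumes u: "pos_radial_solution p \<mu> s u" and v: "pos_radial_solution p \<mu> s v"
  shows "\<exists>\<tau>>0. AE x in lebesgue. v x = dilation p \<tau> u x"
proof -
  define \<kappa> where "\<kappa> = (real CARD('n) - p) / p"
  obtain V y where V: "emden_fowler p (crit_exp (real CARD('n)) p s) \<kappa> \<mu> V y"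
    and uV: "AE x in lebesgue. u x = exp (- \<kappa> * ln (norm x)) * V (ln (norm x))"
    using solution_emden_fowler[OF pN s u] unfolding \<kappa>_def by blast
  obtain W w where W: "emden_fowler p (crit_exp (real CARD('n)) p s) \<kappa> \<mu> W w"
    and vW: "AE x in lebesgue. v x = exp (- \<kappa> * ln (norm x)) * W (ln (norm x))"
    using solution_emden_fowler[OF pN s v] unfolding \<kappa>_def by blast
  obtain \<sigma> where \<sigma>: "\<And>t. W t = V (t + \<sigma>)" using emden_fowler_unique[OF V W] by blast
  have "AE x in lebesgue. x \<noteq> (0::real^'n)"
    by (rule AE_completion[OF AE_lborel_singleton])
  with vW AE_lebesgue_scaleR[OF uV exp_gt_zero[of \<sigma>]]
  have "AE x in lebesgue. v x = dilation p (exp \<sigma>) u x"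
  proof eventually_elim
    case (elim x)
    have ln: "ln (norm (exp \<sigma> *\<^sub>R x)) = ln (norm x) + \<sigma>"
      using elim(3) by (simp add: ln_mult)
    have "dilation p (exp \<sigma>) u x = exp (\<kappa> * \<sigma>) * u (exp \<sigma> *\<^sub>R x)"
      by (simp add: dilation_def \<kappa>_def[symmetric] exp_powr_real mult.commute)
    also have "\<dots> = (exp (\<kappa> * \<sigma>) * exp (- \<kappa> * (ln (norm x) + \<sigma>))) * W (ln (norm x))"
      unfolding elim(2) ln \<sigma> by simp
    also have "exp (\<kappa> * \<sigma>) * exp (- \<kappa> * (ln (norm x) + \<sigma>)) = exp (- \<kappa> * ln (norm x))"
      unfolding exp_add[symmetric] by (simp add: algebra_simps)
    finally show ?case using elim(1) by simp
  qed
  then show ?thesis by (intro exI[of _ "exp \<sigma>"]) simp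
qed

text \<open>The representative \<open>w\<close> is \<open>F (ln |x|)\<close>. The relation \<open>F' = - \<gamma> F\<close> with \<open>\<gamma> = spow p' \<theta>\<close> reduces
  the limits of the gradient to those of \<open>w\<close> and the convergence of \<open>\<gamma>\<close> to the roots.\<close>

lemma asymptotics:
  fixes u :: "real ^ 'n \<Rightarrow> real"
  assumes u: "pos_radial_solution p \<mu> s u" and ab: "a < b"
    and roots: "Gamma_mu (real CARD('n)) p \<mu> a = 0" "Gamma_mu (real CARD('n)) p \<mu> b = 0"
  shows "\<exists>C\<^sub>1>0. \<exists>C\<^sub>2>0. asymptotic_estimates a b C\<^sub>1 C\<^sub>2 u"
proof -
  define \<kappa> where "\<kappa> = (real CARD('n) - p) / p"
  obtain V y where V: "emden_fowler p (crit_exp (real CARD('n)) p s) \<kappa> \<mu> V y"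
    and uV: "AE x in lebesgue. u x = exp (- \<kappa> * ln (norm x)) * V (ln (norm x))"
    using solution_emden_fowler[OF pN s u] unfolding \<kappa>_def by blast
  interpret emden_fowler p "crit_exp (real CARD('n)) p s" \<kappa> \<mu> V y by fact
  have \<kappa>p: "\<kappa> * p = real CARD('n) - p" using pN by (simp add: \<kappa>_def)
  have P_root: "P (spow p \<gamma>) = - Gamma_mu (real CARD('n)) p \<mu> \<gamma>" for \<gamma>
  proof -
    have "\<bar>spow p \<gamma>\<bar> powr p' = \<bar>\<gamma>\<bar> powr p"
      unfolding abs_spow powr_powr p'(4) ..
    then show ?thesis unfolding P_def Gamma_mu_def spow_def[symmetric] \<kappa>p by simp
  qed
  have Pa: "P (spow p a) = 0" and Pb: "P (spow p b) = 0" using roots by (simp_all add: P_root)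
  have b: "0 < b" by (rule larger_root_pos[OF pN ab roots])
  obtain C1 where C1: "C1 > 0" "((\<lambda>t. V t * exp ((a - \<kappa>) * t)) \<longlongrightarrow> C1) at_bot"
    using limit_at_bot(1)[OF ab Pa Pb] by blast
  obtain C2 where C2: "C2 > 0" "((\<lambda>t. V t * exp ((b - \<kappa>) * t)) \<longlongrightarrow> C2) at_top"
    using limit_at_top(1)[OF ab Pa Pb] by blast
  define F where "F t = exp (- \<kappa> * t) * V t" for t
  have dF: "(F has_real_derivative - spow p' (\<theta> t) * F t) (at t)" for t
  proof -
    have "(F has_real_derivative exp (- \<kappa> * t) * - \<kappa> * V t + (\<kappa> - spow p' (\<theta> t)) * V t * exp (- \<kappa> * t)) (at t)"
      unfolding F_def by (rule DERIV_mult[OF _ dV_\<theta>]) (auto intro!: derivative_eq_intros)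
    then show ?thesis by (simp add: F_def algebra_simps)
  qed
  define w where "w x = F (ln (norm x))" for x :: "real ^ 'n"
  have dw: "(w has_derivative (\<lambda>h. ((- spow p' (\<theta> (ln (norm x))) * F (ln (norm x)) / norm x ^ 2) *\<^sub>R x) \<bullet> h)) (at x)"
    if "x \<noteq> 0" for x
    unfolding w_def by (rule has_derivative_ln_norm[OF that dF])
  have Fpos: "0 < F t" for t using V_pos by (simp add: F_def)
  have powr_exp: "norm x powr c = exp (c * ln (norm x))" if "x \<noteq> 0" for x :: "real^'n" and c
    using that by (simp add: powr_def)
  have w_eq: "w x * norm x powr c = V (ln (norm x)) * exp ((c - \<kappa>) * ln (norm x))" if "x \<noteq> 0" for x c
  proof -
    have "w x * norm x powr c = V (ln (norm x)) * (exp (- \<kappa> * ln (norm x)) * exp (c * ln (norm x)))"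
      by (simp add: w_def F_def powr_exp[OF that])
    then show ?thesis unfolding exp_add[symmetric] by (simp add: algebra_simps)
  qed
  have grad_eq: "norm (grad w x) * norm x powr (c + 1)
      = \<bar>spow p' (\<theta> (ln (norm x)))\<bar> * (V (ln (norm x)) * exp ((c - \<kappa>) * ln (norm x)))" if "x \<noteq> 0" for x c
  proof -
    have "norm (grad w x) = \<bar>spow p' (\<theta> (ln (norm x)))\<bar> * w x / norm x"
      using that Fpos[of "ln (norm x)"] unfolding grad_eqI[OF dw[OF that]]
      by (simp add: abs_mult w_def power2_eq_square)
    moreover have "norm x powr (c + 1) = norm x powr c * norm x" using that by (simp add: powr_add)
    ultimately show ?thesis using that by (simp add: w_eq[OF that, symmetric])
  qed
  have ln0: "filterlim (\<lambda>x::real^'n. ln (norm x)) at_bot (at 0)"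
  proof (rule filterlim_compose[OF ln_at_0])
    show "filterlim (\<lambda>x::real^'n. norm x) (at_right 0) (at 0)"
      by (auto simp: filterlim_at eventually_at_filter intro!: tendsto_eq_intros)
  qed
  have lninf: "filterlim (\<lambda>x::real^'n. ln (norm x)) at_top at_infinity"
    by (rule filterlim_compose[OF ln_at_top filterlim_norm_at_top])
  have ev0: "eventually (\<lambda>x. x \<noteq> (0::real^'n)) (at 0)" by (simp add: eventually_at_filter)
  have evinf: "eventually (\<lambda>x. x \<noteq> (0::real^'n)) at_infinity"
    unfolding eventually_at_infinity by (intro exI[of _ 1]) auto
  have "asymptotic_estimates a b C1 C2 u"
    unfolding asymptotic_estimates_def
  proof (intro exI[of _ w] conjI allI impI)
    show "AE x in lebesgue. w x = u x" using uV by eventually_elim (simp add: w_def F_def)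
    show "w differentiable (at x)" if "x \<noteq> 0" for x using dw[OF that] by (auto simp: differentiable_def)
    show "((\<lambda>x. w x * norm x powr a) \<longlongrightarrow> C1) (at 0)"
      by (rule Lim_transform_eventually[OF filterlim_compose[OF C1(2) ln0]])
         (use ev0 in eventually_elim, simp add: w_eq)
    show "((\<lambda>x. w x * norm x powr b) \<longlongrightarrow> C2) at_infinity"
      by (rule Lim_transform_eventually[OF filterlim_compose[OF C2(2) lninf]])
         (use evinf in eventually_elim, simp add: w_eq)
    have "((\<lambda>t. \<bar>spow p' (\<theta> t)\<bar> * (V t * exp ((a - \<kappa>) * t))) \<longlongrightarrow> \<bar>a\<bar> * C1) at_bot"
      by (intro tendsto_mult tendsto_rabs limit_at_bot(2)[OF ab Pa Pb] C1(2))
    from filterlim_compose[OF this ln0]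
    show "((\<lambda>x. norm (grad w x) * norm x powr (a + 1)) \<longlongrightarrow> \<bar>a\<bar> * C1) (at 0)"
      by (rule Lim_transform_eventually) (rule eventually_mono[OF ev0], rule grad_eq[symmetric])
    have "((\<lambda>t. \<bar>spow p' (\<theta> t)\<bar> * (V t * exp ((b - \<kappa>) * t))) \<longlongrightarrow> \<bar>b\<bar> * C2) at_top"
      by (intro tendsto_mult tendsto_rabs limit_at_top(2)[OF ab Pa Pb] C2(2))
    from filterlim_compose[OF this lninf]
    have "((\<lambda>x. norm (grad w x) * norm x powr (b + 1)) \<longlongrightarrow> \<bar>b\<bar> * C2) at_infinity"
      by (rule Lim_transform_eventually) (rule eventually_mono[OF evinf], rule grad_eq[symmetric])
    then show "((\<lambda>x. norm (grad w x) * norm x powr (b + 1)) \<longlongrightarrow> b * C2) at_infinity"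
      using b by simp
  qed
  with C1 C2 show ?thesis by blast
qed

end

theorem theorem1p4:
  fixes p \<mu> s :: real
  assumes "1 < p" and "p < real CARD('n)"
    and "\<mu> < ((real CARD('n) - p) / p) powr p"
    and "0 \<le> s" and "s < p"
  shows "(\<forall>u v :: real ^ 'n \<Rightarrow> real.
            pos_radial_solution p \<mu> s u \<and> pos_radial_solution p \<mu> s v \<longrightarrow>
            (\<exists>\<tau>>0. AE x in lebesgue. v x = dilation p \<tau> u x)) \<and>
         (\<forall>\<gamma>\<^sub>1 \<gamma>\<^sub>2. \<gamma>\<^sub>1 < \<gamma>\<^sub>2 \<and>
            Gamma_mu (real CARD('n)) p \<mu> \<gamma>\<^sub>1 = 0 \<and> Gamma_mu (real CARD('n)) p \<mu> \<gamma>\<^sub>2 = 0 \<longrightarrow>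
            (\<forall>u :: real ^ 'n \<Rightarrow> real. pos_radial_solution p \<mu> s u \<longrightarrow>
               (\<exists>C\<^sub>1>0. \<exists>C\<^sub>2>0. asymptotic_estimates \<gamma>\<^sub>1 \<gamma>\<^sub>2 C\<^sub>1 C\<^sub>2 u)) \<and>
            (\<exists>C\<^sub>1>0. \<exists>C\<^sub>2>0. \<forall>u :: real ^ 'n \<Rightarrow> real. pos_radial_solution p \<mu> s u \<longrightarrow>
               (\<exists>\<tau>>0. asymptotic_estimates \<gamma>\<^sub>1 \<gamma>\<^sub>2 C\<^sub>1 C\<^sub>2 (dilation p \<tau> u))))"
proof (intro conjI allI impI)
  fix u v :: "real ^ 'n \<Rightarrow> real"
  assume "pos_radial_solution p \<mu> s u \<and> pos_radial_solution p \<mu> s v"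
  then show "\<exists>\<tau>>0. AE x in lebesgue. v x = dilation p \<tau> u x"
    using unique_up_to_dilation[OF assms(1,2,5)] by blast
next
  fix a b and u :: "real ^ 'n \<Rightarrow> real"
  assume "a < b \<and> Gamma_mu (real CARD('n)) p \<mu> a = 0 \<and> Gamma_mu (real CARD('n)) p \<mu> b = 0"
    and "pos_radial_solution p \<mu> s u"
  then show "\<exists>C\<^sub>1>0. \<exists>C\<^sub>2>0. asymptotic_estimates a b C\<^sub>1 C\<^sub>2 u"
    using asymptotics[OF assms(1,2,5)] by blast
next
  fix a b
  assume ab: "a < b \<and> Gamma_mu (real CARD('n)) p \<mu> a = 0 \<and> Gamma_mu (real CARD('n)) p \<mu> b = 0"
  show "\<exists>C\<^sub>1>0. \<exists>C\<^sub>2>0. \<forall>u :: real ^ 'n \<Rightarrow> real. pos_radial_solution p \<mu> s u \<longrightarrow>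
               (\<exists>\<tau>>0. asymptotic_estimates a b C\<^sub>1 C\<^sub>2 (dilation p \<tau> u))"
  proof (cases "\<exists>u\<^sub>0 :: real ^ 'n \<Rightarrow> real. pos_radial_solution p \<mu> s u\<^sub>0")
    case True
    then obtain u\<^sub>0 :: "real ^ 'n \<Rightarrow> real" where u0: "pos_radial_solution p \<mu> s u\<^sub>0" ..
    obtain C\<^sub>1 C\<^sub>2 where C: "C\<^sub>1 > 0" "C\<^sub>2 > 0" "asymptotic_estimates a b C\<^sub>1 C\<^sub>2 u\<^sub>0"
      using asymptotics[OF assms(1,2,5) u0] ab by blast
    have "\<exists>\<tau>>0. asymptotic_estimates a b C\<^sub>1 C\<^sub>2 (dilation p \<tau> u)"
      if u: "pos_radial_solution p \<mu> s u" for u :: "real ^ 'n \<Rightarrow> real"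
    proof -
      obtain \<tau> where "\<tau> > 0" "AE x in lebesgue. u\<^sub>0 x = dilation p \<tau> u x"
        using unique_up_to_dilation[OF assms(1,2,5) u u0] by blast
      with C(3) show ?thesis using asymptotic_estimates_cong_AE by blast
    qed
    with C show ?thesis by blast
  next
    case False
    then show ?thesis using zero_less_one[where 'a = real] by blast
  qed
qed

end
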